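(* Let $M$ be a smooth manifold. Then there is a canonical linear injection of $\Gamma(TM)$ in $H_1(\mathcal V(M))$, where $\mathcal V(M)$ is the vertical (cotangent) Koszul-Vinberg algebroid of $M$ over $T^*M$.
   Context: Everything is smooth and real ($\mathbb F=\mathbb R$). $\Gamma(TM)$ is the vector space of smooth vector fields on $M$ and $p:T^*M\to M$ is the canonical projection. The vertical algebroid: the fibers of $p$ define a foliation of $T^*M$ whose tangent bundle is $\mathcal V(M)\subset T(T^*M)$. This foliation is Lagrangian for the Liouville symplectic form $\omega_\lambda$ on $T^*M$. The space of sections $\mathcal A=\Gamma(\mathcal V(M))$ carries the multiplication $ss'$ defined by $i(ss')\omega_\lambda=L_s\,i(s')\omega_\lambda$ ($L_s$ Lie derivative, $i$ inner product), which makes it a Koszul-Vinberg algebra, i.e. the associator $(a,b,c)=a(bc)-(ab)c$ satisfies $(a,b,c)=(b,a,c)$. The anchor is the inclusion of $\mathcal V(M)$ in $T(T^*M)$. Set $W=C^\infty(T^*M,\mathbb R)$ and $\mathcal G=\mathcal A\oplus W$ with multiplication $(s,f)(s',f')=(ss',\,ff'+s\cdot f')$, where $s\cdot f'$ is the derivative of $f'$ along the vector field $s$; $\mathcal G$ is a Koszul-Vinberg algebra. Homology: $C_0(\mathcal G,\mathcal G)=J(\mathcal G)=\{c\in\mathcal G: a(bc)=(ab)c\ \forall a,b\in\mathcal G\}$ and $C_q(\mathcal G,\mathcal G)=\mathrm{Hom}_{\mathbb R}(\bigotimes^q\mathcal G,\mathcal G)$ for $q>0$. The operators are $\delta_0(c)(a)=-ac+ca$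 for $c\in J(\mathcal G)$ and, for $\theta\in C_1(\mathcal G,\mathcal G)$, $(\delta_1\theta)(a,b)=-a\,\theta(b)+\theta(ab)-\theta(a)\,b$. Then $H_1(\mathcal V(M))=\ker\delta_1/\mathrm{im}\,\delta_0$. *)

theory Defs
  imports "HOL-Analysis.Analysis" "HOL-Library.Function_Algebras"
begin

text \<open>Functions into a real vector space form a real vector space under the pointwise operations.
  Vector fields, cochains, etc. below are all functions and use this structure.\<close>

instantiation "fun" :: (type, scaleR) scaleR
begin
definition scaleR_fun :: "real \<Rightarrow> ('a \<Rightarrow> 'b) \<Rightarrow> 'a \<Rightarrow> 'b"
  where "scaleR_fun c f = (\<lambda>x. c *\<^sub>R f x)"
instance ..
end

instance "fun" :: (type, real_vector) real_vector
  by standard (simp_all add: scaleR_fun_def fun_eq_iff scaleR_add_right scaleR_add_left)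

definition linear_map_on :: "'v::real_vector set \<Rightarrow> ('v \<Rightarrow> 'w::real_vector) \<Rightarrow> bool" where
  "linear_map_on V f \<longleftrightarrow>
     (\<forall>x\<in>V. \<forall>y\<in>V. f (x + y) = f x + f y) \<and> (\<forall>c. \<forall>x\<in>V. f (c *\<^sub>R x) = c *\<^sub>R f x)"


section \<open>Smooth manifolds\<close>

text \<open>A manifold is given by an atlas; its underlying set is the union of the chart domains.  The
  model space is a finite-dimensional normed space rather than a Euclidean space, so that the model
  \<open>E \<times> E*\<close> of a cotangent bundle is again of this kind and dimension zero is not excluded.
  The value of a chart outside its domain is irrelevant.\<close>

type_synonym ('a, 'e) chart = "'a set \<times> ('a \<Rightarrow> 'e)"
type_synonym ('a, 'e) atlas = "('a, 'e) chart set"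

text \<open>Over a finite-dimensional domain, continuity of all iterated directional derivatives is the
  usual notion of being \<open>k\<close> times continuously differentiable.\<close>

primrec k_smooth_on ::
  "nat \<Rightarrow> 'e::real_normed_vector set \<Rightarrow> ('e \<Rightarrow> 'f::real_normed_vector) \<Rightarrow> bool" where
  "k_smooth_on 0 S f \<longleftrightarrow> continuous_on S f"
| "k_smooth_on (Suc k) S f \<longleftrightarrow> (\<forall>x\<in>S. f differentiable (at x)) \<and>
     (\<forall>v. k_smooth_on k S (\<lambda>x. frechet_derivative f (at x) v))"

definition smooth_on :: "'e::real_normed_vector set \<Rightarrow> ('e \<Rightarrow> 'f::real_normed_vector) \<Rightarrow> bool" where
  "smooth_on S f \<longleftrightarrow> (\<forall>k. k_smooth_on k S f)"

definition points :: "('a, 'e) atlas \<Rightarrow> 'a set" where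
  "points M = \<Union> (fst ` M)"

definition smooth_atlas :: "('a, 'e::real_normed_vector) atlas \<Rightarrow> bool" where
  "smooth_atlas M \<longleftrightarrow>
     (\<forall>(U, \<phi>)\<in>M. inj_on \<phi> U \<and> open (\<phi> ` U)) \<and>
     (\<forall>(U, \<phi>)\<in>M. \<forall>(V, \<psi>)\<in>M.
        open (\<phi> ` (U \<inter> V)) \<and> smooth_on (\<phi> ` (U \<inter> V)) (\<psi> \<circ> inv_into U \<phi>))"

definition manifold_topology :: "('a, 'e::real_normed_vector) atlas \<Rightarrow> 'a topology" where
  "manifold_topology M =
     topology (\<lambda>W. W \<subseteq> points M \<and> (\<forall>(U, \<phi>)\<in>M. open (\<phi> ` (U \<inter> W))))"

lemma openin_manifold_topology:
  assumes "smooth_atlas M"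
  shows "openin (manifold_topology M) W \<longleftrightarrow>
    W \<subseteq> points M \<and> (\<forall>(U, \<phi>)\<in>M. open (\<phi> ` (U \<inter> W)))"
proof -
  have "istopology (\<lambda>W. W \<subseteq> points M \<and> (\<forall>(U, \<phi>)\<in>M. open (\<phi> ` (U \<inter> W))))"
    unfolding istopology_def
  proof (intro conjI allI impI)
    fix S T assume S: "S \<subseteq> points M \<and> (\<forall>(U, \<phi>)\<in>M. open (\<phi> ` (U \<inter> S)))"
      and T: "T \<subseteq> points M \<and> (\<forall>(U, \<phi>)\<in>M. open (\<phi> ` (U \<inter> T)))"
    show "S \<inter> T \<subseteq> points M" using S by blast
    show "\<forall>(U, \<phi>)\<in>M. open (\<phi> ` (U \<inter> (S \<inter> T)))"
    proof clarify
      fix U \<phi> assume c: "(U, \<phi>) \<in> M"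
      then have "inj_on \<phi> U" using assms by (auto simp: smooth_atlas_def)
      then have "\<phi> ` (U \<inter> (S \<inter> T)) = \<phi> ` (U \<inter> S) \<inter> \<phi> ` (U \<inter> T)"
        by (auto simp: inj_on_def)
      with c S T show "open (\<phi> ` (U \<inter> (S \<inter> T)))" by auto
    qed
  next
    fix K assume K: "\<forall>W\<in>K. W \<subseteq> points M \<and> (\<forall>(U, \<phi>)\<in>M. open (\<phi> ` (U \<inter> W)))"
    show "\<Union> K \<subseteq> points M" using K by blast
    show "\<forall>(U, \<phi>)\<in>M. open (\<phi> ` (U \<inter> \<Union> K))"
    proof clarify
      fix U \<phi> assume c: "(U, \<phi>) \<in> M"
      have eq: "\<phi> ` (U \<inter> \<Union> K) = (\<Union>W\<in>K. \<phi> ` (U \<inter> W))" by blast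
      have "open (\<phi> ` (U \<inter> W))" if "W \<in> K" for W using K c that by auto
      then show "open (\<phi> ` (U \<inter> \<Union> K))" unfolding eq by blast
    qed
  qed
  then show ?thesis by (simp add: manifold_topology_def)
qed

definition smooth_manifold :: "('a, 'e::real_normed_vector) atlas \<Rightarrow> bool" where
  "smooth_manifold M \<longleftrightarrow>
     (\<exists>B::'e set. finite B \<and> span B = UNIV) \<and>
     smooth_atlas M \<and>
     Hausdorff_space (manifold_topology M) \<and>
     second_countable (manifold_topology M)"

text \<open>Objects living on a subset of a type (functions on \<open>M\<close>, linear maps on a subspace, \<dots>) are
  represented by functions that are 0 outside that subset.\<close>

definition smooth_functions :: "('a, 'e::real_normed_vector) atlas \<Rightarrow> ('a \<Rightarrow> real) set" where
  "smooth_functions M = {f. (\<forall>x. x \<notin> points M \<longrightarrow> f x = 0) \<and>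
     (\<forall>(U, \<phi>)\<in>M. smooth_on (\<phi> ` U) (f \<circ> inv_into U \<phi>))}"


section \<open>Tangent vectors, vector fields, one-forms\<close>

text \<open>A tangent vector at \<open>x\<close> is identified with the derivation \<open>f \<mapsto> D(f \<circ> \<phi>\<^sup>-\<^sup>1)(\<phi> x) v\<close> that it
  induces on smooth functions; by the chain rule any chart \<open>\<phi>\<close> around \<open>x\<close> yields the same ones.\<close>

type_synonym 'a tangent = "('a \<Rightarrow> real) \<Rightarrow> real"
type_synonym 'a vfield = "'a \<Rightarrow> 'a tangent"

definition coordinate_vector ::
  "('a, 'e::real_normed_vector) atlas \<Rightarrow> ('a, 'e) chart \<Rightarrow> 'a \<Rightarrow> 'e \<Rightarrow> 'a tangent" where
  "coordinate_vector M c x v = (\<lambda>f. if f \<in> smooth_functions M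
     then frechet_derivative (f \<circ> inv_into (fst c) (snd c)) (at (snd c x)) v else 0)"

definition tangent_space :: "('a, 'e::real_normed_vector) atlas \<Rightarrow> 'a \<Rightarrow> 'a tangent set" where
  "tangent_space M x = {coordinate_vector M c x v | c v. c \<in> M \<and> x \<in> fst c}"

definition apply_vf :: "'a vfield \<Rightarrow> ('a \<Rightarrow> real) \<Rightarrow> 'a \<Rightarrow> real" where
  "apply_vf X f = (\<lambda>x. X x f)"

definition vector_fields :: "('a, 'e::real_normed_vector) atlas \<Rightarrow> 'a vfield set" where
  "vector_fields M = {X. (\<forall>x\<in>points M. X x \<in> tangent_space M x) \<and>
     (\<forall>x. x \<notin> points M \<longrightarrow> X x = 0) \<and>
     (\<forall>f\<in>smooth_functions M. apply_vf X f \<in> smooth_functions M)}"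

definition lie_bracket :: "'a vfield \<Rightarrow> 'a vfield \<Rightarrow> 'a vfield" where
  "lie_bracket X Y = (\<lambda>x f. X x (apply_vf Y f) - Y x (apply_vf X f))"

text \<open>Differential forms are represented by their values on vector fields, as
  \<open>C\<^sup>\<infinity>\<close>-multilinear maps; two one-forms are equal iff they agree on all vector fields.  The
  Lie derivative and the exterior derivative are given by the usual invariant formulas.\<close>

type_synonym 'a form1 = "'a vfield \<Rightarrow> 'a \<Rightarrow> real"
type_synonym 'a form2 = "'a vfield \<Rightarrow> 'a vfield \<Rightarrow> 'a \<Rightarrow> real"

definition lie_derivative :: "'a vfield \<Rightarrow> 'a form1 \<Rightarrow> 'a form1" where
  "lie_derivative X \<alpha> = (\<lambda>Y. apply_vf X (\<alpha> Y) - \<alpha> (lie_bracket X Y))"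

definition exterior_derivative :: "'a form1 \<Rightarrow> 'a form2" where
  "exterior_derivative \<alpha> = (\<lambda>X Y.
     apply_vf X (\<alpha> Y) - apply_vf Y (\<alpha> X) - \<alpha> (lie_bracket X Y))"

definition inner_product :: "'a vfield \<Rightarrow> 'a form2 \<Rightarrow> 'a form1" where
  "inner_product X \<omega> = (\<lambda>Y. \<omega> X Y)"


section \<open>The cotangent bundle and the Liouville form\<close>

type_synonym 'a covector = "'a \<times> ('a tangent \<Rightarrow> real)"

definition cotangent_space :: "('a, 'e::real_normed_vector) atlas \<Rightarrow> 'a \<Rightarrow> ('a tangent \<Rightarrow> real) set"
  where "cotangent_space M x = {\<xi>. linear_map_on (tangent_space M x) \<xi> \<and>
     (\<forall>v. v \<notin> tangent_space M x \<longrightarrow> \<xi> v = 0)}"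

text \<open>A chart \<open>(U, \<phi>)\<close> of \<open>M\<close> induces the chart \<open>(x, \<xi>) \<mapsto> (\<phi> x, \<xi> \<circ> D\<phi>(x)\<^sup>-\<^sup>1)\<close> with values in
  \<open>E \<times> E*\<close> on the part of the cotangent bundle over \<open>U\<close>.\<close>

definition cotangent_chart :: "('a, 'e::real_normed_vector) atlas \<Rightarrow> ('a, 'e) chart \<Rightarrow>
    ('a covector, 'e \<times> ('e \<Rightarrow>\<^sub>L real)) chart" where
  "cotangent_chart M c =
     ({(x, \<xi>). x \<in> fst c \<and> \<xi> \<in> cotangent_space M x},
      \<lambda>(x, \<xi>). (snd c x, Blinfun (\<lambda>v. \<xi> (coordinate_vector M c x v))))"

definition cotangent_bundle :: "('a, 'e::real_normed_vector) atlas \<Rightarrow>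
    ('a covector, 'e \<times> ('e \<Rightarrow>\<^sub>L real)) atlas" where
  "cotangent_bundle M = cotangent_chart M ` M"

text \<open>The differential of the projection \<open>p = fst\<close>: \<open>dp(w)(f) = w(f \<circ> p)\<close>.\<close>

definition dproj :: "('a, 'e::real_normed_vector) atlas \<Rightarrow> 'a covector tangent \<Rightarrow> 'a tangent" where
  "dproj M w = (\<lambda>f. if f \<in> smooth_functions M
     then w (\<lambda>q. if q \<in> points (cotangent_bundle M) then f (fst q) else 0) else 0)"

definition liouville :: "('a, 'e::real_normed_vector) atlas \<Rightarrow> 'a covector form1" where
  "liouville M = (\<lambda>Y q. if q \<in> points (cotangent_bundle M) then snd q (dproj M (Y q)) else 0)"

definition liouville_symplectic :: "('a, 'e::real_normed_vector) atlas \<Rightarrow> 'a covector form2" where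
  "liouville_symplectic M = exterior_derivative (liouville M)"


section \<open>The vertical Koszul-Vinberg algebroid and its first homology\<close>

text \<open>Sections of \<open>\<V>(M) = ker dp\<close>, the bundle tangent to the fibers of \<open>p\<close>.\<close>

definition vertical_fields :: "('a, 'e::real_normed_vector) atlas \<Rightarrow> 'a covector vfield set" where
  "vertical_fields M = {s \<in> vector_fields (cotangent_bundle M).
     \<forall>q\<in>points (cotangent_bundle M). dproj M (s q) = 0}"

definition vertical_mult :: "('a, 'e::real_normed_vector) atlas \<Rightarrow>
    'a covector vfield \<Rightarrow> 'a covector vfield \<Rightarrow> 'a covector vfield" where
  "vertical_mult M s s' = (THE t. t \<in> vertical_fields M \<and>
     (\<forall>Y\<in>vector_fields (cotangent_bundle M).
        inner_product t (liouville_symplectic M) Y =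
        lie_derivative s (inner_product s' (liouville_symplectic M)) Y))"

type_synonym 'a kv = "'a covector vfield \<times> ('a covector \<Rightarrow> real)"

definition kv_algebra :: "('a, 'e::real_normed_vector) atlas \<Rightarrow> 'a kv set" where
  "kv_algebra M = vertical_fields M \<times> smooth_functions (cotangent_bundle M)"

definition kv_mult :: "('a, 'e::real_normed_vector) atlas \<Rightarrow> 'a kv \<Rightarrow> 'a kv \<Rightarrow> 'a kv" where
  "kv_mult M a b =
     (vertical_mult M (fst a) (fst b), snd a * snd b + apply_vf (fst a) (snd b))"

definition chains0 :: "('a, 'e::real_normed_vector) atlas \<Rightarrow> 'a kv set" where
  "chains0 M = {c \<in> kv_algebra M. \<forall>a\<in>kv_algebra M. \<forall>b\<in>kv_algebra M.
     kv_mult M a (kv_mult M b c) = kv_mult M (kv_mult M a b) c}"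

definition chains1 :: "('a, 'e::real_normed_vector) atlas \<Rightarrow> ('a kv \<Rightarrow> 'a kv) set" where
  "chains1 M = {\<theta>. linear_map_on (kv_algebra M) \<theta> \<and>
     (\<forall>a\<in>kv_algebra M. \<theta> a \<in> kv_algebra M) \<and> (\<forall>a. a \<notin> kv_algebra M \<longrightarrow> \<theta> a = 0)}"

definition delta0 :: "('a, 'e::real_normed_vector) atlas \<Rightarrow> 'a kv \<Rightarrow> 'a kv \<Rightarrow> 'a kv" where
  "delta0 M c = (\<lambda>a. if a \<in> kv_algebra M then - kv_mult M a c + kv_mult M c a else 0)"

definition delta1 :: "('a, 'e::real_normed_vector) atlas \<Rightarrow>
    ('a kv \<Rightarrow> 'a kv) \<Rightarrow> 'a kv \<Rightarrow> 'a kv \<Rightarrow> 'a kv" where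
  "delta1 M \<theta> = (\<lambda>a b. if a \<in> kv_algebra M \<and> b \<in> kv_algebra M
     then - kv_mult M a (\<theta> b) + \<theta> (kv_mult M a b) - kv_mult M (\<theta> a) b else 0)"

definition cycles1 :: "('a, 'e::real_normed_vector) atlas \<Rightarrow> ('a kv \<Rightarrow> 'a kv) set" where
  "cycles1 M = {\<theta> \<in> chains1 M. delta1 M \<theta> = 0}"

definition boundaries1 :: "('a, 'e::real_normed_vector) atlas \<Rightarrow> ('a kv \<Rightarrow> 'a kv) set" where
  "boundaries1 M = delta0 M ` chains0 M"

text \<open>The quotient \<open>Z / B\<close> is the set of cosets of \<open>B\<close>, with the induced operations.\<close>

definition quotient_class :: "'v::real_vector set \<Rightarrow> 'v \<Rightarrow> 'v set" where
  "quotient_class B x = {x + b | b. b \<in> B}"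

definition coset_add :: "'v::real_vector set \<Rightarrow> 'v set \<Rightarrow> 'v set" where
  "coset_add P Q = {x + y | x y. x \<in> P \<and> y \<in> Q}"

definition coset_scale :: "'v::real_vector set \<Rightarrow> real \<Rightarrow> 'v set \<Rightarrow> 'v set" where
  "coset_scale B c P = {c *\<^sub>R x + b | x b. x \<in> P \<and> b \<in> B}"

definition homology1 :: "('a, 'e::real_normed_vector) atlas \<Rightarrow> ('a kv \<Rightarrow> 'a kv) set set" where
  "homology1 M = quotient_class (boundaries1 M) ` cycles1 M"


section \<open>The canonical map\<close>

text \<open>The cotangent (complete) lift of \<open>X\<close>: the vector field on the cotangent bundle that projects
  onto \<open>X\<close> and preserves the Liouville form.\<close>

definition is_cotangent_lift :: "('a, 'e::real_normed_vector) atlas \<Rightarrow>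
    'a vfield \<Rightarrow> 'a covector vfield \<Rightarrow> bool" where
  "is_cotangent_lift M X Y \<longleftrightarrow> Y \<in> vector_fields (cotangent_bundle M) \<and>
     (\<forall>q\<in>points (cotangent_bundle M). dproj M (Y q) = X (fst q)) \<and>
     (\<forall>Z\<in>vector_fields (cotangent_bundle M). lie_derivative Y (liouville M) Z = 0)"

definition lie_action :: "('a, 'e::real_normed_vector) atlas \<Rightarrow>
    'a covector vfield \<Rightarrow> 'a kv \<Rightarrow> 'a kv" where
  "lie_action M Y = (\<lambda>a. if a \<in> kv_algebra M
     then (lie_bracket Y (fst a), apply_vf Y (snd a)) else 0)"

end

theory Submission
  imports Defs
begin

text \<open>
  The cotangent lift \<open>Y\<close> of \<open>X\<close> is the solution of \<open>i(Y)\<omega> = - dH\<close> for \<open>H(x, \<xi>) = \<xi>(X x)\<close>.  It preserves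
  \<open>\<lambda>\<close>, hence \<open>\<omega> = d\<lambda>\<close> and the vertical foliation, so that the action of \<open>L\<^sub>Y\<close> is a derivation of the
  Koszul-Vinberg algebra, i.e. a cycle; \<open>Y\<close> is unique because \<open>\<omega>\<close> is nondegenerate.  If this cycle is
  the boundary of \<open>(s\<^sub>0, f\<^sub>0)\<close>, evaluation at \<open>(0, f)\<close> gives \<open>Y f = s\<^sub>0 f\<close> for all \<open>f\<close>, so \<open>Y\<close> is vertical and
  its projection \<open>X\<close> vanishes.
\<close>

section \<open>Finite-dimensional normed spaces\<close>

text \<open>The encoding shapes the proof. Tangent vectors are functionals on globally defined
  smooth functions and forms are tested on globally defined fields, so every passage from global
  data to a chart needs cut-offs: they recover the components of a field, and they extend a single
  vector to a field, which makes nondegeneracy of \<omega> usable at a point. The model space is an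
  abstract finite-dimensional normed space, so bounded coordinates and smooth bumps are built from a
  basis. The product of vertical fields is given only as the unique solution of an equation; its
  existence needs a local computation, in which a vertical field is \<open>(0, a)\<close> and the
  product differentiates \<open>a\<close> along the fibre. The derivation property is then checked
  without coordinates, because an identity between products may be tested by pairing both sides with
  \<omega>.\<close>

definition finite_dim :: "'e::real_normed_vector itself \<Rightarrow> bool" where
  "finite_dim _ \<longleftrightarrow> (\<exists>B::'e set. finite B \<and> span B = UNIV)"

text \<open>Stands in for an orthonormal basis of the abstract model space; boundedness of the
  coordinate functionals is carried by the type of \<open>l\<close>.\<close>

definition dual_frame :: "'e::real_normed_vector set \<Rightarrow> ('e \<Rightarrow> 'e \<Rightarrow>\<^sub>L real) \<Rightarrow> bool" where
  "dual_frame B l \<longleftrightarrow> finite B \<and> (\<forall>x. (\<Sum>b\<in>B. l b x *\<^sub>R b) = x)"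

text \<open>A cube is a Minkowski sum of segments, and the sum of two compact sets is compact. This
  is the compactness behind both the boundedness of coordinates and the compact supports of
  bumps.\<close>

lemma compact_coordinate_cube:
  fixes B :: "'e::real_normed_vector set"
  assumes "finite B"
  shows "compact {\<Sum>b\<in>B. c b *\<^sub>R b | c. \<forall>b\<in>B. \<bar>c b\<bar> \<le> r}"
  using assms
proof (induction B rule: finite_induct)
  case empty
  then show ?case by simp
next
  case (insert b B)
  let ?K = "{\<Sum>b\<in>B. c b *\<^sub>R b | c. \<forall>b\<in>B. \<bar>c b\<bar> \<le> r}"
  let ?L = "(\<lambda>t. t *\<^sub>R b) ` {-r..r}"
  have "compact ?L"
    by (intro compact_continuous_image continuous_intros) auto
  then have "compact {x + y | x y. x \<in> ?L \<and> y \<in> ?K}"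
    using compact_sums insert.IH by blast
  moreover have "{\<Sum>b\<in>insert b B. c b *\<^sub>R b | c. \<forall>b\<in>insert b B. \<bar>c b\<bar> \<le> r}
      = {x + y | x y. x \<in> ?L \<and> y \<in> ?K}" (is "?A = ?B")
  proof
    show "?A \<subseteq> ?B"
    proof
      fix x assume "x \<in> ?A"
      then obtain c where c: "x = (\<Sum>b\<in>insert b B. c b *\<^sub>R b)" "\<forall>b\<in>insert b B. \<bar>c b\<bar> \<le> r" by blast
      then have "x = c b *\<^sub>R b + (\<Sum>b\<in>B. c b *\<^sub>R b)" using insert by simp
      moreover have "c b *\<^sub>R b \<in> ?L" using c(2) by (auto simp: abs_le_iff)
      ultimately show "x \<in> ?B" using c(2) by blast
    qed
    show "?B \<subseteq> ?A"
    proof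
      fix z assume "z \<in> ?B"
      then obtain t c where t: "z = t *\<^sub>R b + (\<Sum>b\<in>B. c b *\<^sub>R b)" "t \<in> {-r..r}" "\<forall>b\<in>B. \<bar>c b\<bar> \<le> r" by blast
      let ?c = "c(b := t)"
      have "(\<Sum>b\<in>B. ?c b *\<^sub>R b) = (\<Sum>b\<in>B. c b *\<^sub>R b)"
        using insert by (intro sum.cong) auto
      then have "z = (\<Sum>b\<in>insert b B. ?c b *\<^sub>R b)" using insert t(1) by simp
      moreover have "\<forall>b\<in>insert b B. \<bar>?c b\<bar> \<le> r" using t by auto
      ultimately show "z \<in> ?A" by blast
    qed
  qed
  ultimately show ?case by simp
qed

text \<open>Equivalence of norms by hand: dividing by the coefficient of largest modulus moves the
  vector into a compact set that misses 0 by independence, and there the norm is bounded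
  below.\<close>

lemma independent_coordinates_bounded:
  fixes B :: "'e::real_normed_vector set"
  assumes "finite B" "independent B"
  obtains d where "d > 0" "\<And>c b. b \<in> B \<Longrightarrow> d * \<bar>c b\<bar> \<le> norm (\<Sum>b\<in>B. c b *\<^sub>R b)"
proof -
  \<comment> \<open>Combinations with coefficient 1 at \<open>b\<close> and all other coefficients
    in [-1, 1].\<close>
  define K where "K = (\<lambda>b. (\<lambda>y. b + y) ` {\<Sum>a\<in>B - {b}. c a *\<^sub>R a | c. \<forall>a\<in>B - {b}. \<bar>c a\<bar> \<le> (1::real)})"
  have "\<exists>d>0. \<forall>x\<in>K b. d \<le> norm x" if "b \<in> B" for b
  proof -
    have ne: "0 \<notin> K b"
    proof
      assume "0 \<in> K b"
      then obtain c where "b + (\<Sum>a\<in>B - {b}. c a *\<^sub>R a) = 0" by (auto simp: K_def)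
      then have "b = - (\<Sum>a\<in>B - {b}. c a *\<^sub>R a)" by (simp add: eq_neg_iff_add_eq_0)
      moreover have "(\<Sum>a\<in>B - {b}. c a *\<^sub>R a) \<in> span (B - {b})"
        by (intro span_sum span_scale span_base) auto
      ultimately have "b \<in> span (B - {b})" by (metis span_neg)
      then show False using assms(2) that by (auto simp: dependent_def)
    qed
    have "compact (K b)"
      unfolding K_def using assms(1) by (intro compact_continuous_image compact_coordinate_cube continuous_intros) auto
    then have "closed (K b)" by (rule compact_imp_closed)
    then obtain d where d: "d > 0" "ball 0 d \<subseteq> - K b"
      using ne open_contains_ball[of "- K b"] by (meson ComplI open_Compl)
    have "d \<le> norm x" if "x \<in> K b" for x
    proof (rule ccontr)
      assume "\<not> d \<le> norm x"
      then have "x \<in> ball 0 d" by simp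
      then show False using d(2) that by blast
    qed
    then show ?thesis using d(1) by blast
  qed
  then obtain e where e: "\<And>b. b \<in> B \<Longrightarrow> e b > 0" "\<And>b x. b \<in> B \<Longrightarrow> x \<in> K b \<Longrightarrow> e b \<le> norm x"
    by metis
  \<comment> \<open>The 1 keeps the minimum defined when \<open>B\<close> is empty.\<close>
  define d where "d = Min (insert 1 (e ` B))"
  have d: "d > 0" "\<And>b. b \<in> B \<Longrightarrow> d \<le> e b"
    unfolding d_def using assms(1) e(1) by auto
  have "d * \<bar>c b\<bar> \<le> norm (\<Sum>b\<in>B. c b *\<^sub>R b)" if b: "b \<in> B" for c b
  proof -
    obtain m where m: "m \<in> B" "\<And>a. a \<in> B \<Longrightarrow> \<bar>c a\<bar> \<le> \<bar>c m\<bar>"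
    proof -
      have "Max ((\<lambda>a. \<bar>c a\<bar>) ` B) \<in> (\<lambda>a. \<bar>c a\<bar>) ` B" using b assms(1) by (intro Max_in) auto
      then obtain m where "m \<in> B" "Max ((\<lambda>a. \<bar>c a\<bar>) ` B) = \<bar>c m\<bar>" by auto
      then show ?thesis using that[of m] assms(1) by (metis Max_ge finite_imageI imageI)
    qed
    show ?thesis
    proof (cases "c m = 0")
      case True
      then show ?thesis using m(2)[OF b] by simp
    next
      case False
      let ?x = "\<Sum>b\<in>B. c b *\<^sub>R b"
      have "?x = c m *\<^sub>R m + (\<Sum>a\<in>B - {m}. c a *\<^sub>R a)"
        using m(1) assms(1) by (simp add: sum.remove)
      then have "(1 / c m) *\<^sub>R ?x = m + (\<Sum>a\<in>B - {m}. (c a / c m) *\<^sub>R a)"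
        using False by (simp add: scaleR_add_right scaleR_sum_right)
      moreover have "\<bar>c a / c m\<bar> \<le> 1" if "a \<in> B" for a using m(2)[OF that] False by simp
      ultimately have "(1 / c m) *\<^sub>R ?x \<in> K m"
        unfolding K_def
        by (intro image_eqI[where x = "\<Sum>a\<in>B - {m}. (c a / c m) *\<^sub>R a"]) auto
      then have "d \<le> norm ((1 / c m) *\<^sub>R ?x)" using e(2) d(2) m(1) order_trans by blast
      then have "d * \<bar>c m\<bar> \<le> norm ?x" using False by (simp add: field_simps)
      moreover have "d * \<bar>c b\<bar> \<le> d * \<bar>c m\<bar>" using d(1) m(2)[OF b] by simp
      ultimately show ?thesis by linarith
    qed
  qed
  with d(1) show ?thesis using that by blast
qed

text \<open>A basis is extracted from the spanning set; the preceding estimate bounds each of its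
  coordinate functionals by \<open>1 / d\<close>.\<close>

lemma dual_frame_exists:
  assumes "finite_dim TYPE('e::real_normed_vector)"
  obtains B :: "'e::real_normed_vector set" and l where "dual_frame B l"
proof -
  obtain A :: "'e set" where A: "finite A" "span A = UNIV" using assms by (auto simp: finite_dim_def)
  obtain B where B: "B \<subseteq> A" "independent B" "A \<subseteq> span B" using maximal_independent_subset by blast
  have fin: "finite B" using A B finite_subset by blast
  have sp: "span B = UNIV" using A B by (metis span_mono span_span top.extremum_uniqueI)
  let ?r = "\<lambda>b v. representation B v b"
  have rep: "(\<Sum>b\<in>B. ?r b x *\<^sub>R b) = x" for x
    using B fin sp sum_representation_eq[of B x B] by auto
  obtain d where d: "d > 0" "\<And>c b. b \<in> B \<Longrightarrow> d * \<bar>c b\<bar> \<le> norm (\<Sum>b\<in>B. c b *\<^sub>R b)"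
    using independent_coordinates_bounded[OF fin B(2)] by blast
  have bl: "bounded_linear (?r b)" if "b \<in> B" for b
  proof (rule bounded_linear_intro)
    show "?r b (x + y) = ?r b x + ?r b y" for x y
      using B sp by (simp add: representation_add)
    show "?r b (r *\<^sub>R x) = r *\<^sub>R ?r b x" for r x
      using B sp by (simp add: representation_scale)
    show "norm (?r b x) \<le> norm x * (1 / d)" for x
      using d(2)[OF that, of "\<lambda>b. ?r b x"] d(1) by (simp add: rep field_simps)
  qed
  have "dual_frame B (\<lambda>b. Blinfun (?r b))"
    unfolding dual_frame_def using fin
    by (auto simp: bounded_linear_Blinfun_apply[OF bl] rep)
  then show ?thesis using that by blast
qed

lemma dual_frame_sum: "dual_frame B l \<Longrightarrow> (\<Sum>b\<in>B. l b x *\<^sub>R b) = x"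
  by (simp add: dual_frame_def)

lemma linear_imp_bounded_linear:
  fixes f :: "'e::real_normed_vector \<Rightarrow> 'f::real_normed_vector"
  assumes fd: "finite_dim TYPE('e)" and f: "linear f"
  shows "bounded_linear f"
proof -
  obtain B :: "'e set" and l where Bl: "dual_frame B l" using dual_frame_exists[OF fd] by blast
  have "f = (\<lambda>x. \<Sum>b\<in>B. l b x *\<^sub>R f b)"
  proof
    fix x
    have "f x = f (\<Sum>b\<in>B. l b x *\<^sub>R b)" by (simp add: dual_frame_sum[OF Bl])
    also have "\<dots> = (\<Sum>b\<in>B. l b x *\<^sub>R f b)"
      by (simp add: linear_sum[OF f] linear_scale[OF f])
    finally show "f x = (\<Sum>b\<in>B. l b x *\<^sub>R f b)" .
  qed
  moreover have "bounded_linear (\<lambda>x. \<Sum>b\<in>B. l b x *\<^sub>R f b)"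
    by (intro bounded_linear_intros)
  ultimately show ?thesis by simp
qed

lemma dual_frame_blinfun:
  fixes a :: "'e::real_normed_vector \<Rightarrow>\<^sub>L 'f::real_normed_vector"
  assumes "dual_frame B l"
  shows "a x = (\<Sum>b\<in>B. l b x *\<^sub>R a b)"
proof -
  have "a x = a (\<Sum>b\<in>B. l b x *\<^sub>R b)" by (simp add: dual_frame_sum[OF assms])
  also have "\<dots> = (\<Sum>b\<in>B. l b x *\<^sub>R a b)"
    by (simp add: blinfun.sum_right blinfun.scaleR_right)
  finally show ?thesis .
qed

text \<open>Cotangent charts take values in this space, so the theory of atlases below applies to
  the bundle as well. The functionals \<open>l b\<close> span the dual: \<open>a\<close> has
  coefficient \<open>a b\<close> on \<open>l b\<close>.\<close>

lemma finite_dim_prod_dual: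
  assumes fd: "finite_dim TYPE('e::real_normed_vector)"
  shows "finite_dim TYPE('e \<times> ('e \<Rightarrow>\<^sub>L real))"
proof -
  obtain B :: "'e set" and l where Bl: "dual_frame B l" using dual_frame_exists[OF fd] by blast
  let ?C = "(\<lambda>b. (b, 0)) ` B \<union> (\<lambda>b. (0, l b)) ` B :: ('e \<times> ('e \<Rightarrow>\<^sub>L real)) set"
  have "(x, a) \<in> span ?C" for x a
  proof -
    have "a = (\<Sum>b\<in>B. a b *\<^sub>R l b)"
      by (rule blinfun_eqI, subst dual_frame_blinfun[OF Bl, of a])
        (simp add: blinfun.sum_left blinfun.scaleR_left mult.commute)
    then have "(x, a) = (\<Sum>b\<in>B. l b x *\<^sub>R (b, 0)) + (\<Sum>b\<in>B. a b *\<^sub>R (0, l b))"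
      by (auto simp: prod_eq_iff fst_sum snd_sum dual_frame_sum[OF Bl])
    also have "\<dots> \<in> span ?C"
      by (intro span_add span_sum span_scale span_base) auto
    finally show ?thesis .
  qed
  then have "span ?C = UNIV" by auto
  moreover have "finite ?C" using Bl by (simp add: dual_frame_def)
  ultimately show ?thesis unfolding finite_dim_def by blast
qed

text \<open>Used to identify vectors known only through the scalar functions they
  differentiate.\<close>

lemma dual_separates:
  fixes v :: "'e::real_normed_vector"
  assumes fd: "finite_dim TYPE('e)" and "\<And>a::'e \<Rightarrow>\<^sub>L real. a v = 0"
  shows "v = 0"
proof -
  obtain B :: "'e set" and l where Bl: "dual_frame B l" using dual_frame_exists[OF fd] by blast
  have "v = (\<Sum>b\<in>B. l b v *\<^sub>R b)" by (simp add: dual_frame_sum[OF Bl])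
  then show ?thesis using assms(2) by simp
qed


section \<open>Calculus of smooth maps\<close>

abbreviation deriv_at :: "('e::real_normed_vector \<Rightarrow> 'f::real_normed_vector) \<Rightarrow> 'e \<Rightarrow> 'e \<Rightarrow> 'f" where
  "deriv_at f x \<equiv> frechet_derivative f (at x)"

lemma deriv_at_eq: "(f has_derivative f') (at x) \<Longrightarrow> deriv_at f x = f'"
  using frechet_derivative_at by metis

lemma deriv_at_cong:
  assumes "open S" "x \<in> S" "\<And>y. y \<in> S \<Longrightarrow> f y = g y"
  shows "deriv_at f x = deriv_at g x"
proof -
  have "(f has_derivative f') (at x) \<longleftrightarrow> (g has_derivative f') (at x)" for f'
    using assms has_derivative_transform_within_open[of f f' x UNIV S g]
      has_derivative_transform_within_open[of g f' x UNIV S f] by auto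
  then show ?thesis by (simp add: frechet_derivative_def)
qed

lemma differentiable_cong:
  assumes "open S" "x \<in> S" "\<And>y. y \<in> S \<Longrightarrow> f y = g y"
  shows "f differentiable (at x) \<longleftrightarrow> g differentiable (at x)"
proof -
  have "(f has_derivative f') (at x) \<longleftrightarrow> (g has_derivative f') (at x)" for f'
    using assms has_derivative_transform_within_open[of f f' x UNIV S g]
      has_derivative_transform_within_open[of g f' x UNIV S f] by auto
  then show ?thesis by (simp add: differentiable_def)
qed

text \<open>Derivatives are taken in the whole space, so equality on \<open>S\<close> passes to them
  because \<open>S\<close> is open.\<close>

lemma k_smooth_on_cong:
  assumes "open S" "\<And>x. x \<in> S \<Longrightarrow> f x = g x"
  shows "k_smooth_on k S f \<longleftrightarrow> k_smooth_on k S g"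
  using assms(2)
proof (induction k arbitrary: f g)
  case 0
  then show ?case using continuous_on_cong by force
next
  case (Suc k)
  have "deriv_at f x = deriv_at g x" if "x \<in> S" for x
    using deriv_at_cong[OF assms(1) that] Suc.prems by blast
  then have "k_smooth_on k S (\<lambda>x. deriv_at f x v) \<longleftrightarrow> k_smooth_on k S (\<lambda>x. deriv_at g x v)" for v
    using Suc.IH[of "\<lambda>x. deriv_at f x v" "\<lambda>x. deriv_at g x v"] by simp
  moreover have "f differentiable (at x) \<longleftrightarrow> g differentiable (at x)" if "x \<in> S" for x
    using differentiable_cong[OF assms(1) that] Suc.prems by blast
  ultimately show ?case by simp
qed

lemma k_smooth_on_subset: "k_smooth_on k S f \<Longrightarrow> T \<subseteq> S \<Longrightarrow> k_smooth_on k T f"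
  by (induction k arbitrary: f) (auto intro: continuous_on_subset)

lemma k_smooth_on_local:
  assumes "\<And>x. x \<in> S \<Longrightarrow> \<exists>T. open T \<and> x \<in> T \<and> k_smooth_on k T f"
  shows "k_smooth_on k S f"
  using assms
proof (induction k arbitrary: f)
  case 0
  have "isCont f x" if "x \<in> S" for x
    using 0[OF that] continuous_on_eq_continuous_at by auto
  then show ?case by (simp add: continuous_at_imp_continuous_on)
next
  case (Suc k)
  have "k_smooth_on k S (\<lambda>x. deriv_at f x v)" for v
    using Suc.prems by (intro Suc.IH) (auto, blast)
  moreover have "f differentiable (at x)" if "x \<in> S" for x
    using Suc.prems[OF that] by auto
  ultimately show ?case by simp
qed

lemma k_smooth_on_SucD: "k_smooth_on (Suc k) S f \<Longrightarrow> k_smooth_on k S f"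
proof (induction k arbitrary: f)
  case 0
  then have "isCont f x" if "x \<in> S" for x
    using that differentiable_imp_continuous_within[of f x UNIV] by auto
  then show ?case by (simp add: continuous_at_imp_continuous_on)
next
  case (Suc k)
  then show ?case by (metis k_smooth_on.simps(2))
qed

lemma k_smooth_on_SucI:
  assumes "open S" "\<And>x. x \<in> S \<Longrightarrow> (f has_derivative f' x) (at x)"
    and "\<And>v. k_smooth_on k S (\<lambda>x. f' x v)"
  shows "k_smooth_on (Suc k) S f"
proof -
  have "k_smooth_on k S (\<lambda>x. deriv_at f x v)" for v
    using k_smooth_on_cong[OF assms(1), of "\<lambda>x. deriv_at f x v" "\<lambda>x. f' x v"] assms(2,3) deriv_at_eq
    by metis
  then show ?thesis using assms(2) by (auto simp: differentiable_def)
qed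

lemma k_smooth_on_derivE:
  assumes "k_smooth_on (Suc k) S f" "x \<in> S"
  shows "(f has_derivative deriv_at f x) (at x)"
  using assms by (simp add: frechet_derivative_works)

lemma k_smooth_on_const: "k_smooth_on k S (\<lambda>x. c)"
  by (induction k arbitrary: c) auto

lemma k_smooth_on_bounded_linear:
  assumes "open S" "bounded_linear f"
  shows "k_smooth_on k S f"
proof (cases k)
  case 0
  then show ?thesis using assms linear_continuous_on by auto
next
  case (Suc j)
  have "k_smooth_on (Suc j) S f"
    by (rule k_smooth_on_SucI[where f' = "\<lambda>_. f"])
      (use assms in \<open>auto simp: k_smooth_on_const bounded_linear_imp_has_derivative\<close>)
  then show ?thesis using Suc by simp
qed

lemma k_smooth_on_add:
  assumes "open S" "k_smooth_on k S f" "k_smooth_on k S g"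
  shows "k_smooth_on k S (\<lambda>x. f x + g x)"
  using assms(2,3)
proof (induction k arbitrary: f g)
  case 0
  then show ?case by (auto intro: continuous_intros)
next
  case (Suc k)
  show ?case
    by (rule k_smooth_on_SucI[OF assms(1) has_derivative_add[OF k_smooth_on_derivE k_smooth_on_derivE]])
      (use Suc in auto)
qed

lemma (in bounded_bilinear) k_smooth_on_prod:
  assumes "open S" "k_smooth_on k S f" "k_smooth_on k S g"
  shows "k_smooth_on k S (\<lambda>x. prod (f x) (g x))"
  using assms(2,3)
proof (induction k arbitrary: f g)
  case 0
  then show ?case by (auto intro: continuous_on)
next
  case (Suc k)
  note S = k_smooth_on_SucD[OF Suc.prems(1)] k_smooth_on_SucD[OF Suc.prems(2)]
  show ?case
    by (rule k_smooth_on_SucI[OF assms(1) FDERIV[OF k_smooth_on_derivE k_smooth_on_derivE]])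
      (use Suc S assms(1) in \<open>auto intro!: k_smooth_on_add\<close>)
qed

lemma (in bounded_linear) k_smooth_on_comp:
  assumes "open S" "k_smooth_on k S g"
  shows "k_smooth_on k S (\<lambda>x. f (g x))"
  using assms(2)
proof (induction k arbitrary: g)
  case 0
  then show ?case by (auto intro: continuous_on)
next
  case (Suc k)
  show ?case
    by (rule k_smooth_on_SucI[OF assms(1) has_derivative[OF k_smooth_on_derivE]])
      (use Suc in auto)
qed

lemma k_smooth_on_sum:
  assumes "open S" "\<And>i. i \<in> I \<Longrightarrow> k_smooth_on k S (f i)"
  shows "k_smooth_on k S (\<lambda>x. \<Sum>i\<in>I. f i x)"
proof (cases "finite I")
  case True
  then show ?thesis using assms(2)
    by (induction I rule: finite_induct) (auto simp: k_smooth_on_const intro!: k_smooth_on_add[OF assms(1)])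
qed (simp add: k_smooth_on_const)

text \<open>The chain rule differentiates \<open>g\<close> in the direction
  \<open>deriv_at f x v\<close>, which moves with \<open>x\<close>, whereas smoothness is about
  fixed directions. Expanding that direction in a frame leaves finitely many fixed directions
  \<open>b\<close>, and the induction hypothesis handles \<open>deriv_at g (f x) b\<close>.\<close>

lemma k_smooth_on_compose:
  fixes f :: "'d::real_normed_vector \<Rightarrow> 'e::real_normed_vector" and g :: "'e \<Rightarrow> 'f::real_normed_vector"
  assumes fd: "finite_dim TYPE('e)" and "open S" "open T" "f ` S \<subseteq> T" "k_smooth_on k S f" "k_smooth_on k T g"
  shows "k_smooth_on k S (\<lambda>x. g (f x))"
proof -
  obtain B :: "'e set" and l where Bl: "dual_frame B l" using dual_frame_exists[OF fd] by blast
  show ?thesis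
    using assms(4-6)
  proof (induction k arbitrary: g)
    case 0
    then show ?case by (auto intro: continuous_on_compose2)
  next
    case (Suc k)
    let ?D = "\<lambda>x v. \<Sum>b\<in>B. l b (deriv_at f x v) *\<^sub>R deriv_at g (f x) b"
    show ?case
    proof (rule k_smooth_on_SucI[where f' = ?D])
      show "open S" by fact
      fix x assume x: "x \<in> S"
      have df: "(f has_derivative deriv_at f x) (at x)" using k_smooth_on_derivE Suc.prems(2) x by blast
      have dg: "(g has_derivative deriv_at g (f x)) (at (f x))"
        using k_smooth_on_derivE Suc.prems(1,3) x by blast
      have "deriv_at g (f x) (deriv_at f x v) = ?D x v" for v
      proof -
        have lin: "linear (deriv_at g (f x))" using dg by (simp add: has_derivative_linear)
        have "deriv_at g (f x) (\<Sum>b\<in>B. l b (deriv_at f x v) *\<^sub>R b) = ?D x v"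
          by (simp add: linear_sum[OF lin] linear_scale[OF lin])
        then show ?thesis by (simp add: dual_frame_sum[OF Bl])
      qed
      then show "((\<lambda>x. g (f x)) has_derivative ?D x) (at x)"
        using has_derivative_compose[OF df dg] by simp
    next
      fix v
      have f: "k_smooth_on k S f" using Suc.prems(2) by (rule k_smooth_on_SucD)
      show "k_smooth_on k S (\<lambda>x. ?D x v)"
      proof (intro k_smooth_on_sum bounded_bilinear.k_smooth_on_prod[OF bounded_bilinear_scaleR])
        fix b
        show "k_smooth_on k S (\<lambda>x. l b (deriv_at f x v))"
          using Suc.prems(2) by (intro bounded_linear.k_smooth_on_comp[OF blinfun.bounded_linear_right]) (auto simp: \<open>open S\<close>)
        show "k_smooth_on k S (\<lambda>x. deriv_at g (f x) b)"
          using Suc.prems f by (intro Suc.IH) auto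
      qed (use \<open>open S\<close> in auto)
    qed
  qed
qed

text \<open>The derivative is again built from \<open>inverse (f x)\<close>, but one order lower, so
  the induction closes.\<close>

lemma k_smooth_on_inverse:
  fixes f :: "'e::real_normed_vector \<Rightarrow> real"
  assumes "open S" "k_smooth_on k S f" "\<And>x. x \<in> S \<Longrightarrow> f x \<noteq> 0"
  shows "k_smooth_on k S (\<lambda>x. inverse (f x))"
  using assms(2)
proof (induction k)
  case 0
  then show ?case using assms(3) by (auto intro!: continuous_intros)
next
  case (Suc k)
  have inv: "k_smooth_on k S (\<lambda>x. inverse (f x))" using Suc.IH k_smooth_on_SucD[OF Suc.prems] by blast
  show ?case
  proof (rule k_smooth_on_SucI[where f' = "\<lambda>x v. (-1) * ((inverse (f x) * deriv_at f x v) * inverse (f x))"])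
    fix x assume x: "x \<in> S"
    show "((\<lambda>x. inverse (f x)) has_derivative (\<lambda>v. (-1) * ((inverse (f x) * deriv_at f x v) * inverse (f x)))) (at x)"
      using Deriv.has_derivative_inverse[OF assms(3)[OF x] k_smooth_on_derivE[OF Suc.prems x]] by simp
  next
    show "k_smooth_on k S (\<lambda>x. (-1) * ((inverse (f x) * deriv_at f x v) * inverse (f x)))" for v
      using Suc.prems by (intro bounded_bilinear.k_smooth_on_prod[OF bounded_bilinear_mult] inv k_smooth_on_const assms(1)) auto
  qed (fact assms(1))
qed

section \<open>Smooth maps of infinite order\<close>

lemma smooth_on_cong: "open S \<Longrightarrow> (\<And>x. x \<in> S \<Longrightarrow> f x = g x) \<Longrightarrow> smooth_on S f \<longleftrightarrow> smooth_on S g"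
  unfolding smooth_on_def using k_smooth_on_cong by blast

lemma smooth_on_congI: "open S \<Longrightarrow> smooth_on S g \<Longrightarrow> (\<And>x. x \<in> S \<Longrightarrow> f x = g x) \<Longrightarrow> smooth_on S f"
  using smooth_on_cong[of S f g] by blast

lemma smooth_on_subset: "smooth_on S f \<Longrightarrow> T \<subseteq> S \<Longrightarrow> smooth_on T f"
  unfolding smooth_on_def using k_smooth_on_subset by blast

lemma smooth_on_local: "(\<And>x. x \<in> S \<Longrightarrow> \<exists>T. open T \<and> x \<in> T \<and> smooth_on T f) \<Longrightarrow> smooth_on S f"
  unfolding smooth_on_def using k_smooth_on_local by meson

lemma smooth_on_deriv: "smooth_on S f \<Longrightarrow> smooth_on S (\<lambda>x. deriv_at f x v)"
  unfolding smooth_on_def using k_smooth_on.simps(2) by blast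

lemma smooth_on_has_derivative: "smooth_on S f \<Longrightarrow> x \<in> S \<Longrightarrow> (f has_derivative deriv_at f x) (at x)"
  unfolding smooth_on_def using k_smooth_on_derivE by blast

lemma smooth_on_continuous: "smooth_on S f \<Longrightarrow> continuous_on S f"
  unfolding smooth_on_def using k_smooth_on.simps(1) by blast

lemma smooth_on_const: "smooth_on S (\<lambda>x. c)"
  by (simp add: smooth_on_def k_smooth_on_const)

lemma smooth_on_bounded_linear: "open S \<Longrightarrow> bounded_linear f \<Longrightarrow> smooth_on S f"
  by (simp add: smooth_on_def k_smooth_on_bounded_linear)

lemma smooth_on_add: "open S \<Longrightarrow> smooth_on S f \<Longrightarrow> smooth_on S g \<Longrightarrow> smooth_on S (\<lambda>x. f x + g x)"
  by (simp add: smooth_on_def k_smooth_on_add)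

lemma smooth_on_bilinear:
  "bounded_bilinear p \<Longrightarrow> open S \<Longrightarrow> smooth_on S f \<Longrightarrow> smooth_on S g \<Longrightarrow> smooth_on S (\<lambda>x. p (f x) (g x))"
  by (simp add: smooth_on_def bounded_bilinear.k_smooth_on_prod)

lemma smooth_on_linear_comp:
  "bounded_linear L \<Longrightarrow> open S \<Longrightarrow> smooth_on S f \<Longrightarrow> smooth_on S (\<lambda>x. L (f x))"
  by (simp add: smooth_on_def bounded_linear.k_smooth_on_comp)

lemmas smooth_on_scaleR = smooth_on_bilinear[OF bounded_bilinear_scaleR]
lemmas smooth_on_mult = smooth_on_bilinear[OF bounded_bilinear_mult]
lemmas smooth_on_blinfun_apply = smooth_on_bilinear[OF bounded_bilinear_blinfun_apply]
lemmas smooth_on_fst = smooth_on_linear_comp[OF bounded_linear_fst]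
lemmas smooth_on_snd = smooth_on_linear_comp[OF bounded_linear_snd]
lemmas smooth_on_uminus = smooth_on_linear_comp[OF bounded_linear_minus[OF bounded_linear_ident]]

lemma smooth_on_diff: "open S \<Longrightarrow> smooth_on S f \<Longrightarrow> smooth_on S g \<Longrightarrow> smooth_on S (\<lambda>x. f x - g x)"
  using smooth_on_add[of S f "\<lambda>x. - g x"] smooth_on_uminus[of S g] by simp

lemma smooth_on_sum:
  "open S \<Longrightarrow> (\<And>i. i \<in> I \<Longrightarrow> smooth_on S (f i)) \<Longrightarrow> smooth_on S (\<lambda>x. \<Sum>i\<in>I. f i x)"
  by (simp add: smooth_on_def k_smooth_on_sum)

lemma smooth_on_Pair:
  assumes "open S" "smooth_on S f" "smooth_on S g"
  shows "smooth_on S (\<lambda>x. (f x, g x))"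
proof -
  have "smooth_on S (\<lambda>x. (f x, 0) + (0, g x))"
    using assms by (intro smooth_on_add smooth_on_linear_comp[where L = "\<lambda>y. (y, 0)"]
      smooth_on_linear_comp[where L = "\<lambda>y. (0, y)"] bounded_linear_Pair bounded_linear_ident bounded_linear_zero) auto
  then show ?thesis by simp
qed

lemma smooth_on_compose:
  fixes f :: "'d::real_normed_vector \<Rightarrow> 'e::real_normed_vector" and g :: "'e \<Rightarrow> 'f::real_normed_vector"
  assumes "finite_dim TYPE('e)" "open S" "open T" "\<And>x. x \<in> S \<Longrightarrow> f x \<in> T" "smooth_on S f" "smooth_on T g"
  shows "smooth_on S (\<lambda>x. g (f x))"
  using assms(4-6) k_smooth_on_compose[OF assms(1-3)] unfolding smooth_on_def by blast

lemma smooth_on_inverse: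
  "open S \<Longrightarrow> smooth_on S f \<Longrightarrow> (\<And>x. x \<in> S \<Longrightarrow> f x \<noteq> 0) \<Longrightarrow> smooth_on S (\<lambda>x. inverse (f x) :: real)"
  by (simp add: smooth_on_def k_smooth_on_inverse)

text \<open>This is the local form of a vector field acting on a function. The direction varies with
  the point, so it is again split along a frame.\<close>

lemma smooth_on_deriv_apply:
  fixes f :: "'e::real_normed_vector \<Rightarrow> 'f::real_normed_vector"
  assumes fd: "finite_dim TYPE('e)" and S: "open S" and f: "smooth_on S f" and g: "smooth_on S g"
  shows "smooth_on S (\<lambda>x. deriv_at f x (g x))"
proof -
  obtain B :: "'e set" and l where Bl: "dual_frame B l" using dual_frame_exists[OF fd] by blast
  have "deriv_at f x (g x) = (\<Sum>b\<in>B. l b (g x) *\<^sub>R deriv_at f x b)" if "x \<in> S" for x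
  proof -
    have lin: "linear (deriv_at f x)" using smooth_on_has_derivative[OF f that] by (rule has_derivative_linear)
    have "deriv_at f x (\<Sum>b\<in>B. l b (g x) *\<^sub>R b) = (\<Sum>b\<in>B. l b (g x) *\<^sub>R deriv_at f x b)"
      by (simp add: linear_sum[OF lin] linear_scale[OF lin])
    then show ?thesis by (simp add: dual_frame_sum[OF Bl])
  qed
  moreover have "smooth_on S (\<lambda>x. \<Sum>b\<in>B. l b (g x) *\<^sub>R deriv_at f x b)"
  proof (rule smooth_on_sum[OF S])
    fix b
    have "smooth_on S (\<lambda>x. l b (g x))"
      by (rule smooth_on_linear_comp[OF blinfun.bounded_linear_right S g])
    then show "smooth_on S (\<lambda>x. l b (g x) *\<^sub>R deriv_at f x b)"
      by (rule smooth_on_scaleR[OF S _ smooth_on_deriv[OF f]])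
  qed
  ultimately show ?thesis
    using smooth_on_cong[OF S, of "\<lambda>x. deriv_at f x (g x)" "\<lambda>x. \<Sum>b\<in>B. l b (g x) *\<^sub>R deriv_at f x b"] by simp
qed

text \<open>Reduces smoothness to scalar components, which are all that the action of a vector field
  on functions reveals.\<close>

lemma smooth_on_weak:
  fixes f :: "'d::real_normed_vector \<Rightarrow> 'e::real_normed_vector"
  assumes fd: "finite_dim TYPE('e)" and S: "open S" and f: "\<And>a::'e \<Rightarrow>\<^sub>L real. smooth_on S (\<lambda>x. a (f x))"
  shows "smooth_on S f"
proof -
  obtain B :: "'e set" and l where Bl: "dual_frame B l" using dual_frame_exists[OF fd] by blast
  have "smooth_on S (\<lambda>x. \<Sum>b\<in>B. l b (f x) *\<^sub>R b)"
    by (rule smooth_on_sum[OF S smooth_on_scaleR[OF S f smooth_on_const]])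
  then show ?thesis by (simp add: dual_frame_sum[OF Bl])
qed

lemma smooth_on_blinfun_pointwise:
  fixes f :: "'d::real_normed_vector \<Rightarrow> 'e::real_normed_vector \<Rightarrow>\<^sub>L real"
  assumes fd: "finite_dim TYPE('e)" and S: "open S" and f: "\<And>v. smooth_on S (\<lambda>x. f x v)"
  shows "smooth_on S f"
proof -
  obtain B :: "'e set" and l where Bl: "dual_frame B l" using dual_frame_exists[OF fd] by blast
  have "f x = (\<Sum>b\<in>B. f x b *\<^sub>R l b)" for x
    by (rule blinfun_eqI, subst dual_frame_blinfun[OF Bl, of "f x"])
      (simp add: blinfun.sum_left blinfun.scaleR_left mult.commute)
  moreover have "smooth_on S (\<lambda>x. \<Sum>b\<in>B. f x b *\<^sub>R l b)"
    by (rule smooth_on_sum[OF S smooth_on_scaleR[OF S f smooth_on_const]])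
  ultimately show ?thesis by simp
qed

section \<open>Symmetry of second derivatives\<close>

lemma directional_DERIV:
  fixes f :: "'e::real_normed_vector \<Rightarrow> real"
  assumes "f differentiable (at (p + s *\<^sub>R u))"
  shows "((\<lambda>s. f (p + s *\<^sub>R u)) has_field_derivative deriv_at f (p + s *\<^sub>R u) u) (at s)"
proof -
  have "((\<lambda>s. p + s *\<^sub>R u) has_derivative (\<lambda>h. h *\<^sub>R u)) (at s)"
    by (auto intro!: derivative_eq_intros)
  moreover have "(f has_derivative deriv_at f (p + s *\<^sub>R u)) (at (p + s *\<^sub>R u))"
    using assms by (simp add: frechet_derivative_works)
  ultimately have "((\<lambda>s. f (p + s *\<^sub>R u)) has_derivative (\<lambda>h. deriv_at f (p + s *\<^sub>R u) (h *\<^sub>R u))) (at s)"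
    by (rule has_derivative_compose)
  moreover have "deriv_at f (p + s *\<^sub>R u) (h *\<^sub>R u) = deriv_at f (p + s *\<^sub>R u) u * h" for h
    using linear_scale[OF linear_frechet_derivative[OF assms]] by simp
  ultimately show ?thesis by (simp add: has_field_derivative_def)
qed

text \<open>Two applications of the mean value theorem: along \<open>u\<close> to the difference of
  \<open>f\<close> and its translate by \<open>h v\<close>, then along \<open>v\<close> to the
  derivative in direction \<open>u\<close>.\<close>

lemma second_difference_mvt:
  fixes f :: "'e::real_normed_vector \<Rightarrow> real"
  assumes f: "k_smooth_on 2 S f" and h: "h > 0"
    and sub: "\<And>s t. 0 \<le> s \<Longrightarrow> s \<le> h \<Longrightarrow> 0 \<le> t \<Longrightarrow> t \<le> h \<Longrightarrow> x + s *\<^sub>R u + t *\<^sub>R v \<in> S"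
  obtains s t where "0 < s" "s < h" "0 < t" "t < h"
    "f (x + h *\<^sub>R u + h *\<^sub>R v) - f (x + h *\<^sub>R u) - f (x + h *\<^sub>R v) + f x
      = h * h * deriv_at (\<lambda>y. deriv_at f y u) (x + s *\<^sub>R u + t *\<^sub>R v) v"
proof -
  have f1: "f differentiable (at y)" if "y \<in> S" for y
    using f that by (simp add: numeral_2_eq_2)
  have f2: "(\<lambda>y. deriv_at f y u) differentiable (at y)" if "y \<in> S" for y
    using f that by (simp add: numeral_2_eq_2)
  let ?g = "\<lambda>s. f ((x + h *\<^sub>R v) + s *\<^sub>R u) - f (x + s *\<^sub>R u)"
  let ?g' = "\<lambda>s. deriv_at f ((x + h *\<^sub>R v) + s *\<^sub>R u) u - deriv_at f (x + s *\<^sub>R u) u"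
  have "DERIV ?g s :> ?g' s" if "0 \<le> s" "s \<le> h" for s
  proof (intro DERIV_diff directional_DERIV f1)
    show "x + h *\<^sub>R v + s *\<^sub>R u \<in> S" using sub[of s h] that h by (simp add: add_ac)
    show "x + s *\<^sub>R u \<in> S" using sub[of s 0] that h by simp
  qed
  then obtain s where s: "0 < s" "s < h" "?g h - ?g 0 = (h - 0) * ?g' s"
    using MVT2[OF h, of ?g ?g'] by blast
  let ?k = "\<lambda>t. deriv_at f ((x + s *\<^sub>R u) + t *\<^sub>R v) u"
  let ?k' = "\<lambda>t. deriv_at (\<lambda>y. deriv_at f y u) ((x + s *\<^sub>R u) + t *\<^sub>R v) v"
  have "DERIV ?k t :> ?k' t" if "0 \<le> t" "t \<le> h" for t
    by (rule directional_DERIV[of "\<lambda>y. deriv_at f y u"], rule f2) (use sub[of s t] s that in simp)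
  then obtain t where t: "0 < t" "t < h" "?k h - ?k 0 = (h - 0) * ?k' t"
    using MVT2[OF h, of ?k ?k'] by blast
  have "?g' s = ?k h - ?k 0" by (simp add: add_ac)
  then have "?g h - ?g 0 = h * (h * ?k' t)" using s(3) t(3) by simp
  then have "f (x + h *\<^sub>R u + h *\<^sub>R v) - f (x + h *\<^sub>R u) - f (x + h *\<^sub>R v) + f x = h * h * ?k' t"
    by (simp add: add_ac)
  then show ?thesis using that s(1,2) t(1,2) by blast
qed

text \<open>The second difference is symmetric in \<open>u\<close> and \<open>v\<close>, so in every
  small parallelogram at \<open>x\<close> some value of one mixed derivative equals some value of
  the other; continuity brings the equality to \<open>x\<close>.\<close>

lemma mixed_derivatives_commute:
  fixes f :: "'e::real_normed_vector \<Rightarrow> real"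
  assumes f: "smooth_on S f" and S: "open S" and x: "x \<in> S"
  shows "deriv_at (\<lambda>y. deriv_at f y u) x v = deriv_at (\<lambda>y. deriv_at f y v) x u"
proof -
  let ?A = "\<lambda>y. deriv_at (\<lambda>y. deriv_at f y u) y v" and ?B = "\<lambda>y. deriv_at (\<lambda>y. deriv_at f y v) y u"
  have cont: "isCont ?A x" "isCont ?B x"
    using smooth_on_continuous[OF smooth_on_deriv[OF smooth_on_deriv[OF f]]] S x
    by (auto simp: continuous_on_eq_continuous_at)
  have f2: "k_smooth_on 2 S f" using f by (simp add: smooth_on_def)
  have "dist (?A x) (?B x) < 2 * e" if e: "e > 0" for e
  proof -
    obtain d1 where d1: "d1 > 0" "\<And>y. dist y x < d1 \<Longrightarrow> dist (?A y) (?A x) < e"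
      using cont(1) e unfolding continuous_at_eps_delta by (auto simp: dist_norm)
    obtain d2 where d2: "d2 > 0" "\<And>y. dist y x < d2 \<Longrightarrow> dist (?B y) (?B x) < e"
      using cont(2) e unfolding continuous_at_eps_delta by (auto simp: dist_norm)
    obtain d3 where d3: "d3 > 0" "ball x d3 \<subseteq> S" using S x open_contains_ball by blast
    define d where "d = min d1 (min d2 d3)"
    \<comment> \<open>Small enough that \<open>s u + t v\<close> with \<open>s\<close>,
      \<open>t\<close> in [0, h] has norm below \<open>d\<close>; adding 1 covers the case that
      \<open>u\<close> and \<open>v\<close> are both 0.\<close>
    define h where "h = d / (2 * (norm u + norm v + 1))"
    have d: "d > 0" "d \<le> d1" "d \<le> d2" "d \<le> d3" using d1 d2 d3 by (auto simp: d_def)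
    have h: "h > 0" unfolding h_def using d(1) by (intro divide_pos_pos) (auto simp: add_nonneg_pos)
    have hb: "h * (norm u + norm v) < d"
    proof -
      have "h * (norm u + norm v) < h * (2 * (norm u + norm v + 1))"
        using h by (intro mult_strict_left_mono) (auto simp: add_nonneg_pos intro: add_nonneg_pos)
      also have "\<dots> = d"
      proof -
        have "norm u + norm v + 1 > 0" by (simp add: add_nonneg_pos)
        then show ?thesis by (simp add: h_def)
      qed
      finally show ?thesis .
    qed
    have near: "dist (x + s *\<^sub>R u + t *\<^sub>R v) x < d" if "0 \<le> s" "s \<le> h" "0 \<le> t" "t \<le> h" for s t
    proof -
      have "dist (x + s *\<^sub>R u + t *\<^sub>R v) x = norm (s *\<^sub>R u + t *\<^sub>R v)" by (simp add: dist_norm add_ac)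
      also have "\<dots> \<le> norm (s *\<^sub>R u) + norm (t *\<^sub>R v)" by (rule norm_triangle_ineq)
      also have "\<dots> \<le> h * norm u + h * norm v" using that by (auto intro!: add_mono mult_right_mono)
      finally show ?thesis using hb by (simp add: algebra_simps)
    qed
    have inS: "x + s *\<^sub>R u + t *\<^sub>R v \<in> S" if "0 \<le> s" "s \<le> h" "0 \<le> t" "t \<le> h" for s t
    proof -
      have "x + s *\<^sub>R u + t *\<^sub>R v \<in> ball x d3" using near[OF that] d(4) by (simp add: dist_commute)
      then show ?thesis using d3(2) by blast
    qed
    have inS': "x + s *\<^sub>R v + t *\<^sub>R u \<in> S" if "0 \<le> s" "s \<le> h" "0 \<le> t" "t \<le> h" for s t
      using inS[OF that(3,4,1,2)] by (simp add: add_ac)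
    obtain s t where st: "0 < s" "s < h" "0 < t" "t < h"
      "f (x + h *\<^sub>R u + h *\<^sub>R v) - f (x + h *\<^sub>R u) - f (x + h *\<^sub>R v) + f x = h * h * ?A (x + s *\<^sub>R u + t *\<^sub>R v)"
      using second_difference_mvt[OF f2 h inS] by blast
    obtain s' t' where st': "0 < s'" "s' < h" "0 < t'" "t' < h"
      "f (x + h *\<^sub>R v + h *\<^sub>R u) - f (x + h *\<^sub>R v) - f (x + h *\<^sub>R u) + f x = h * h * ?B (x + s' *\<^sub>R v + t' *\<^sub>R u)"
      using second_difference_mvt[OF f2 h inS'] by blast
    have "f (x + h *\<^sub>R v + h *\<^sub>R u) = f (x + h *\<^sub>R u + h *\<^sub>R v)" by (simp add: add_ac)
    then have "h * h * ?A (x + s *\<^sub>R u + t *\<^sub>R v) = h * h * ?B (x + s' *\<^sub>R v + t' *\<^sub>R u)"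
      using st(5) st'(5) by linarith
    then have eq: "?A (x + s *\<^sub>R u + t *\<^sub>R v) = ?B (x + s' *\<^sub>R v + t' *\<^sub>R u)" using h by simp
    have "dist (?A (x + s *\<^sub>R u + t *\<^sub>R v)) (?A x) < e"
      by (rule d1(2)) (use near[of s t] st d in linarith)
    moreover have "dist (?B (x + s' *\<^sub>R v + t' *\<^sub>R u)) (?B x) < e"
    proof (rule d2(2))
      have "dist (x + s' *\<^sub>R v + t' *\<^sub>R u) x < d" using near[of t' s'] st' by (simp add: add_ac)
      then show "dist (x + s' *\<^sub>R v + t' *\<^sub>R u) x < d2" using d by linarith
    qed
    ultimately show ?thesis using eq by (simp add: dist_real_def)
  qed
  \<comment> \<open>The estimate is contradictory when \<open>e\<close> is half of a positive
    distance.\<close>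
  then have "\<not> dist (?A x) (?B x) > 0" using field_sum_of_halves by (metis less_irrefl mult.commute half_gt_zero mult_2)
  then show ?thesis by simp
qed

lemma has_derivative_deriv_apply:
  fixes f :: "'e::real_normed_vector \<Rightarrow> 'f::real_normed_vector" and g :: "'e \<Rightarrow> 'e"
  assumes fd: "finite_dim TYPE('e)" and S: "open S" and f: "smooth_on S f" and g: "smooth_on S g" and x: "x \<in> S"
  shows "((\<lambda>z. deriv_at f z (g z)) has_derivative
    (\<lambda>u. deriv_at (\<lambda>z. deriv_at f z (g x)) x u + deriv_at f x (deriv_at g x u))) (at x)"
proof -
  obtain B :: "'e set" and l where Bl: "dual_frame B l" using dual_frame_exists[OF fd] by blast
  have expand: "deriv_at f z v = (\<Sum>b\<in>B. l b v *\<^sub>R deriv_at f z b)" if "z \<in> S" for z v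
  proof -
    have lin: "linear (deriv_at f z)" using smooth_on_has_derivative[OF f that] by (rule has_derivative_linear)
    have "deriv_at f z (\<Sum>b\<in>B. l b v *\<^sub>R b) = (\<Sum>b\<in>B. l b v *\<^sub>R deriv_at f z b)"
      by (simp add: linear_sum[OF lin] linear_scale[OF lin])
    then show ?thesis by (simp add: dual_frame_sum[OF Bl])
  qed
  note df = smooth_on_has_derivative[OF smooth_on_deriv[OF f] x]
  have "((\<lambda>z. \<Sum>b\<in>B. l b (g z) *\<^sub>R deriv_at f z b) has_derivative
      (\<lambda>u. \<Sum>b\<in>B. l b (g x) *\<^sub>R deriv_at (\<lambda>z. deriv_at f z b) x u + l b (deriv_at g x u) *\<^sub>R deriv_at f x b)) (at x)"
    by (intro has_derivative_sum has_derivative_scaleR df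
        bounded_linear.has_derivative[OF blinfun.bounded_linear_right smooth_on_has_derivative[OF g x]])
  moreover have "(\<Sum>b\<in>B. l b (g x) *\<^sub>R deriv_at (\<lambda>z. deriv_at f z b) x u + l b (deriv_at g x u) *\<^sub>R deriv_at f x b)
      = deriv_at (\<lambda>z. deriv_at f z (g x)) x u + deriv_at f x (deriv_at g x u)" for u
  proof -
    have "((\<lambda>z. \<Sum>b\<in>B. l b (g x) *\<^sub>R deriv_at f z b) has_derivative
        (\<lambda>u. \<Sum>b\<in>B. l b (g x) *\<^sub>R deriv_at (\<lambda>z. deriv_at f z b) x u)) (at x)"
      by (intro has_derivative_sum bounded_linear.has_derivative[OF bounded_linear_scaleR_right df])
    then have "deriv_at (\<lambda>z. \<Sum>b\<in>B. l b (g x) *\<^sub>R deriv_at f z b) x u = (\<Sum>b\<in>B. l b (g x) *\<^sub>R deriv_at (\<lambda>z. deriv_at f z b) x u)"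
      by (simp add: deriv_at_eq)
    moreover have "deriv_at (\<lambda>z. deriv_at f z (g x)) x = deriv_at (\<lambda>z. \<Sum>b\<in>B. l b (g x) *\<^sub>R deriv_at f z b) x"
      by (rule deriv_at_cong[OF S x expand])
    ultimately show ?thesis using expand[OF x, of "deriv_at g x u"] by (simp add: sum.distrib)
  qed
  ultimately have *: "((\<lambda>z. \<Sum>b\<in>B. l b (g z) *\<^sub>R deriv_at f z b) has_derivative
      (\<lambda>u. deriv_at (\<lambda>z. deriv_at f z (g x)) x u + deriv_at f x (deriv_at g x u))) (at x)" by simp
  show ?thesis
    by (rule has_derivative_transform_within_open[OF * S x]) (simp add: expand[symmetric])
qed


section \<open>Cut-off functions\<close>

text \<open>The powers of \<open>inverse x\<close> are included because they arise on
  differentiating exp(-1/x); the linear span of this family is closed under differentiation.\<close>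

definition flat_exp :: "nat \<Rightarrow> real \<Rightarrow> real" where
  "flat_exp n x = (if x > 0 then inverse x ^ n * exp (- inverse x) else 0)"

lemma flat_exp_tendsto_0: "(flat_exp n \<longlongrightarrow> 0) (at 0)"
proof (rule filterlim_split_at)
  have "eventually (\<lambda>x. flat_exp n x = 0) (at_left 0)"
    by (auto simp: eventually_at_filter flat_exp_def)
  then show "(flat_exp n \<longlongrightarrow> 0) (at_left 0)" by (rule tendsto_eventually)
  have "((\<lambda>x. inverse x ^ n / exp (inverse x)) \<longlongrightarrow> 0) (at_right (0::real))"
    by (rule filterlim_compose[OF tendsto_power_div_exp_0 filterlim_inverse_at_top_right])
  moreover have "eventually (\<lambda>x. inverse x ^ n / exp (inverse x) = flat_exp n x) (at_right 0)"
    by (auto simp: eventually_at_filter flat_exp_def exp_minus field_simps)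
  ultimately show "(flat_exp n \<longlongrightarrow> 0) (at_right 0)" by (rule Lim_transform_eventually)
qed

lemma flat_exp_DERIV: "DERIV (flat_exp n) x :> flat_exp (n + 2) x - real n * flat_exp (n + 1) x"
proof -
  consider "x > 0" | "x < 0" | "x = 0" by linarith
  then show ?thesis
  proof cases
    case 1
    have "DERIV (\<lambda>x. inverse x ^ n * exp (- inverse x)) x :> flat_exp (n + 2) x - real n * flat_exp (n + 1) x"
    proof -
      \<comment> \<open>For \<open>n = 0\<close> the truncated exponent \<open>n - 1\<close> is
        harmless, as the factor \<open>real n\<close> vanishes.\<close>
      have "inverse x ^ n * inverse x ^ 2 = inverse x ^ (n + 2)" "real n * inverse x ^ (n - 1) * inverse x ^ 2 = real n * inverse x ^ (n + 1)"
        by (cases n; simp add: power2_eq_square mult_ac)+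
      moreover have "DERIV (\<lambda>x. inverse x ^ n * exp (- inverse x)) x :>
        (inverse x ^ n * inverse x ^ 2) * exp (- inverse x) - (real n * inverse x ^ (n - 1) * inverse x ^ 2) * exp (- inverse x)"
        using 1 by (auto intro!: derivative_eq_intros simp: power2_eq_square)
      ultimately show ?thesis using 1 by (simp only: flat_exp_def if_True) (simp add: mult.assoc)
    qed
    then show ?thesis
      by (rule has_field_derivative_transform_within_open[where S = "{0<..}"]) (use 1 in \<open>auto simp: flat_exp_def\<close>)
  next
    case 2
    have "DERIV (\<lambda>x. 0) x :> flat_exp (n + 2) x - real n * flat_exp (n + 1) x"
      using 2 by (simp add: flat_exp_def)
    then show ?thesis
      by (rule has_field_derivative_transform_within_open[where S = "{..<0}"]) (use 2 in \<open>auto simp: flat_exp_def\<close>)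
  next
    case 3
    \<comment> \<open>Away from 0 the difference quotient of \<open>flat_exp n\<close> at 0 is
      \<open>flat_exp (n + 1)\<close>, which tends to 0.\<close>
    have "((\<lambda>h. (flat_exp n (0 + h) - flat_exp n 0) / h) \<longlongrightarrow> 0) (at 0)"
    proof (rule Lim_transform_eventually[OF flat_exp_tendsto_0[of "n + 1"]])
      show "\<forall>\<^sub>F h in at 0. flat_exp (n + 1) h = (flat_exp n (0 + h) - flat_exp n 0) / h"
        by (auto simp: eventually_at_filter flat_exp_def field_simps)
    qed
    then show ?thesis using 3 by (simp add: DERIV_def flat_exp_def)
  qed
qed

text \<open>The induction on the order runs over all \<open>n\<close> at once, since each derivative
  raises \<open>n\<close>.\<close>

lemma smooth_on_flat_exp: "smooth_on UNIV (flat_exp n)"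
proof -
  have "k_smooth_on k UNIV (flat_exp n)" for k
  proof (induction k arbitrary: n)
    case 0
    show ?case by (auto intro!: continuous_at_imp_continuous_on DERIV_isCont[OF flat_exp_DERIV])
  next
    case (Suc k)
    show ?case
    proof (rule k_smooth_on_SucI[where f' = "\<lambda>x v. (flat_exp (n + 2) x + (- real n) * flat_exp (n + 1) x) * v"])
      show "(flat_exp n has_derivative (\<lambda>v. (flat_exp (n + 2) x + (- real n) * flat_exp (n + 1) x) * v)) (at x)" for x
        using flat_exp_DERIV[of n x] by (simp add: has_field_derivative_def)
      show "k_smooth_on k UNIV (\<lambda>x. (flat_exp (n + 2) x + (- real n) * flat_exp (n + 1) x) * v)" for v
        by (rule bounded_bilinear.k_smooth_on_prod[OF bounded_bilinear_mult] k_smooth_on_const k_smooth_on_add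
            open_UNIV Suc.IH)+
    qed simp
  qed
  then show ?thesis by (simp add: smooth_on_def)
qed

lemma finite_dim_real: "finite_dim TYPE(real)"
  unfolding finite_dim_def
  by (intro exI[of _ "{1::real}"]) (auto simp: span_singleton intro: range_eqI[where f = "\<lambda>k. k * 1"])

lemma cutoff_exists:
  obtains H :: "real \<Rightarrow> real"
  where "smooth_on UNIV H" "\<And>t. t \<le> 1 / 2 \<Longrightarrow> H t = 1" "\<And>t. t \<ge> 1 \<Longrightarrow> H t = 0"
proof -
  let ?F = "flat_exp 0"
  \<comment> \<open>\<open>1 - t\<close> and \<open>t - 1 / 2\<close> are never both nonpositive, so
    the denominator is positive; the first is nonpositive from 1 on, which gives the value 0, the
    second up to 1/2, which gives the value 1.\<close>
  define H where "H = (\<lambda>t. ?F (1 - t) * inverse (?F (1 - t) + ?F (t - 1 / 2)))"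
  have pos: "?F (1 - t) + ?F (t - 1 / 2) \<noteq> 0" for t
    by (cases "t < 1") (auto simp: flat_exp_def add_pos_pos less_imp_neq[symmetric])
  have aff: "smooth_on UNIV (\<lambda>t::real. 1 - t)" "smooth_on UNIV (\<lambda>t::real. t - 1 / 2)"
    by (rule smooth_on_diff smooth_on_const smooth_on_bounded_linear bounded_linear_ident open_UNIV)+
  have F: "smooth_on UNIV (\<lambda>t. ?F (1 - t))" "smooth_on UNIV (\<lambda>t. ?F (t - 1 / 2))"
    using smooth_on_compose[OF finite_dim_real open_UNIV open_UNIV _ aff(1) smooth_on_flat_exp]
      smooth_on_compose[OF finite_dim_real open_UNIV open_UNIV _ aff(2) smooth_on_flat_exp] by auto
  have "smooth_on UNIV H"
    unfolding H_def
    by (rule smooth_on_mult[OF open_UNIV F(1) smooth_on_inverse[OF open_UNIV smooth_on_add[OF open_UNIV F] pos]])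
  moreover have "H t = 1" if "t \<le> 1 / 2" for t
    using that pos[of t] by (simp add: H_def flat_exp_def)
  moreover have "H t = 0" if "t \<ge> 1" for t
    using that by (simp add: H_def flat_exp_def)
  ultimately show ?thesis using that by blast
qed

text \<open>A norm need not be smooth, so the cut-off is applied to a quadratic form in the
  coordinates. Compactness of \<open>K\<close> is what later yields a closed set in a Hausdorff
  manifold.\<close>

lemma bump_function_exists:
  fixes x0 :: "'e::real_normed_vector"
  assumes fd: "finite_dim TYPE('e)" and S: "open S" and x0: "x0 \<in> S"
  obtains \<rho> :: "'e \<Rightarrow> real" and K W where "smooth_on UNIV \<rho>" "compact K" "K \<subseteq> S"
    "open W" "x0 \<in> W" "W \<subseteq> S" "\<And>x. x \<in> W \<Longrightarrow> \<rho> x = 1" "\<And>x. x \<notin> K \<Longrightarrow> \<rho> x = 0"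
proof -
  obtain B :: "'e set" and l where Bl: "dual_frame B l" using dual_frame_exists[OF fd] by blast
  have finB: "finite B" using Bl by (simp add: dual_frame_def)
  obtain H :: "real \<Rightarrow> real" where H: "smooth_on UNIV H" "\<And>t. t \<le> 1 / 2 \<Longrightarrow> H t = 1" "\<And>t. t \<ge> 1 \<Longrightarrow> H t = 0"
    using cutoff_exists by blast
  obtain e where e: "e > 0" "ball x0 e \<subseteq> S" using S x0 open_contains_ball by blast
  \<comment> \<open>With \<open>r = e / C\<close>, a vector whose coordinates are at most
    \<open>r\<close> in modulus has norm below \<open>e\<close>; the 1 makes the inequality strict
    and keeps \<open>C\<close> positive for empty \<open>B\<close>.\<close>
  define C where "C = (\<Sum>b\<in>B. norm b) + 1"
  have C: "C > 0" unfolding C_def by (simp add: add_nonneg_pos sum_nonneg)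
  define r where "r = e / C"
  have r: "r > 0" using e(1) C by (simp add: r_def)
  \<comment> \<open>Scaled so that \<open>Q x \<le> 1\<close> bounds every coordinate of
    \<open>x - x0\<close> by \<open>r\<close>.\<close>
  define Q where "Q = (\<lambda>x. (\<Sum>b\<in>B. l b (x - x0) * l b (x - x0)) * inverse (r * r))"
  have Qs: "smooth_on UNIV Q"
  proof -
    have "smooth_on UNIV (\<lambda>x. x - x0)"
      by (rule smooth_on_diff smooth_on_const smooth_on_bounded_linear bounded_linear_ident open_UNIV)+
    then have *: "smooth_on UNIV (\<lambda>x. l b (x - x0))" for b
      by (rule smooth_on_linear_comp[OF blinfun.bounded_linear_right open_UNIV])
    show ?thesis unfolding Q_def
      by (rule smooth_on_mult[OF open_UNIV smooth_on_sum[OF open_UNIV smooth_on_mult[OF open_UNIV * *]] smooth_on_const])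
  qed
  have Qc: "continuous_on UNIV Q" using smooth_on_continuous[OF Qs] .
  \<comment> \<open>The thresholds 1 and 1/2 are those of the cut-off \<open>H\<close>.\<close>
  define K where "K = {x. Q x \<le> 1}"
  define W where "W = {x. Q x < 1 / 2}"
  have coord: "\<bar>l b (x - x0)\<bar> \<le> r" if "x \<in> K" "b \<in> B" for x b
  proof -
    have "l b (x - x0) * l b (x - x0) \<le> (\<Sum>b\<in>B. l b (x - x0) * l b (x - x0))"
      using finB that(2) by (intro member_le_sum) auto
    also have "\<dots> \<le> r * r" using that(1) r by (simp add: K_def Q_def field_simps)
    finally show ?thesis using r abs_le_square_iff[of "l b (x - x0)" r] by (simp add: power2_eq_square)
  qed
  have KS: "K \<subseteq> S"
  proof
    fix x assume x: "x \<in> K"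
    have "norm (x - x0) = norm (\<Sum>b\<in>B. l b (x - x0) *\<^sub>R b)" by (simp add: dual_frame_sum[OF Bl])
    also have "\<dots> \<le> (\<Sum>b\<in>B. \<bar>l b (x - x0)\<bar> * norm b)" by (rule order_trans[OF norm_sum]) simp
    also have "\<dots> \<le> (\<Sum>b\<in>B. r * norm b)" using coord[OF x] by (intro sum_mono mult_right_mono) auto
    also have "\<dots> < r * C" using r by (simp add: C_def flip: sum_distrib_left)
    also have "\<dots> = e" using C by (simp add: r_def)
    finally have "x \<in> ball x0 e" by (simp add: dist_norm norm_minus_commute)
    then show "x \<in> S" using e(2) by blast
  qed
  have sub: "K \<subseteq> (\<lambda>y. x0 + y) ` {\<Sum>b\<in>B. c b *\<^sub>R b | c. \<forall>b\<in>B. \<bar>c b\<bar> \<le> r}"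
  proof
    fix x assume x: "x \<in> K"
    have "x = x0 + (\<Sum>b\<in>B. l b (x - x0) *\<^sub>R b)" by (simp add: dual_frame_sum[OF Bl])
    moreover have "(\<Sum>b\<in>B. l b (x - x0) *\<^sub>R b) \<in> {\<Sum>b\<in>B. c b *\<^sub>R b | c. \<forall>b\<in>B. \<bar>c b\<bar> \<le> r}"
      using coord[OF x] by (intro CollectI exI[of _ "\<lambda>b. l b (x - x0)"]) auto
    ultimately show "x \<in> (\<lambda>y. x0 + y) ` {\<Sum>b\<in>B. c b *\<^sub>R b | c. \<forall>b\<in>B. \<bar>c b\<bar> \<le> r}" by (rule image_eqI)
  qed
  have cube: "compact ((\<lambda>y. x0 + y) ` {\<Sum>b\<in>B. c b *\<^sub>R b | c. \<forall>b\<in>B. \<bar>c b\<bar> \<le> r})"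
    using finB by (intro compact_continuous_image compact_coordinate_cube continuous_intros) auto
  have cl: "closed K"
    unfolding K_def using Qc by (intro closed_Collect_le) (auto intro: continuous_intros)
  have "compact K" using closed_Int_compact[OF cl cube] sub by (simp add: Int_absorb2)
  moreover have "open W"
    unfolding W_def using Qc by (intro open_Collect_less) (auto intro: continuous_intros)
  moreover have "x0 \<in> W" by (simp add: W_def Q_def)
  moreover have "W \<subseteq> S" using KS by (auto simp: W_def K_def)
  moreover have "smooth_on UNIV (\<lambda>x. H (Q x))"
  proof -
    show ?thesis by (rule smooth_on_compose[OF finite_dim_real open_UNIV open_UNIV _ Qs H(1)]) auto
  qed
  moreover have "H (Q x) = 1" if "x \<in> W" for x using that by (intro H(2)) (simp add: W_def)
  moreover have "H (Q x) = 0" if "x \<notin> K" for x using that by (intro H(3)) (simp add: K_def)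
  ultimately show ?thesis using KS by (intro that[of "\<lambda>x. H (Q x)" K W])
qed

section \<open>Tangent vectors and vector fields on atlases with enough functions\<close>

lemma scaleR_fun_apply: "(r *\<^sub>R f) x = r *\<^sub>R f x"
  by (simp add: scaleR_fun_def)

lemma apply_vf_add_left: "apply_vf (X + Y) f = apply_vf X f + apply_vf Y f"
  by (rule ext) (simp add: apply_vf_def)

lemma apply_vf_scale_left: "apply_vf (r *\<^sub>R X) f = r *\<^sub>R apply_vf X f"
  by (rule ext) (simp add: apply_vf_def scaleR_fun_def)

lemma apply_vf_zero_left: "apply_vf 0 f = 0"
  by (rule ext) (simp add: apply_vf_def)

text \<open>The \<open>cutoff\<close> assumption holds for Hausdorff manifolds; for a cotangent bundle it is obtained
  from cut-off functions on the base alone, so that no bump functions along the fibers are needed.\<close>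

locale bump_atlas =
  fixes N :: "('a, 'e::real_normed_vector) atlas"
  assumes fd: "finite_dim TYPE('e)"
    and atlas: "smooth_atlas N"
    and cutoff: "\<And>U \<phi> x. (U, \<phi>) \<in> N \<Longrightarrow> x \<in> U \<Longrightarrow> \<exists>\<beta> W. x \<in> W \<and> W \<subseteq> U \<and> open (\<phi> ` W) \<and>
      (\<forall>y\<in>W. \<beta> y = (1::real)) \<and> smooth_on (\<phi> ` U) (\<beta> \<circ> inv_into U \<phi>) \<and>
      (\<forall>V \<psi> y. (V, \<psi>) \<in> N \<longrightarrow> y \<in> V \<longrightarrow> y \<notin> U \<longrightarrow>
        (\<exists>T. y \<in> T \<and> T \<subseteq> V \<and> open (\<psi> ` T) \<and> (\<forall>z\<in>T \<inter> U. \<beta> z = 0)))"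
begin

abbreviation cv :: "('a, 'e) chart \<Rightarrow> 'a \<Rightarrow> 'e \<Rightarrow> 'a tangent" where
  "cv \<equiv> coordinate_vector N"

lemma chart_open: "(U, \<phi>) \<in> N \<Longrightarrow> open (\<phi> ` U)"
  and chart_inj: "(U, \<phi>) \<in> N \<Longrightarrow> inj_on \<phi> U"
  using atlas by (auto simp: smooth_atlas_def)

lemma chart_inv: "(U, \<phi>) \<in> N \<Longrightarrow> x \<in> U \<Longrightarrow> inv_into U \<phi> (\<phi> x) = x"
  using chart_inj by (simp add: inv_into_f_f)

lemma overlap_open: "(U, \<phi>) \<in> N \<Longrightarrow> (V, \<psi>) \<in> N \<Longrightarrow> open (\<phi> ` (U \<inter> V))"
  and transition_smooth: "(U, \<phi>) \<in> N \<Longrightarrow> (V, \<psi>) \<in> N \<Longrightarrow> smooth_on (\<phi> ` (U \<inter> V)) (\<psi> \<circ> inv_into U \<phi>)"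
  using atlas by (auto simp: smooth_atlas_def)

lemma points_chart: "x \<in> points N \<Longrightarrow> \<exists>U \<phi>. (U, \<phi>) \<in> N \<and> x \<in> U"
  and chart_points: "(U, \<phi>) \<in> N \<Longrightarrow> x \<in> U \<Longrightarrow> x \<in> points N"
  by (auto simp: points_def) (metis fst_conv)

lemma smooth_function_local: "f \<in> smooth_functions N \<Longrightarrow> (U, \<phi>) \<in> N \<Longrightarrow> smooth_on (\<phi> ` U) (f \<circ> inv_into U \<phi>)"
  by (auto simp: smooth_functions_def)

lemma smooth_function_outside: "f \<in> smooth_functions N \<Longrightarrow> x \<notin> points N \<Longrightarrow> f x = 0"
  by (auto simp: smooth_functions_def)

lemma smooth_functionI:
  "(\<And>x. x \<notin> points N \<Longrightarrow> f x = 0) \<Longrightarrow> (\<And>U \<phi>. (U, \<phi>) \<in> N \<Longrightarrow> smooth_on (\<phi> ` U) (f \<circ> inv_into U \<phi>))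
    \<Longrightarrow> f \<in> smooth_functions N"
  by (auto simp: smooth_functions_def)

lemma smooth_function_zero: "0 \<in> smooth_functions N"
  by (rule smooth_functionI) (simp_all add: o_def smooth_on_const)

lemma smooth_function_add:
  assumes "f \<in> smooth_functions N" "g \<in> smooth_functions N"
  shows "f + g \<in> smooth_functions N"
  using smooth_on_add[OF chart_open smooth_function_local[OF assms(1)] smooth_function_local[OF assms(2)]]
  by (intro smooth_functionI) (simp_all add: assms smooth_function_outside o_def)

lemma smooth_function_mult:
  assumes "f \<in> smooth_functions N" "g \<in> smooth_functions N"
  shows "f * g \<in> smooth_functions N"
  using smooth_on_mult[OF chart_open smooth_function_local[OF assms(1)] smooth_function_local[OF assms(2)]]
  by (intro smooth_functionI) (simp_all add: assms smooth_function_outside o_def)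

lemma smooth_function_scale:
  assumes "f \<in> smooth_functions N"
  shows "r *\<^sub>R f \<in> smooth_functions N"
  using smooth_on_mult[OF chart_open smooth_on_const smooth_function_local[OF assms(1)]]
  by (intro smooth_functionI) (simp_all add: assms smooth_function_outside o_def scaleR_fun_def)

lemma smooth_function_diff:
  assumes "f \<in> smooth_functions N" "g \<in> smooth_functions N"
  shows "f - g \<in> smooth_functions N"
  using smooth_function_add[OF assms(1) smooth_function_scale[OF assms(2), of "-1"]] by simp

lemma transition_compose_smooth:
  assumes "(U, \<phi>) \<in> N" "(V, \<psi>) \<in> N" "smooth_on (\<phi> ` U) h"
  shows "smooth_on (\<psi> ` (V \<inter> U)) (\<lambda>w. h (\<phi> (inv_into V \<psi> w)))"
proof (rule smooth_on_compose[OF fd overlap_open[OF assms(2,1)] chart_open[OF assms(1)] _ _ assms(3)])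
  show "smooth_on (\<psi> ` (V \<inter> U)) (\<lambda>w. \<phi> (inv_into V \<psi> w))"
    using transition_smooth[OF assms(2,1)] by (simp add: o_def)
  show "\<phi> (inv_into V \<psi> w) \<in> \<phi> ` U" if "w \<in> \<psi> ` (V \<inter> U)" for w
    using that by (auto simp: chart_inv[OF assms(2)])
qed

text \<open>Around a point outside \<open>U\<close> the extension by zero is smooth because
  \<open>\<beta>\<close> vanishes on the nearby part of \<open>U\<close>. One \<open>\<beta>\<close>
  serves all \<open>g\<close>, as is needed to cut off a vector field, which acts on all functions
  at once.\<close>

lemma bump:
  assumes U: "(U, \<phi>) \<in> N" and x: "x \<in> U"
  shows "\<exists>\<beta> W. x \<in> W \<and> W \<subseteq> U \<and> open (\<phi> ` W) \<and> (\<forall>y\<in>W. \<beta> y = 1) \<and>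
    (\<forall>g. smooth_on (\<phi> ` U) g \<longrightarrow> (\<lambda>y. if y \<in> U then \<beta> y * g (\<phi> y) else 0) \<in> smooth_functions N)"
proof -
  obtain \<beta> :: "'a \<Rightarrow> real" and W where W: "x \<in> W" "W \<subseteq> U" "open (\<phi> ` W)" "\<forall>y\<in>W. \<beta> y = 1"
    and \<beta>: "smooth_on (\<phi> ` U) (\<beta> \<circ> inv_into U \<phi>)"
    and supp: "\<And>V \<psi> y. (V, \<psi>) \<in> N \<Longrightarrow> y \<in> V \<Longrightarrow> y \<notin> U \<Longrightarrow>
        \<exists>T. y \<in> T \<and> T \<subseteq> V \<and> open (\<psi> ` T) \<and> (\<forall>z\<in>T \<inter> U. \<beta> z = 0)"
    using cutoff[OF U x] by blast
  have "(\<lambda>y. if y \<in> U then \<beta> y * g (\<phi> y) else 0) \<in> smooth_functions N" (is "?G \<in> _")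
    if g: "smooth_on (\<phi> ` U) g" for g
  proof (rule smooth_functionI)
    show "?G y = 0" if "y \<notin> points N" for y using that chart_points[OF U] by auto
    fix V \<psi> assume V: "(V, \<psi>) \<in> N"
    show "smooth_on (\<psi> ` V) (?G \<circ> inv_into V \<psi>)"
    proof (rule smooth_on_local)
      fix z assume "z \<in> \<psi> ` V"
      then obtain y where y: "y \<in> V" "z = \<psi> y" by blast
      show "\<exists>T. open T \<and> z \<in> T \<and> smooth_on T (?G \<circ> inv_into V \<psi>)"
      proof (cases "y \<in> U")
        case True
        have "smooth_on (\<psi> ` (V \<inter> U)) (\<lambda>w. (\<beta> \<circ> inv_into U \<phi>) (\<phi> (inv_into V \<psi> w)) * g (\<phi> (inv_into V \<psi> w)))"
          by (rule smooth_on_mult[OF overlap_open[OF V U] transition_compose_smooth[OF U V \<beta>]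
                transition_compose_smooth[OF U V g]])
        then have "smooth_on (\<psi> ` (V \<inter> U)) (?G \<circ> inv_into V \<psi>)"
          by (rule smooth_on_congI[OF overlap_open[OF V U]]) (auto simp: chart_inv[OF V] chart_inv[OF U])
        then show ?thesis using overlap_open[OF V U] y True by blast
      next
        case False
        then obtain T where T: "y \<in> T" "T \<subseteq> V" "open (\<psi> ` T)" "\<forall>z\<in>T \<inter> U. \<beta> z = 0"
          using supp[OF V y(1)] by blast
        have "smooth_on (\<psi> ` T) (?G \<circ> inv_into V \<psi>)"
          by (rule smooth_on_congI[OF T(3) smooth_on_const[of _ 0]])
            (use T in \<open>auto simp: chart_inv[OF V] subset_iff\<close>)
        then show ?thesis using T y by blast
      qed
    qed
  qed
  then show ?thesis using W by blast
qed

lemma local_extension: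
  assumes "(U, \<phi>) \<in> N" "x \<in> U" "smooth_on (\<phi> ` U) g"
  obtains f W where "f \<in> smooth_functions N" "x \<in> W" "W \<subseteq> U" "open (\<phi> ` W)" "\<And>y. y \<in> W \<Longrightarrow> f y = g (\<phi> y)"
proof -
  obtain \<beta> W where *: "x \<in> W" "W \<subseteq> U" "open (\<phi> ` W)" "\<forall>y\<in>W. \<beta> y = 1"
    "\<forall>g. smooth_on (\<phi> ` U) g \<longrightarrow> (\<lambda>y. if y \<in> U then \<beta> y * g (\<phi> y) else 0) \<in> smooth_functions N"
    using bump[OF assms(1,2)] by blast
  then show ?thesis using assms(3) that[of "\<lambda>y. if y \<in> U then \<beta> y * g (\<phi> y) else 0" W]
    by (simp add: subset_iff)
qed

section \<open>Coordinate vectors and tangent spaces\<close>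

lemma local_has_derivative:
  assumes "f \<in> smooth_functions N" "(U, \<phi>) \<in> N" "x \<in> U"
  shows "((f \<circ> inv_into U \<phi>) has_derivative deriv_at (f \<circ> inv_into U \<phi>) (\<phi> x)) (at (\<phi> x))"
  using smooth_on_has_derivative[OF smooth_function_local[OF assms(1,2)]] assms(3) by blast

lemma cv_apply: "f \<in> smooth_functions N \<Longrightarrow> cv (U, \<phi>) x v f = deriv_at (f \<circ> inv_into U \<phi>) (\<phi> x) v"
  and cv_outside: "f \<notin> smooth_functions N \<Longrightarrow> cv c x v f = 0"
  by (simp_all add: coordinate_vector_def)

lemma cv_linear:
  assumes "(U, \<phi>) \<in> N" "x \<in> U"
  shows cv_add: "cv (U, \<phi>) x (v + w) = cv (U, \<phi>) x v + cv (U, \<phi>) x w"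
    and cv_scale: "cv (U, \<phi>) x (r *\<^sub>R v) = r *\<^sub>R cv (U, \<phi>) x v"
    and cv_zero: "cv (U, \<phi>) x 0 = 0"
proof -
  have lin: "linear (deriv_at (f \<circ> inv_into U \<phi>) (\<phi> x))" if "f \<in> smooth_functions N" for f
    using local_has_derivative[OF that assms] by (rule has_derivative_linear)
  show "cv (U, \<phi>) x (v + w) = cv (U, \<phi>) x v + cv (U, \<phi>) x w"
    by (rule ext) (simp add: coordinate_vector_def linear_add[OF lin])
  show "cv (U, \<phi>) x (r *\<^sub>R v) = r *\<^sub>R cv (U, \<phi>) x v"
    by (rule ext) (simp add: coordinate_vector_def linear_scale[OF lin] scaleR_fun_def)
  show "cv (U, \<phi>) x 0 = 0"
    by (rule ext) (simp add: coordinate_vector_def linear_0[OF lin])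
qed

text \<open>Global functions that agree near \<open>x\<close> with a linear functional of the chart
  detect the components of a coordinate vector, and functionals separate points.\<close>

lemma cv_inj:
  assumes "(U, \<phi>) \<in> N" "x \<in> U" "cv (U, \<phi>) x v = cv (U, \<phi>) x w"
  shows "v = w"
proof -
  have "a v = a w" for a :: "'e \<Rightarrow>\<^sub>L real"
  proof -
    have "smooth_on (\<phi> ` U) a"
      using chart_open[OF assms(1)] by (intro smooth_on_bounded_linear blinfun.bounded_linear_right)
    then obtain f W where f: "f \<in> smooth_functions N" "x \<in> W" "W \<subseteq> U" "open (\<phi> ` W)" "\<And>y. y \<in> W \<Longrightarrow> f y = a (\<phi> y)"
      using local_extension[OF assms(1,2)] by blast
    have "deriv_at (f \<circ> inv_into U \<phi>) (\<phi> x) = deriv_at a (\<phi> x)"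
      using f chart_inv[OF assms(1)] by (intro deriv_at_cong[OF f(4)]) (auto simp: subset_iff)
    also have "\<dots> = a" by (intro deriv_at_eq bounded_linear_imp_has_derivative blinfun.bounded_linear_right)
    finally show ?thesis using fun_cong[OF assms(3), of f] by (simp add: cv_apply[OF f(1)])
  qed
  then have "v - w = 0" by (intro dual_separates[OF fd]) (simp add: blinfun.diff_right)
  then show ?thesis by simp
qed

lemma cv_change:
  assumes "(U, \<phi>) \<in> N" "(V, \<psi>) \<in> N" "x \<in> U" "x \<in> V"
  shows "cv (V, \<psi>) x v = cv (U, \<phi>) x (deriv_at (\<phi> \<circ> inv_into V \<psi>) (\<psi> x) v)"
proof
  fix f
  show "cv (V, \<psi>) x v f = cv (U, \<phi>) x (deriv_at (\<phi> \<circ> inv_into V \<psi>) (\<psi> x) v) f"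
  proof (cases "f \<in> smooth_functions N")
    case True
    let ?t = "\<phi> \<circ> inv_into V \<psi>"
    have x: "\<psi> x \<in> \<psi> ` (V \<inter> U)" using assms by blast
    have t: "(?t has_derivative deriv_at ?t (\<psi> x)) (at (\<psi> x))"
      by (rule smooth_on_has_derivative[OF transition_smooth[OF assms(2,1)] x])
    have tx: "?t (\<psi> x) = \<phi> x" using assms by (simp add: chart_inv)
    have "((f \<circ> inv_into U \<phi>) has_derivative deriv_at (f \<circ> inv_into U \<phi>) (\<phi> x)) (at (?t (\<psi> x)))"
      unfolding tx by (rule local_has_derivative[OF True assms(1,3)])
    from has_derivative_compose[OF t this]
    have "deriv_at (\<lambda>z. (f \<circ> inv_into U \<phi>) (?t z)) (\<psi> x)
        = (\<lambda>v. deriv_at (f \<circ> inv_into U \<phi>) (\<phi> x) (deriv_at ?t (\<psi> x) v))" by (rule deriv_at_eq)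
    moreover have "deriv_at (f \<circ> inv_into V \<psi>) (\<psi> x) = deriv_at (\<lambda>z. (f \<circ> inv_into U \<phi>) (?t z)) (\<psi> x)"
    proof (rule deriv_at_cong[OF overlap_open[OF assms(2,1)] x])
      show "(f \<circ> inv_into V \<psi>) y = (f \<circ> inv_into U \<phi>) (?t y)" if "y \<in> \<psi> ` (V \<inter> U)" for y
        using that assms by (auto simp: chart_inv)
    qed
    ultimately show ?thesis by (simp add: cv_apply[OF True])
  qed (simp add: cv_outside)
qed

lemma tangent_space_eq:
  assumes "(U, \<phi>) \<in> N" "x \<in> U"
  shows "tangent_space N x = range (cv (U, \<phi>) x)"
proof
  show "tangent_space N x \<subseteq> range (cv (U, \<phi>) x)"
    using cv_change[OF assms(1) _ assms(2)] by (fastforce simp: tangent_space_def)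
  show "range (cv (U, \<phi>) x) \<subseteq> tangent_space N x"
    using assms by (fastforce simp: tangent_space_def)
qed

lemma cv_in_tangent: "(U, \<phi>) \<in> N \<Longrightarrow> x \<in> U \<Longrightarrow> cv (U, \<phi>) x v \<in> tangent_space N x"
  by (auto simp: tangent_space_eq)

lemma tangent_scale:
  assumes "x \<in> points N" "v \<in> tangent_space N x"
  shows "r *\<^sub>R v \<in> tangent_space N x"
  using points_chart[OF assms(1)] assms(2) by (auto simp: tangent_space_eq cv_scale[symmetric])

lemma tangent_derivation:
  assumes "x \<in> points N" "w \<in> tangent_space N x" "f \<in> smooth_functions N" "g \<in> smooth_functions N"
  shows tangent_apply_add: "w (f + g) = w f + w g"
    and tangent_apply_diff: "w (f - g) = w f - w g"
    and tangent_apply_scale: "w (r *\<^sub>R f) = r * w f"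
    and tangent_apply_mult: "w (f * g) = f x * w g + w f * g x"
proof -
  obtain U \<phi> where c: "(U, \<phi>) \<in> N" "x \<in> U" using points_chart[OF assms(1)] by blast
  obtain v where v: "w = cv (U, \<phi>) x v" using assms(2) by (auto simp: tangent_space_eq[OF c])
  note d = local_has_derivative[OF assms(3) c] local_has_derivative[OF assms(4) c]
  have e: "(f + g) \<circ> inv_into U \<phi> = (\<lambda>z. (f \<circ> inv_into U \<phi>) z + (g \<circ> inv_into U \<phi>) z)"
    "(f - g) \<circ> inv_into U \<phi> = (\<lambda>z. (f \<circ> inv_into U \<phi>) z - (g \<circ> inv_into U \<phi>) z)"
    "(f * g) \<circ> inv_into U \<phi> = (\<lambda>z. (f \<circ> inv_into U \<phi>) z * (g \<circ> inv_into U \<phi>) z)"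
    "(r *\<^sub>R f) \<circ> inv_into U \<phi> = (\<lambda>z. r * (f \<circ> inv_into U \<phi>) z)"
    by (simp_all add: o_def scaleR_fun_def)
  show "w (f + g) = w f + w g"
    unfolding v cv_apply[OF smooth_function_add[OF assms(3,4)]] cv_apply[OF assms(3)] cv_apply[OF assms(4)] e
    by (simp only: deriv_at_eq[OF has_derivative_add[OF d]])
  show "w (f - g) = w f - w g"
    unfolding v cv_apply[OF smooth_function_diff[OF assms(3,4)]] cv_apply[OF assms(3)] cv_apply[OF assms(4)] e
    by (simp only: deriv_at_eq[OF has_derivative_diff[OF d]])
  show "w (r *\<^sub>R f) = r * w f"
    unfolding v cv_apply[OF smooth_function_scale[OF assms(3)]] cv_apply[OF assms(3)] e
    by (simp only: deriv_at_eq[OF has_derivative_mult_right[OF d(1)]])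
  show "w (f * g) = f x * w g + w f * g x"
    unfolding v cv_apply[OF smooth_function_mult[OF assms(3,4)]] cv_apply[OF assms(3)] cv_apply[OF assms(4)] e
    by (simp only: deriv_at_eq[OF has_derivative_mult[OF d]]) (simp add: chart_inv[OF c])
qed

section \<open>Vector fields and their coordinate expressions\<close>

lemma vector_field_tangent: "X \<in> vector_fields N \<Longrightarrow> x \<in> points N \<Longrightarrow> X x \<in> tangent_space N x"
  and vector_field_outside: "X \<in> vector_fields N \<Longrightarrow> x \<notin> points N \<Longrightarrow> X x = 0"
  and apply_vf_smooth: "X \<in> vector_fields N \<Longrightarrow> f \<in> smooth_functions N \<Longrightarrow> apply_vf X f \<in> smooth_functions N"
  by (auto simp: vector_fields_def)

lemma vector_field_not_smooth:
  assumes "X \<in> vector_fields N" "f \<notin> smooth_functions N"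
  shows "X x f = 0"
proof (cases "x \<in> points N")
  case True
  then obtain U \<phi> where "(U, \<phi>) \<in> N" "x \<in> U" using points_chart by blast
  then show ?thesis using vector_field_tangent[OF assms(1) True] by (auto simp: tangent_space_eq cv_outside[OF assms(2)])
qed (simp add: vector_field_outside[OF assms(1)])

text \<open>The components of the field on the chart image; by \<open>cv_inj\<close> there is at
  most one candidate at each point of the chart.\<close>

definition vf_rep :: "('a, 'e) chart \<Rightarrow> 'a vfield \<Rightarrow> 'e \<Rightarrow> 'e" where
  "vf_rep c X z = (SOME v. X (inv_into (fst c) (snd c) z) = cv c (inv_into (fst c) (snd c) z) v)"

lemma vf_rep_unique:
  assumes "(U, \<phi>) \<in> N" "x \<in> U" "X x = cv (U, \<phi>) x v"
  shows "vf_rep (U, \<phi>) X (\<phi> x) = v"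
  unfolding vf_rep_def using assms cv_inj[OF assms(1,2)]
  by (simp add: chart_inv) (metis (mono_tags, lifting) someI)

lemma vf_rep:
  assumes "X \<in> vector_fields N" "(U, \<phi>) \<in> N" "x \<in> U"
  shows "X x = cv (U, \<phi>) x (vf_rep (U, \<phi>) X (\<phi> x))"
proof -
  have "X x \<in> range (cv (U, \<phi>) x)"
    using vector_field_tangent[OF assms(1) chart_points[OF assms(2,3)]] by (simp add: tangent_space_eq[OF assms(2,3)])
  then show ?thesis using vf_rep_unique[OF assms(2,3)] by auto
qed

lemma vf_apply_rep:
  assumes "X \<in> vector_fields N" "(U, \<phi>) \<in> N" "x \<in> U" "f \<in> smooth_functions N"
  shows "X x f = deriv_at (f \<circ> inv_into U \<phi>) (\<phi> x) (vf_rep (U, \<phi>) X (\<phi> x))"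
  by (subst vf_rep[OF assms(1-3)]) (simp add: cv_apply[OF assms(4)])

lemma vf_apply_local:
  assumes "X \<in> vector_fields N" "(U, \<phi>) \<in> N" "f \<in> smooth_functions N" "z \<in> \<phi> ` U"
  shows "(apply_vf X f \<circ> inv_into U \<phi>) z = deriv_at (f \<circ> inv_into U \<phi>) z (vf_rep (U, \<phi>) X z)"
  using assms by (auto simp: apply_vf_def chart_inv vf_apply_rep)

text \<open>A vector field is only required to preserve smooth functions. Applying it to a global
  function that equals the coordinate \<open>a\<close> near a point returns the component of the
  field along \<open>a\<close> there.\<close>

lemma vf_rep_smooth:
  assumes X: "X \<in> vector_fields N" and c: "(U, \<phi>) \<in> N"
  shows "smooth_on (\<phi> ` U) (vf_rep (U, \<phi>) X)"
proof (rule smooth_on_weak[OF fd chart_open[OF c]])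
  fix a :: "'e \<Rightarrow>\<^sub>L real"
  show "smooth_on (\<phi> ` U) (\<lambda>z. a (vf_rep (U, \<phi>) X z))"
  proof (rule smooth_on_local)
    fix z assume "z \<in> \<phi> ` U"
    then obtain x where x: "x \<in> U" "z = \<phi> x" by blast
    have "smooth_on (\<phi> ` U) a"
      using chart_open[OF c] by (intro smooth_on_bounded_linear blinfun.bounded_linear_right)
    then obtain f W where f: "f \<in> smooth_functions N" "x \<in> W" "W \<subseteq> U" "open (\<phi> ` W)" "\<And>y. y \<in> W \<Longrightarrow> f y = a (\<phi> y)"
      using local_extension[OF c x(1)] by blast
    have "a (vf_rep (U, \<phi>) X w) = (apply_vf X f \<circ> inv_into U \<phi>) w" if "w \<in> \<phi> ` W" for w
    proof -
      have "deriv_at (f \<circ> inv_into U \<phi>) w = deriv_at a w"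
        using f chart_inv[OF c] by (intro deriv_at_cong[OF f(4) that]) (auto simp: subset_iff)
      also have "\<dots> = a" by (intro deriv_at_eq bounded_linear_imp_has_derivative blinfun.bounded_linear_right)
      finally show ?thesis using vf_apply_local[OF X c f(1), of w] that f(3) by auto
    qed
    moreover have "smooth_on (\<phi> ` W) (apply_vf X f \<circ> inv_into U \<phi>)"
      using smooth_on_subset[OF smooth_function_local[OF apply_vf_smooth[OF X f(1)] c]] f(3) by blast
    ultimately have "smooth_on (\<phi> ` W) (\<lambda>z. a (vf_rep (U, \<phi>) X z))"
      using smooth_on_congI[OF f(4), of _ "\<lambda>z. a (vf_rep (U, \<phi>) X z)"] by blast
    then show "\<exists>T. open T \<and> z \<in> T \<and> smooth_on T (\<lambda>z. a (vf_rep (U, \<phi>) X z))"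
      using f(2,4) x(2) by blast
  qed
qed

lemma vf_rep_has_derivative:
  assumes "X \<in> vector_fields N" "(U, \<phi>) \<in> N" "z \<in> \<phi> ` U"
  shows "(vf_rep (U, \<phi>) X has_derivative deriv_at (vf_rep (U, \<phi>) X) z) (at z)"
  using smooth_on_has_derivative[OF vf_rep_smooth[OF assms(1,2)] assms(3)] .

text \<open>Converse of \<open>vf_rep_smooth\<close>: fields with smooth components preserve smooth
  functions, by \<open>smooth_on_deriv_apply\<close>.\<close>

lemma vector_fieldI:
  assumes out: "\<And>x. x \<notin> points N \<Longrightarrow> X x = 0"
    and rep: "\<And>U \<phi>. (U, \<phi>) \<in> N \<Longrightarrow> \<exists>F. smooth_on (\<phi> ` U) F \<and> (\<forall>x\<in>U. X x = cv (U, \<phi>) x (F (\<phi> x)))"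
  shows "X \<in> vector_fields N"
  unfolding vector_fields_def
proof (intro CollectI conjI ballI allI impI)
  fix x assume "x \<in> points N"
  then obtain U \<phi> where c: "(U, \<phi>) \<in> N" "x \<in> U" using points_chart by blast
  then show "X x \<in> tangent_space N x" using rep[OF c(1)] cv_in_tangent[OF c] by auto
next
  show "x \<notin> points N \<Longrightarrow> X x = 0" for x by fact
next
  fix f assume f: "f \<in> smooth_functions N"
  show "apply_vf X f \<in> smooth_functions N"
  proof (rule smooth_functionI)
    show "x \<notin> points N \<Longrightarrow> apply_vf X f x = 0" for x by (simp add: apply_vf_def out)
    fix U \<phi> assume c: "(U, \<phi>) \<in> N"
    obtain F where F: "smooth_on (\<phi> ` U) F" "\<forall>x\<in>U. X x = cv (U, \<phi>) x (F (\<phi> x))" using rep[OF c] by blast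
    have "smooth_on (\<phi> ` U) (\<lambda>z. deriv_at (f \<circ> inv_into U \<phi>) z (F z))"
      by (rule smooth_on_deriv_apply[OF fd chart_open[OF c] smooth_function_local[OF f c] F(1)])
    moreover have "(apply_vf X f \<circ> inv_into U \<phi>) z = deriv_at (f \<circ> inv_into U \<phi>) z (F z)" if z: "z \<in> \<phi> ` U" for z
    proof -
      obtain x where x: "x \<in> U" "z = \<phi> x" using z by blast
      then have "X x f = deriv_at (f \<circ> inv_into U \<phi>) (\<phi> x) (F (\<phi> x))"
        using F(2) cv_apply[OF f] by metis
      then show ?thesis by (simp add: x(2) apply_vf_def chart_inv[OF c x(1)])
    qed
    ultimately show "smooth_on (\<phi> ` U) (apply_vf X f \<circ> inv_into U \<phi>)"
      by (rule smooth_on_congI[OF chart_open[OF c]])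
  qed
qed

text \<open>Compatibility is required as equality of derivations instead of a transformation rule
  for components, so the value at each point may be taken from an arbitrarily chosen chart.\<close>

lemma vector_field_glue:
  assumes smooth: "\<And>U \<phi>. (U, \<phi>) \<in> N \<Longrightarrow> smooth_on (\<phi> ` U) (F (U, \<phi>))"
    and agree: "\<And>U \<phi> V \<psi> x. (U, \<phi>) \<in> N \<Longrightarrow> (V, \<psi>) \<in> N \<Longrightarrow> x \<in> U \<Longrightarrow> x \<in> V \<Longrightarrow>
      cv (U, \<phi>) x (F (U, \<phi>) (\<phi> x)) = cv (V, \<psi>) x (F (V, \<psi>) (\<psi> x))"
  obtains X where "X \<in> vector_fields N"
    "\<And>U \<phi> x. (U, \<phi>) \<in> N \<Longrightarrow> x \<in> U \<Longrightarrow> vf_rep (U, \<phi>) X (\<phi> x) = F (U, \<phi>) (\<phi> x)"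
proof -
  define c where "c x = (SOME c. c \<in> N \<and> x \<in> fst c)" for x
  define X where "X x = (if x \<in> points N then cv (c x) x (F (c x) (snd (c x) x)) else 0)" for x
  have X: "X x = cv (U, \<phi>) x (F (U, \<phi>) (\<phi> x))" if U: "(U, \<phi>) \<in> N" "x \<in> U" for U \<phi> x
  proof -
    have "c x \<in> N \<and> x \<in> fst (c x)" unfolding c_def by (rule someI[of _ "(U, \<phi>)"]) (simp add: U)
    then obtain V \<psi> where V: "c x = (V, \<psi>)" "(V, \<psi>) \<in> N" "x \<in> V" by (cases "c x") simp
    have "X x = cv (V, \<psi>) x (F (V, \<psi>) (\<psi> x))" using chart_points[OF U] by (simp add: X_def V(1))
    then show ?thesis using agree[OF V(2) U(1) V(3) U(2)] by simp
  qed
  have "X \<in> vector_fields N"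
  proof (rule vector_fieldI)
    show "x \<notin> points N \<Longrightarrow> X x = 0" for x by (simp add: X_def)
    show "\<exists>G. smooth_on (\<phi> ` U) G \<and> (\<forall>x\<in>U. X x = cv (U, \<phi>) x (G (\<phi> x)))" if "(U, \<phi>) \<in> N" for U \<phi>
      using smooth[OF that] X[OF that] by blast
  qed
  moreover have "vf_rep (U, \<phi>) X (\<phi> x) = F (U, \<phi>) (\<phi> x)" if "(U, \<phi>) \<in> N" "x \<in> U" for U \<phi> x
    using vf_rep_unique[of U \<phi> x X "F (U, \<phi>) (\<phi> x)"] X[of U \<phi> x] that by blast
  ultimately show ?thesis by (rule that)
qed

text \<open>A field with constant components, cut off. It turns statements tested on global fields
  into statements about single tangent vectors.\<close>

lemma vector_field_through:
  assumes "(U, \<phi>) \<in> N" "x \<in> U"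
  obtains X where "X \<in> vector_fields N" "X x = cv (U, \<phi>) x v"
proof -
  obtain \<beta> W where \<beta>: "x \<in> W" "W \<subseteq> U" "open (\<phi> ` W)" "\<forall>y\<in>W. \<beta> y = 1"
    "\<forall>g. smooth_on (\<phi> ` U) g \<longrightarrow> (\<lambda>y. if y \<in> U then \<beta> y * g (\<phi> y) else 0) \<in> smooth_functions N"
    using bump[OF assms] by blast
  define X where "X y = (if y \<in> U then \<beta> y *\<^sub>R cv (U, \<phi>) y v else 0)" for y
  have "X \<in> vector_fields N"
    unfolding vector_fields_def
  proof (intro CollectI conjI ballI allI impI)
    fix y assume y: "y \<in> points N"
    show "X y \<in> tangent_space N y"
    proof (cases "y \<in> U")
      case True
      then show ?thesis by (simp add: X_def tangent_scale[OF y] cv_in_tangent[OF assms(1)])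
    next
      case False
      obtain V \<psi> where c: "(V, \<psi>) \<in> N" "y \<in> V" using points_chart[OF y] by blast
      have "0 \<in> tangent_space N y" using cv_in_tangent[OF c, of 0] cv_zero[OF c] by simp
      with False show ?thesis by (simp add: X_def)
    qed
  next
    show "y \<notin> points N \<Longrightarrow> X y = 0" for y using chart_points[OF assms(1)] by (auto simp: X_def)
  next
    fix f assume f: "f \<in> smooth_functions N"
    have "apply_vf X f = (\<lambda>y. if y \<in> U then \<beta> y * deriv_at (f \<circ> inv_into U \<phi>) (\<phi> y) v else 0)"
      by (rule ext) (simp add: apply_vf_def X_def scaleR_fun_def cv_apply[OF f])
    then show "apply_vf X f \<in> smooth_functions N"
      using spec[OF \<beta>(5), of "\<lambda>z. deriv_at (f \<circ> inv_into U \<phi>) z v"]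
        smooth_on_deriv[OF smooth_function_local[OF f assms(1)]] by simp
  qed
  moreover have "X x = cv (U, \<phi>) x v" using \<beta> assms by (simp add: X_def)
  ultimately show ?thesis using that by blast
qed

lemma vector_field_add:
  assumes "X \<in> vector_fields N" "Y \<in> vector_fields N"
  shows "X + Y \<in> vector_fields N"
proof (rule vector_fieldI)
  show "x \<notin> points N \<Longrightarrow> (X + Y) x = 0" for x using assms by (simp add: vector_field_outside fun_eq_iff)
  fix U \<phi> assume c: "(U, \<phi>) \<in> N"
  show "\<exists>F. smooth_on (\<phi> ` U) F \<and> (\<forall>x\<in>U. (X + Y) x = cv (U, \<phi>) x (F (\<phi> x)))"
  proof (intro exI conjI ballI)
    show "smooth_on (\<phi> ` U) (\<lambda>z. vf_rep (U, \<phi>) X z + vf_rep (U, \<phi>) Y z)"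
      by (rule smooth_on_add[OF chart_open[OF c] vf_rep_smooth[OF assms(1) c] vf_rep_smooth[OF assms(2) c]])
    show "(X + Y) x = cv (U, \<phi>) x (vf_rep (U, \<phi>) X (\<phi> x) + vf_rep (U, \<phi>) Y (\<phi> x))" if "x \<in> U" for x
      using vf_rep[OF assms(1) c that] vf_rep[OF assms(2) c that] by (simp add: cv_add[OF c that])
  qed
qed

lemma vector_field_scale:
  assumes "X \<in> vector_fields N"
  shows "r *\<^sub>R X \<in> vector_fields N"
proof (rule vector_fieldI)
  show "x \<notin> points N \<Longrightarrow> (r *\<^sub>R X) x = 0" for x using assms by (simp add: vector_field_outside scaleR_fun_def fun_eq_iff)
  fix U \<phi> assume c: "(U, \<phi>) \<in> N"
  show "\<exists>F. smooth_on (\<phi> ` U) F \<and> (\<forall>x\<in>U. (r *\<^sub>R X) x = cv (U, \<phi>) x (F (\<phi> x)))"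
  proof (intro exI conjI ballI)
    show "smooth_on (\<phi> ` U) (\<lambda>z. r *\<^sub>R vf_rep (U, \<phi>) X z)"
      by (rule smooth_on_scaleR[OF chart_open[OF c] smooth_on_const vf_rep_smooth[OF assms(1) c]])
    show "(r *\<^sub>R X) x = cv (U, \<phi>) x (r *\<^sub>R vf_rep (U, \<phi>) X (\<phi> x))" if "x \<in> U" for x
      using vf_rep[OF assms(1) c that] by (simp add: cv_scale[OF c that] scaleR_fun_def[of r X])
  qed
qed

section \<open>Vector fields as derivations, and the Lie bracket\<close>

lemma vf_apply_diff:
  assumes "X \<in> vector_fields N" "f \<in> smooth_functions N" "g \<in> smooth_functions N"
  shows "X x (f - g) = X x f - X x g"
  using assms by (cases "x \<in> points N") (auto simp: vector_field_outside tangent_apply_diff vector_field_tangent)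

lemma vf_apply_add:
  assumes "X \<in> vector_fields N" "f \<in> smooth_functions N" "g \<in> smooth_functions N"
  shows "X x (f + g) = X x f + X x g"
  using assms by (cases "x \<in> points N") (auto simp: vector_field_outside tangent_apply_add vector_field_tangent)

lemma vf_apply_scale:
  assumes "X \<in> vector_fields N" "f \<in> smooth_functions N"
  shows "X x (r *\<^sub>R f) = r * X x f"
  using assms by (cases "x \<in> points N") (auto simp: vector_field_outside tangent_apply_scale[OF _ _ _ assms(2)] vector_field_tangent)

lemma vf_apply_mult:
  assumes "X \<in> vector_fields N" "f \<in> smooth_functions N" "g \<in> smooth_functions N"
  shows "X x (f * g) = f x * X x g + X x f * g x"
  using assms by (cases "x \<in> points N") (auto simp: vector_field_outside tangent_apply_mult vector_field_tangent)

text \<open>The second derivatives of the test function cancel by symmetry, which leaves a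
  first-order operator.\<close>

lemma lie_bracket_cv:
  assumes X: "X \<in> vector_fields N" and Y: "Y \<in> vector_fields N" and c: "(U, \<phi>) \<in> N" "x \<in> U"
  shows "lie_bracket X Y x = cv (U, \<phi>) x
    (deriv_at (vf_rep (U, \<phi>) Y) (\<phi> x) (vf_rep (U, \<phi>) X (\<phi> x)) -
     deriv_at (vf_rep (U, \<phi>) X) (\<phi> x) (vf_rep (U, \<phi>) Y (\<phi> x)))"
proof
  fix f :: "'a \<Rightarrow> real"
  let ?X = "vf_rep (U, \<phi>) X" and ?Y = "vf_rep (U, \<phi>) Y" and ?f = "f \<circ> inv_into U \<phi>" and ?x = "\<phi> x"
  show "lie_bracket X Y x f = cv (U, \<phi>) x (deriv_at ?Y ?x (?X ?x) - deriv_at ?X ?x (?Y ?x)) f"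
  proof (cases "f \<in> smooth_functions N")
    case True
    have x: "?x \<in> \<phi> ` U" using c by blast
    note S = chart_open[OF c(1)] and f = smooth_function_local[OF True c(1)]
    have d: "A x (apply_vf B f) = deriv_at (\<lambda>z. deriv_at ?f z (vf_rep (U, \<phi>) B ?x)) ?x (vf_rep (U, \<phi>) A ?x)
        + deriv_at ?f ?x (deriv_at (vf_rep (U, \<phi>) B) ?x (vf_rep (U, \<phi>) A ?x))"
      if A: "A \<in> vector_fields N" and B: "B \<in> vector_fields N" for A B
    proof -
      have "A x (apply_vf B f) = deriv_at (apply_vf B f \<circ> inv_into U \<phi>) ?x (vf_rep (U, \<phi>) A ?x)"
        by (rule vf_apply_rep[OF A c apply_vf_smooth[OF B True]])
      also have "deriv_at (apply_vf B f \<circ> inv_into U \<phi>) ?x = deriv_at (\<lambda>z. deriv_at ?f z (vf_rep (U, \<phi>) B z)) ?x"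
        by (rule deriv_at_cong[OF S x vf_apply_local[OF B c(1) True]])
      also have "\<dots> = (\<lambda>u. deriv_at (\<lambda>z. deriv_at ?f z (vf_rep (U, \<phi>) B ?x)) ?x u
          + deriv_at ?f ?x (deriv_at (vf_rep (U, \<phi>) B) ?x u))"
        by (rule deriv_at_eq[OF has_derivative_deriv_apply[OF fd S f vf_rep_smooth[OF B c(1)] x]])
      finally show ?thesis .
    qed
    have "linear (deriv_at ?f ?x)" using local_has_derivative[OF True c] by (rule has_derivative_linear)
    then show ?thesis
      using mixed_derivatives_commute[OF f S x, of "?Y ?x" "?X ?x"]
      by (simp add: lie_bracket_def d[OF X Y] d[OF Y X] cv_apply[OF True] linear_diff)
  next
    \<comment> \<open>Tangent vectors are 0 on functions that are not smooth, so both fields send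
      \<open>f\<close> to the zero function and both sides vanish.\<close>
    case False
    have z: "apply_vf A f = 0" if "A \<in> vector_fields N" for A
      by (rule ext) (simp add: apply_vf_def vector_field_not_smooth[OF that False])
    have "A x 0 = 0" if "A \<in> vector_fields N" for A :: "'a vfield"
      using vf_apply_diff[OF that smooth_function_zero smooth_function_zero] by simp
    from this[OF X] this[OF Y] show ?thesis
      by (simp add: lie_bracket_def z[OF X] z[OF Y] cv_outside[OF False])
  qed
qed

lemma vf_rep_lie_bracket:
  assumes "X \<in> vector_fields N" "Y \<in> vector_fields N" "(U, \<phi>) \<in> N" "z \<in> \<phi> ` U"
  shows "vf_rep (U, \<phi>) (lie_bracket X Y) z =
     deriv_at (vf_rep (U, \<phi>) Y) z (vf_rep (U, \<phi>) X z) - deriv_at (vf_rep (U, \<phi>) X) z (vf_rep (U, \<phi>) Y z)"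
proof -
  obtain x where x: "x \<in> U" "z = \<phi> x" using assms(4) by blast
  show ?thesis unfolding x(2) 
    by (rule vf_rep_unique[of U \<phi> x "lie_bracket X Y", OF assms(3) x(1) lie_bracket_cv[OF assms(1-3) x(1)]])
qed

lemma lie_bracket_vector_field:
  assumes X: "X \<in> vector_fields N" and Y: "Y \<in> vector_fields N"
  shows "lie_bracket X Y \<in> vector_fields N"
proof (rule vector_fieldI)
  show "lie_bracket X Y x = 0" if "x \<notin> points N" for x
    using that assms by (simp add: lie_bracket_def vector_field_outside fun_eq_iff)
  fix U \<phi> assume c: "(U, \<phi>) \<in> N"
  let ?X = "vf_rep (U, \<phi>) X" and ?Y = "vf_rep (U, \<phi>) Y"
  have "smooth_on (\<phi> ` U) (\<lambda>z. deriv_at ?Y z (?X z) - deriv_at ?X z (?Y z))"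
    by (rule smooth_on_diff[OF chart_open[OF c]
          smooth_on_deriv_apply[OF fd chart_open[OF c] vf_rep_smooth[OF Y c] vf_rep_smooth[OF X c]]
          smooth_on_deriv_apply[OF fd chart_open[OF c] vf_rep_smooth[OF X c] vf_rep_smooth[OF Y c]]])
  then show "\<exists>F. smooth_on (\<phi> ` U) F \<and> (\<forall>x\<in>U. lie_bracket X Y x = cv (U, \<phi>) x (F (\<phi> x)))"
    using lie_bracket_cv[OF X Y c] by blast
qed

lemma apply_lie_bracket:
  assumes "X \<in> vector_fields N" "Y \<in> vector_fields N" "f \<in> smooth_functions N"
  shows "apply_vf (lie_bracket X Y) f = apply_vf X (apply_vf Y f) - apply_vf Y (apply_vf X f)"
  by (rule ext) (simp add: apply_vf_def lie_bracket_def)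

text \<open>Fields vanish on functions that are not smooth, so smooth test functions decide
  equality.\<close>

lemma vector_field_eqI:
  assumes "X \<in> vector_fields N" "Y \<in> vector_fields N"
    and "\<And>f. f \<in> smooth_functions N \<Longrightarrow> apply_vf X f = apply_vf Y f"
  shows "X = Y"
proof (intro ext)
  fix x f
  show "X x f = Y x f"
    using assms(3) vector_field_not_smooth[OF assms(1)] vector_field_not_smooth[OF assms(2)]
    by (cases "f \<in> smooth_functions N") (auto simp: apply_vf_def fun_eq_iff)
qed

lemma apply_vf_add_right:
  "X \<in> vector_fields N \<Longrightarrow> f \<in> smooth_functions N \<Longrightarrow> g \<in> smooth_functions N \<Longrightarrow>
    apply_vf X (f + g) = apply_vf X f + apply_vf X g"
  by (rule ext) (simp add: apply_vf_def vf_apply_add)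

lemma apply_vf_diff_right:
  "X \<in> vector_fields N \<Longrightarrow> f \<in> smooth_functions N \<Longrightarrow> g \<in> smooth_functions N \<Longrightarrow>
    apply_vf X (f - g) = apply_vf X f - apply_vf X g"
  by (rule ext) (simp add: apply_vf_def vf_apply_diff)

lemma apply_vf_scale_right:
  "X \<in> vector_fields N \<Longrightarrow> f \<in> smooth_functions N \<Longrightarrow> apply_vf X (r *\<^sub>R f) = r *\<^sub>R apply_vf X f"
  by (rule ext) (simp add: apply_vf_def vf_apply_scale scaleR_fun_def[of r "\<lambda>x. X x f"])

lemma apply_vf_mult_right:
  "X \<in> vector_fields N \<Longrightarrow> f \<in> smooth_functions N \<Longrightarrow> g \<in> smooth_functions N \<Longrightarrow>
    apply_vf X (f * g) = f * apply_vf X g + apply_vf X f * g"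
  by (rule ext) (simp add: apply_vf_def vf_apply_mult)

lemma lie_bracket_jacobi:
  assumes "X \<in> vector_fields N" "Y \<in> vector_fields N" "Z \<in> vector_fields N"
  shows "lie_bracket X (lie_bracket Y Z) = lie_bracket (lie_bracket X Y) Z + lie_bracket Y (lie_bracket X Z)"
proof (rule vector_field_eqI)
  show "lie_bracket X (lie_bracket Y Z) \<in> vector_fields N"
    "lie_bracket (lie_bracket X Y) Z + lie_bracket Y (lie_bracket X Z) \<in> vector_fields N"
    using assms by (simp_all add: lie_bracket_vector_field vector_field_add)
  fix f assume "f \<in> smooth_functions N"
  then have "apply_vf (lie_bracket X (lie_bracket Y Z)) f =
      apply_vf (lie_bracket (lie_bracket X Y) Z) f + apply_vf (lie_bracket Y (lie_bracket X Z)) f"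
    using assms by (simp add: apply_lie_bracket lie_bracket_vector_field apply_vf_smooth apply_vf_diff_right)
  then show "apply_vf (lie_bracket X (lie_bracket Y Z)) f = apply_vf (lie_bracket (lie_bracket X Y) Z + lie_bracket Y (lie_bracket X Z)) f"
    by (simp add: apply_vf_def fun_eq_iff)
qed

lemma lie_bracket_add_right:
  assumes "X \<in> vector_fields N" "Y \<in> vector_fields N" "Z \<in> vector_fields N"
  shows "lie_bracket X (Y + Z) = lie_bracket X Y + lie_bracket X Z"
proof (rule vector_field_eqI)
  show "lie_bracket X (Y + Z) \<in> vector_fields N" "lie_bracket X Y + lie_bracket X Z \<in> vector_fields N"
    using assms by (simp_all add: lie_bracket_vector_field vector_field_add)
  fix f assume f: "f \<in> smooth_functions N"
  have l: "apply_vf (A + B) g = apply_vf A g + apply_vf B g" for A B :: "'a vfield" and g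
    by (rule ext) (simp add: apply_vf_def)
  show "apply_vf (lie_bracket X (Y + Z)) f = apply_vf (lie_bracket X Y + lie_bracket X Z) f"
    using assms f by (simp add: l apply_lie_bracket vector_field_add apply_vf_add_right apply_vf_smooth)
qed

lemma lie_bracket_scale_right:
  assumes "X \<in> vector_fields N" "Y \<in> vector_fields N"
  shows "lie_bracket X (r *\<^sub>R Y) = r *\<^sub>R lie_bracket X Y"
proof (rule vector_field_eqI)
  show "lie_bracket X (r *\<^sub>R Y) \<in> vector_fields N" "r *\<^sub>R lie_bracket X Y \<in> vector_fields N"
    using assms by (simp_all add: lie_bracket_vector_field vector_field_scale)
  fix f assume f: "f \<in> smooth_functions N"
  have l: "apply_vf (r *\<^sub>R A) g = r *\<^sub>R apply_vf A g" for A :: "'a vfield" and g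
    by (rule ext) (simp add: apply_vf_def scaleR_fun_def)
  show "apply_vf (lie_bracket X (r *\<^sub>R Y)) f = apply_vf (r *\<^sub>R lie_bracket X Y) f"
    using assms f by (simp add: l apply_lie_bracket vector_field_scale apply_vf_scale_right apply_vf_smooth scaleR_diff_right)
qed

lemma vf_rep_add:
  assumes "X \<in> vector_fields N" "Y \<in> vector_fields N" "(U, \<phi>) \<in> N" "x \<in> U"
  shows "vf_rep (U, \<phi>) (X + Y) (\<phi> x) = vf_rep (U, \<phi>) X (\<phi> x) + vf_rep (U, \<phi>) Y (\<phi> x)"
  using vf_rep[OF assms(1,3,4)] vf_rep[OF assms(2,3,4)]
  by (intro vf_rep_unique[OF assms(3,4)]) (simp add: cv_add[OF assms(3,4)])

lemma vf_rep_scale: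
  assumes "X \<in> vector_fields N" "(U, \<phi>) \<in> N" "x \<in> U"
  shows "vf_rep (U, \<phi>) (r *\<^sub>R X) (\<phi> x) = r *\<^sub>R vf_rep (U, \<phi>) X (\<phi> x)"
  using vf_rep[OF assms]
  by (intro vf_rep_unique[OF assms(2,3)]) (simp add: cv_scale[OF assms(2,3)] scaleR_fun_def[of r X])

lemma vector_field_eqI_rep:
  assumes X: "X \<in> vector_fields N" and Y: "Y \<in> vector_fields N"
    and eq: "\<And>U \<phi> x. (U, \<phi>) \<in> N \<Longrightarrow> x \<in> U \<Longrightarrow> vf_rep (U, \<phi>) X (\<phi> x) = vf_rep (U, \<phi>) Y (\<phi> x)"
  shows "X = Y"
proof
  fix x
  show "X x = Y x"
  proof (cases "x \<in> points N")
    case True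
    then obtain U \<phi> where c: "(U, \<phi>) \<in> N" "x \<in> U" using points_chart by blast
    show ?thesis using vf_rep[OF X c] vf_rep[OF Y c] eq[OF c] by simp
  qed (simp add: vector_field_outside[OF X] vector_field_outside[OF Y])
qed

lemma lie_bracket_anti:
  assumes "X \<in> vector_fields N" "Y \<in> vector_fields N"
  shows "lie_bracket X Y = - lie_bracket Y X"
  by (intro ext) (simp add: lie_bracket_def)

lemma lie_bracket_add_left:
  assumes "X \<in> vector_fields N" "Y \<in> vector_fields N" "Z \<in> vector_fields N"
  shows "lie_bracket (X + Y) Z = lie_bracket X Z + lie_bracket Y Z"
  using assms lie_bracket_add_right[OF assms(3,1,2)]
  by (simp add: lie_bracket_anti[of _ Z] vector_field_add)

lemma lie_bracket_scale_left:
  assumes "X \<in> vector_fields N" "Z \<in> vector_fields N"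
  shows "lie_bracket (r *\<^sub>R X) Z = r *\<^sub>R lie_bracket X Z"
  using assms lie_bracket_scale_right[OF assms(2,1)]
  by (simp add: lie_bracket_anti[of _ Z] vector_field_scale)

lemma vector_field_zero: "0 \<in> vector_fields N"
  by (rule vector_fieldI)
    (auto simp: cv_zero smooth_on_const intro!: exI[of _ "\<lambda>_. 0"])

end

text \<open>This is where the Hausdorff condition acts: the compact set carrying the bump is closed
  in the manifold, so its complement is an open neighbourhood of every point outside
  \<open>U\<close>.\<close>

lemma smooth_manifold_bump_atlas:
  fixes M :: "('a, 'e::real_normed_vector) atlas"
  assumes M: "smooth_manifold M"
  shows "bump_atlas M"
proof
  show fd: "finite_dim TYPE('e)" using M by (simp add: smooth_manifold_def finite_dim_def)
  show atlas: "smooth_atlas M" using M by (simp add: smooth_manifold_def)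
  have haus: "Hausdorff_space (manifold_topology M)" using M by (simp add: smooth_manifold_def)
  note open_iff = openin_manifold_topology[OF atlas]
  have inj: "inj_on \<phi> U" and img_open: "open (\<phi> ` U)" if "(U, \<phi>) \<in> M" for U \<phi>
    using atlas that by (auto simp: smooth_atlas_def)
  have overlap: "open (\<phi> ` (U \<inter> V))" if "(U, \<phi>) \<in> M" "(V, \<psi>) \<in> M" for U V \<phi> \<psi>
    using atlas that by (auto simp: smooth_atlas_def)
  have topspace: "topspace (manifold_topology M) = points M"
  proof
    show "topspace (manifold_topology M) \<subseteq> points M"
      using open_iff[of "topspace (manifold_topology M)"] by simp
    have "openin (manifold_topology M) (points M)"
      unfolding open_iff
    proof (intro conjI subset_refl, clarify)
      fix U \<phi> assume c: "(U, \<phi>) \<in> M"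
      then have "U \<inter> points M = U" by (force simp: points_def)
      then show "open (\<phi> ` (U \<inter> points M))" using img_open[OF c] by simp
    qed
    then show "points M \<subseteq> topspace (manifold_topology M)" by (rule openin_subset)
  qed
  fix U :: "'a set" and \<phi> :: "'a \<Rightarrow> 'e" and x
  assume U: "(U, \<phi>) \<in> M" and x: "x \<in> U"
  have inv: "inv_into U \<phi> (\<phi> y) = y" if "y \<in> U" for y using inj[OF U] that by simp
  obtain \<rho> :: "'e \<Rightarrow> real" and K W where \<rho>: "smooth_on UNIV \<rho>" "compact K" "K \<subseteq> \<phi> ` U"
    "open W" "\<phi> x \<in> W" "W \<subseteq> \<phi> ` U" "\<And>y. y \<in> W \<Longrightarrow> \<rho> y = 1" "\<And>y. y \<notin> K \<Longrightarrow> \<rho> y = 0"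
    using bump_function_exists[OF fd img_open[OF U], of "\<phi> x"] x by blast
  let ?K = "inv_into U \<phi> ` K" and ?W = "inv_into U \<phi> ` W"
  have imgW: "\<phi> ` ?W = W"
  proof -
    have "\<phi> (inv_into U \<phi> w) = w" if "w \<in> W" for w using \<rho>(6) that by (auto simp: f_inv_into_f)
    then show ?thesis by (auto simp: image_image)
  qed
  \<comment> \<open>Continuity of the inverse chart carries compactness of \<open>K\<close> over to
    the manifold.\<close>
  have "continuous_map (top_of_set (\<phi> ` U)) (manifold_topology M) (inv_into U \<phi>)"
    unfolding continuous_map_def
  proof (intro conjI allI impI)
    show "inv_into U \<phi> \<in> topspace (top_of_set (\<phi> ` U)) \<rightarrow> topspace (manifold_topology M)"
      using U by (force simp: topspace points_def inv)
    fix A assume A: "openin (manifold_topology M) A"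
    have "{y \<in> topspace (top_of_set (\<phi> ` U)). inv_into U \<phi> y \<in> A} = \<phi> ` (U \<inter> A)"
      by (auto simp: inv)
    moreover have "open (\<phi> ` (U \<inter> A))" using A U by (auto simp: open_iff)
    ultimately show "openin (top_of_set (\<phi> ` U)) {y \<in> topspace (top_of_set (\<phi> ` U)). inv_into U \<phi> y \<in> A}"
      by (auto intro: open_subset)
  qed
  then have "compactin (manifold_topology M) ?K"
    using \<rho>(2,3) image_compactin[of "top_of_set (\<phi> ` U)" K] by (simp add: compactin_subtopology)
  then have closed: "closedin (manifold_topology M) ?K"
    using compactin_imp_closedin[OF haus] by blast
  have "\<exists>T. y \<in> T \<and> T \<subseteq> V \<and> open (\<psi> ` T) \<and> (\<forall>z\<in>T \<inter> U. \<rho> (\<phi> z) = 0)"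
    if V: "(V, \<psi>) \<in> M" "y \<in> V" "y \<notin> U" for V \<psi> y
  proof (intro exI conjI)
    let ?T = "V \<inter> (points M - ?K)"
    have KU: "?K \<subseteq> U" using \<rho>(3) by (auto simp: inv)
    show "y \<in> ?T" using V KU by (force simp: points_def)
    show "?T \<subseteq> V" by blast
    have "openin (manifold_topology M) (points M - ?K)"
      using closed by (simp add: closedin_def topspace)
    then show "open (\<psi> ` ?T)" using V(1) by (auto simp: open_iff)
    show "\<forall>z\<in>?T \<inter> U. \<rho> (\<phi> z) = 0"
    proof
      fix z assume z: "z \<in> ?T \<inter> U"
      have "\<phi> z \<notin> K" using z inv[of z] by (metis DiffD2 IntD1 IntD2 imageI)
      then show "\<rho> (\<phi> z) = 0" by (rule \<rho>(8))
    qed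
  qed
  moreover have "x \<in> ?W" using inv[OF x] \<rho>(5) by (metis imageI)
  moreover have "?W \<subseteq> U" using \<rho>(6) by (auto simp: inv)
  moreover have "open (\<phi> ` ?W)" using imgW \<rho>(4) by simp
  moreover have "\<forall>y\<in>?W. \<rho> (\<phi> y) = 1"
  proof
    fix y assume "y \<in> ?W"
    then have "\<phi> y \<in> W" using imgW by blast
    then show "\<rho> (\<phi> y) = 1" by (rule \<rho>(7))
  qed
  moreover have "smooth_on (\<phi> ` U) ((\<lambda>y. \<rho> (\<phi> y)) \<circ> inv_into U \<phi>)"
    by (rule smooth_on_congI[OF img_open[OF U] smooth_on_subset[OF \<rho>(1)]]) (auto simp: inv)
  ultimately show "\<exists>\<beta> W. x \<in> W \<and> W \<subseteq> U \<and> open (\<phi> ` W) \<and>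
      (\<forall>y\<in>W. \<beta> y = (1::real)) \<and> smooth_on (\<phi> ` U) (\<beta> \<circ> inv_into U \<phi>) \<and>
      (\<forall>V \<psi> y. (V, \<psi>) \<in> M \<longrightarrow> y \<in> V \<longrightarrow> y \<notin> U \<longrightarrow>
        (\<exists>T. y \<in> T \<and> T \<subseteq> V \<and> open (\<psi> ` T) \<and> (\<forall>z\<in>T \<inter> U. \<beta> z = 0)))"
    by (intro exI[of _ "\<lambda>y. \<rho> (\<phi> y)"] exI[of _ ?W]) blast
qed


section \<open>The cotangent bundle\<close>

context bump_atlas
begin

definition cdom :: "'a set \<Rightarrow> 'a covector set" where
  "cdom U = {(x, \<xi>). x \<in> U \<and> \<xi> \<in> cotangent_space N x}"

definition cmap :: "'a set \<Rightarrow> ('a \<Rightarrow> 'e) \<Rightarrow> 'a covector \<Rightarrow> 'e \<times> ('e \<Rightarrow>\<^sub>L real)" where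
  "cmap U \<phi> = (\<lambda>(x, \<xi>). (\<phi> x, Blinfun (\<lambda>v. \<xi> (cv (U, \<phi>) x v))))"

text \<open>Inverse to the fibre part of \<open>cmap\<close>: the cotangent vector with components
  \<open>a\<close> in the chart, set to 0 off the tangent space as \<open>cotangent_space\<close>
  demands.\<close>

definition covector :: "'a set \<Rightarrow> ('a \<Rightarrow> 'e) \<Rightarrow> 'a \<Rightarrow> ('e \<Rightarrow>\<^sub>L real) \<Rightarrow> 'a tangent \<Rightarrow> real" where
  "covector U \<phi> x a = (\<lambda>w. if w \<in> tangent_space N x then a (SOME v. w = cv (U, \<phi>) x v) else 0)"

lemma cotangent_chart_eq: "cotangent_chart N (U, \<phi>) = (cdom U, cmap U \<phi>)"
  by (simp add: cotangent_chart_def cdom_def cmap_def)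

lemma cotangent_bundle_iff: "c \<in> cotangent_bundle N \<longleftrightarrow> (\<exists>U \<phi>. (U, \<phi>) \<in> N \<and> c = (cdom U, cmap U \<phi>))"
  unfolding cotangent_bundle_def by (force simp: image_iff simp flip: cotangent_chart_eq)

lemma points_cotangent: "q \<in> points (cotangent_bundle N) \<longleftrightarrow> fst q \<in> points N \<and> snd q \<in> cotangent_space N (fst q)"
proof
  assume "q \<in> points (cotangent_bundle N)"
  then obtain U \<phi> where "(U, \<phi>) \<in> N" "q \<in> cdom U"
    by (auto simp: points_def cotangent_bundle_iff)
  then show "fst q \<in> points N \<and> snd q \<in> cotangent_space N (fst q)"
    using chart_points by (auto simp: cdom_def)
next
  assume q: "fst q \<in> points N \<and> snd q \<in> cotangent_space N (fst q)"
  then obtain U \<phi> where "(U, \<phi>) \<in> N" "fst q \<in> U" using points_chart by blast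
  then have "(cdom U, cmap U \<phi>) \<in> cotangent_bundle N" "q \<in> cdom U"
    using q by (auto simp: cotangent_bundle_iff cdom_def case_prod_beta)
  then show "q \<in> points (cotangent_bundle N)" unfolding points_def by force
qed

text \<open>Elements of \<open>cotangent_space\<close> are merely linear; finite dimension makes
  them bounded, which gives \<open>Blinfun\<close> in the cotangent chart its meaning.\<close>

lemma cotangent_bounded_linear:
  assumes "(U, \<phi>) \<in> N" "x \<in> U" "\<xi> \<in> cotangent_space N x"
  shows "bounded_linear (\<lambda>v. \<xi> (cv (U, \<phi>) x v))"
proof (rule linear_imp_bounded_linear[OF fd])
  show "linear (\<lambda>v. \<xi> (cv (U, \<phi>) x v))"
    using assms(3) cv_in_tangent[OF assms(1,2)]
    by (intro linearI) (simp_all add: cv_add[OF assms(1,2)] cv_scale[OF assms(1,2)] cotangent_space_def linear_map_on_def)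
qed

lemma cmap_apply:
  assumes "(U, \<phi>) \<in> N" "q \<in> cdom U"
  shows "snd (cmap U \<phi> q) v = snd q (cv (U, \<phi>) (fst q) v)"
  using assms cotangent_bounded_linear[OF assms(1)]
  by (auto simp: cmap_def cdom_def case_prod_beta bounded_linear_Blinfun_apply)

lemma fst_cmap: "fst (cmap U \<phi> q) = \<phi> (fst q)"
  by (simp add: cmap_def case_prod_beta)

lemma covector_cv:
  assumes "(U, \<phi>) \<in> N" "x \<in> U"
  shows "covector U \<phi> x a (cv (U, \<phi>) x v) = a v"
proof -
  have "(SOME u. cv (U, \<phi>) x v = cv (U, \<phi>) x u) = v"
    using cv_inj[OF assms] by (intro some_equality) auto
  then show ?thesis by (simp add: covector_def cv_in_tangent[OF assms])
qed

lemma covector_in_cotangent: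
  assumes "(U, \<phi>) \<in> N" "x \<in> U"
  shows "covector U \<phi> x a \<in> cotangent_space N x"
proof -
  have "linear_map_on (tangent_space N x) (covector U \<phi> x a)"
    unfolding linear_map_on_def tangent_space_eq[OF assms]
    by (auto simp: covector_cv[OF assms] blinfun.add_right blinfun.scaleR_right
        simp flip: cv_add[OF assms] cv_scale[OF assms])
  then show ?thesis by (simp add: cotangent_space_def covector_def)
qed

lemma cotangent_eqI:
  assumes "(U, \<phi>) \<in> N" "x \<in> U" "\<xi> \<in> cotangent_space N x" "\<eta> \<in> cotangent_space N x"
    and "\<And>v. \<xi> (cv (U, \<phi>) x v) = \<eta> (cv (U, \<phi>) x v)"
  shows "\<xi> = \<eta>"
proof
  fix w
  show "\<xi> w = \<eta> w"
    using assms(3-5) tangent_space_eq[OF assms(1,2)]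
    by (cases "w \<in> tangent_space N x") (auto simp: cotangent_space_def)
qed

lemma covector_mem: "(U, \<phi>) \<in> N \<Longrightarrow> x \<in> U \<Longrightarrow> (x, covector U \<phi> x a) \<in> cdom U"
  by (simp add: cdom_def covector_in_cotangent)

lemma cmap_covector:
  assumes "(U, \<phi>) \<in> N" "x \<in> U"
  shows "cmap U \<phi> (x, covector U \<phi> x a) = (\<phi> x, a)"
  by (rule prod_eqI) (auto simp: fst_cmap cmap_apply[OF assms(1) covector_mem[OF assms]] covector_cv[OF assms] intro: blinfun_eqI)

lemma covector_cmap:
  assumes "(U, \<phi>) \<in> N" "q \<in> cdom U"
  shows "(fst q, covector U \<phi> (fst q) (snd (cmap U \<phi> q))) = q"
proof -
  have x: "fst q \<in> U" "snd q \<in> cotangent_space N (fst q)" using assms(2) by (auto simp: cdom_def)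
  have "covector U \<phi> (fst q) (snd (cmap U \<phi> q)) = snd q"
    by (rule cotangent_eqI[OF assms(1) x(1) covector_in_cotangent[OF assms(1) x(1)] x(2)])
      (simp add: covector_cv[OF assms(1) x(1)] cmap_apply[OF assms])
  then show ?thesis by simp
qed

lemma cmap_image:
  assumes "(U, \<phi>) \<in> N" "W \<subseteq> U"
  shows "cmap U \<phi> ` cdom W = \<phi> ` W \<times> UNIV"
proof
  show "cmap U \<phi> ` cdom W \<subseteq> \<phi> ` W \<times> UNIV" by (auto simp: cdom_def cmap_def)
  show "\<phi> ` W \<times> UNIV \<subseteq> cmap U \<phi> ` cdom W"
  proof
    fix z assume "z \<in> \<phi> ` W \<times> (UNIV :: ('e \<Rightarrow>\<^sub>L real) set)"
    then obtain x a where x: "x \<in> W" "z = (\<phi> x, a)" by blast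
    then have "z = cmap U \<phi> (x, covector U \<phi> x a)" using cmap_covector[OF assms(1)] assms(2) by auto
    moreover have "(x, covector U \<phi> x a) \<in> cdom W"
      using covector_in_cotangent[OF assms(1)] assms(2) x(1) by (auto simp: cdom_def)
    ultimately show "z \<in> cmap U \<phi> ` cdom W" by blast
  qed
qed

lemma cmap_inj:
  assumes c: "(U, \<phi>) \<in> N"
  shows "inj_on (cmap U \<phi>) (cdom U)"
proof (rule inj_on_inverseI)
  fix q assume q: "q \<in> cdom U"
  have "inv_into U \<phi> (fst (cmap U \<phi> q)) = fst q"
    using q unfolding fst_cmap by (intro chart_inv[OF c]) (auto simp: cdom_def)
  then show "(\<lambda>z. (inv_into U \<phi> (fst z), covector U \<phi> (inv_into U \<phi> (fst z)) (snd z))) (cmap U \<phi> q) = q"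
    by (simp only: covector_cmap[OF c q])
qed

lemma cmap_inv:
  assumes "(U, \<phi>) \<in> N" "y \<in> \<phi> ` U"
  shows "inv_into (cdom U) (cmap U \<phi>) (y, a) = (inv_into U \<phi> y, covector U \<phi> (inv_into U \<phi> y) a)"
proof -
  obtain x where x: "x \<in> U" "y = \<phi> x" using assms(2) by blast
  show ?thesis unfolding x(2) chart_inv[OF assms(1) x(1)]
    by (rule inv_into_f_eq[OF cmap_inj[OF assms(1)] covector_mem[OF assms(1) x(1)] cmap_covector[OF assms(1) x(1)]])
qed

lemma cdom_Int: "cdom U \<inter> cdom V = cdom (U \<inter> V)"
  by (auto simp: cdom_def)

text \<open>Covectors are pulled back: the fibre part composes \<open>a\<close> with the derivative
  of the inverse transition at the new base point.\<close>

lemma cotangent_transition: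
  assumes U: "(U, \<phi>) \<in> N" and V: "(V, \<psi>) \<in> N" and y: "y \<in> \<phi> ` (U \<inter> V)"
  shows "(cmap V \<psi> \<circ> inv_into (cdom U) (cmap U \<phi>)) (y, a) =
    ((\<psi> \<circ> inv_into U \<phi>) y, Blinfun (\<lambda>v. a (deriv_at (\<phi> \<circ> inv_into V \<psi>) ((\<psi> \<circ> inv_into U \<phi>) y) v)))"
proof -
  obtain x where x: "x \<in> U" "x \<in> V" "y = \<phi> x" using y by blast
  have "cmap V \<psi> (x, covector U \<phi> x a) = (\<psi> x, Blinfun (\<lambda>v. covector U \<phi> x a (cv (V, \<psi>) x v)))"
    by (simp add: cmap_def)
  also have "(\<lambda>v. covector U \<phi> x a (cv (V, \<psi>) x v)) = (\<lambda>v. a (deriv_at (\<phi> \<circ> inv_into V \<psi>) (\<psi> x) v))"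
    by (simp add: cv_change[OF U V x(1,2)] covector_cv[OF U x(1)])
  finally show ?thesis using x by (simp add: cmap_inv[OF U] chart_inv[OF U])
qed

text \<open>At each fixed \<open>v\<close> the fibre part is a bilinear pairing of the covector with
  a derivative of the transition map; finite dimension upgrades this to smoothness with values in
  the dual.\<close>

lemma cotangent_transition_smooth:
  assumes U: "(U, \<phi>) \<in> N" and V: "(V, \<psi>) \<in> N"
  shows "smooth_on (cmap U \<phi> ` (cdom U \<inter> cdom V)) (cmap V \<psi> \<circ> inv_into (cdom U) (cmap U \<phi>))"
proof -
  let ?S = "\<phi> ` (U \<inter> V)" and ?\<tau> = "\<psi> \<circ> inv_into U \<phi>" and ?\<sigma> = "\<phi> \<circ> inv_into V \<psi>"
  let ?P = "?S \<times> (UNIV :: ('e \<Rightarrow>\<^sub>L real) set)"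
  have img: "cmap U \<phi> ` (cdom U \<inter> cdom V) = ?P" unfolding cdom_Int by (rule cmap_image[OF U]) blast
  have S: "open ?S" by (rule overlap_open[OF U V])
  then have P: "open ?P" by (intro open_Times open_UNIV)
  have base: "smooth_on ?P (\<lambda>z. ?\<tau> (fst z))"
    by (rule smooth_on_compose[OF fd P S _ smooth_on_bounded_linear[OF P bounded_linear_fst] transition_smooth[OF U V]]) auto
  have \<tau>: "?\<tau> y \<in> \<psi> ` (V \<inter> U)" if "y \<in> ?S" for y using that by (auto simp: chart_inv[OF U])
  have lin: "bounded_linear (\<lambda>v. a (deriv_at ?\<sigma> (?\<tau> y) v))" if "y \<in> ?S" for y and a :: "'e \<Rightarrow>\<^sub>L real"
    by (rule bounded_linear_compose[OF blinfun.bounded_linear_right has_derivative_bounded_linear[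
        OF smooth_on_has_derivative[OF transition_smooth[OF V U] \<tau>[OF that]]]])
  have fiber: "smooth_on ?P (\<lambda>z. Blinfun (\<lambda>v. blinfun_apply (snd z) (deriv_at ?\<sigma> (?\<tau> (fst z)) v)))"
  proof (rule smooth_on_blinfun_pointwise[OF fd P])
    fix v
    have "smooth_on ?P (\<lambda>z. deriv_at ?\<sigma> (?\<tau> (fst z)) v)"
    proof (rule smooth_on_compose[OF fd P overlap_open[OF V U] _ base smooth_on_deriv[OF transition_smooth[OF V U]]])
      show "?\<tau> (fst z) \<in> \<psi> ` (V \<inter> U)" if "z \<in> ?P" for z using that by (intro \<tau>) auto
    qed
    then have sm: "smooth_on ?P (\<lambda>z. blinfun_apply (snd z) (deriv_at ?\<sigma> (?\<tau> (fst z)) v))"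
      by (rule smooth_on_blinfun_apply[OF P smooth_on_bounded_linear[OF P bounded_linear_snd]])
    have eq: "blinfun_apply (Blinfun (\<lambda>v. blinfun_apply (snd z) (deriv_at ?\<sigma> (?\<tau> (fst z)) v))) v = blinfun_apply (snd z) (deriv_at ?\<sigma> (?\<tau> (fst z)) v)"
      if "z \<in> ?P" for z
    proof -
      have "fst z \<in> ?S" using that by auto
      then show ?thesis by (simp only: bounded_linear_Blinfun_apply[OF lin])
    qed
    show "smooth_on ?P (\<lambda>z. blinfun_apply (Blinfun (\<lambda>v. blinfun_apply (snd z) (deriv_at ?\<sigma> (?\<tau> (fst z)) v))) v)"
      by (rule smooth_on_congI[OF P sm eq])
  qed
  show ?thesis
    unfolding img
  proof (rule smooth_on_congI[OF P smooth_on_Pair[OF P base fiber]])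
    fix z :: "'e \<times> ('e \<Rightarrow>\<^sub>L real)" assume "z \<in> ?P"
    then have "fst z \<in> ?S" by auto
    from cotangent_transition[OF U V this, of "snd z"]
    show "(cmap V \<psi> \<circ> inv_into (cdom U) (cmap U \<phi>)) z =
      (?\<tau> (fst z), Blinfun (\<lambda>v. blinfun_apply (snd z) (deriv_at ?\<sigma> (?\<tau> (fst z)) v)))" by simp
  qed
qed

lemma cotangent_smooth_atlas: "smooth_atlas (cotangent_bundle N)"
proof -
  have 1: "inj_on (cmap U \<phi>) (cdom U)" "open (cmap U \<phi> ` cdom U)" if U: "(U, \<phi>) \<in> N" for U \<phi>
    using cmap_inj[OF U] by (auto simp: cmap_image[OF U] intro!: open_Times chart_open[OF U])
  have 2: "open (cmap U \<phi> ` (cdom U \<inter> cdom V))"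
    if U: "(U, \<phi>) \<in> N" and V: "(V, \<psi>) \<in> N" for U \<phi> V \<psi>
    unfolding cdom_Int cmap_image[OF U Int_lower1] by (intro open_Times open_UNIV overlap_open[OF U V])
  show ?thesis
    unfolding smooth_atlas_def
    using 1 2 cotangent_transition_smooth by (auto simp: cotangent_bundle_iff)
qed

lemma cotangent_function_smooth:
  assumes "(U, \<phi>) \<in> N" "smooth_on (\<phi> ` U) (f \<circ> inv_into U \<phi>)"
  shows "smooth_on (cmap U \<phi> ` cdom U) ((\<lambda>q. f (fst q)) \<circ> inv_into (cdom U) (cmap U \<phi>))"
proof -
  let ?P = "\<phi> ` U \<times> (UNIV :: ('e \<Rightarrow>\<^sub>L real) set)"
  have P: "open ?P" by (intro open_Times open_UNIV chart_open[OF assms(1)])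
  have "smooth_on ?P (\<lambda>z. (f \<circ> inv_into U \<phi>) (fst z))"
    by (rule smooth_on_compose[OF fd P chart_open[OF assms(1)] _ smooth_on_bounded_linear[OF P bounded_linear_fst] assms(2)]) auto
  then show ?thesis unfolding cmap_image[OF assms(1) subset_refl]
    by (rule smooth_on_congI[OF P]) (auto simp: cmap_inv[OF assms(1)])
qed

lemma cotangent_bump_atlas: "bump_atlas (cotangent_bundle N)"
proof
  show "finite_dim TYPE('e \<times> ('e \<Rightarrow>\<^sub>L real))" by (rule finite_dim_prod_dual[OF fd])
  show "smooth_atlas (cotangent_bundle N)" by (rule cotangent_smooth_atlas)
  fix UU :: "'a covector set" and \<Phi> q
  assume "(UU, \<Phi>) \<in> cotangent_bundle N" and q: "q \<in> UU"
  then obtain U \<phi> where U: "(U, \<phi>) \<in> N" and eq: "UU = cdom U" "\<Phi> = cmap U \<phi>"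
    by (auto simp: cotangent_bundle_iff)
  have x: "fst q \<in> U" using q by (auto simp: eq cdom_def)
  obtain \<beta> :: "'a \<Rightarrow> real" and W where W: "fst q \<in> W" "W \<subseteq> U" "open (\<phi> ` W)" "\<forall>y\<in>W. \<beta> y = 1"
    and \<beta>: "smooth_on (\<phi> ` U) (\<beta> \<circ> inv_into U \<phi>)"
    and supp: "\<And>V \<psi> y. (V, \<psi>) \<in> N \<Longrightarrow> y \<in> V \<Longrightarrow> y \<notin> U \<Longrightarrow>
        \<exists>T. y \<in> T \<and> T \<subseteq> V \<and> open (\<psi> ` T) \<and> (\<forall>z\<in>T \<inter> U. \<beta> z = 0)"
    using cutoff[OF U x] by blast
  show "\<exists>\<beta> W. q \<in> W \<and> W \<subseteq> UU \<and> open (\<Phi> ` W) \<and>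
      (\<forall>y\<in>W. \<beta> y = (1::real)) \<and> smooth_on (\<Phi> ` UU) (\<beta> \<circ> inv_into UU \<Phi>) \<and>
      (\<forall>V \<psi> y. (V, \<psi>) \<in> cotangent_bundle N \<longrightarrow> y \<in> V \<longrightarrow> y \<notin> UU \<longrightarrow>
        (\<exists>T. y \<in> T \<and> T \<subseteq> V \<and> open (\<psi> ` T) \<and> (\<forall>z\<in>T \<inter> UU. \<beta> z = 0)))"
    unfolding eq
  \<comment> \<open>Sets saturated along the fibres are products in a cotangent chart, so all
    conditions reduce to those on the base.\<close>
  proof (rule exI[of _ "\<lambda>q. \<beta> (fst q)"], rule exI[of _ "cdom W"], intro conjI allI impI)
    show "q \<in> cdom W" using W(1) q by (auto simp: eq cdom_def)
    show "cdom W \<subseteq> cdom U" using W(2) by (auto simp: cdom_def)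
    show "open (cmap U \<phi> ` cdom W)" unfolding cmap_image[OF U W(2)] by (intro open_Times open_UNIV W(3))
    show "\<forall>y\<in>cdom W. \<beta> (fst y) = 1" using W(4) by (auto simp: cdom_def)
    show "smooth_on (cmap U \<phi> ` cdom U) ((\<lambda>q. \<beta> (fst q)) \<circ> inv_into (cdom U) (cmap U \<phi>))"
      by (rule cotangent_function_smooth[OF U \<beta>])
    fix VV \<Psi> r assume "(VV, \<Psi>) \<in> cotangent_bundle N" and r: "r \<in> VV" "r \<notin> cdom U"
    then obtain V \<psi> where V: "(V, \<psi>) \<in> N" and eq': "VV = cdom V" "\<Psi> = cmap V \<psi>"
      by (auto simp: cotangent_bundle_iff)
    have "fst r \<in> V" "fst r \<notin> U" using r by (auto simp: eq' cdom_def)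
    then obtain T where T: "fst r \<in> T" "T \<subseteq> V" "open (\<psi> ` T)" "\<forall>z\<in>T \<inter> U. \<beta> z = 0"
      using supp[OF V] by blast
    show "\<exists>T. r \<in> T \<and> T \<subseteq> VV \<and> open (\<Psi> ` T) \<and> (\<forall>z\<in>T \<inter> cdom U. \<beta> (fst z) = 0)"
      unfolding eq'
    proof (intro exI[of _ "cdom T"] conjI)
      show "r \<in> cdom T" using T(1) r by (auto simp: eq' cdom_def)
      show "cdom T \<subseteq> cdom V" using T(2) by (auto simp: cdom_def)
      show "open (cmap V \<psi> ` cdom T)" unfolding cmap_image[OF V T(2)] by (intro open_Times open_UNIV T(3))
      show "\<forall>z\<in>cdom T \<inter> cdom U. \<beta> (fst z) = 0" using T(4) by (auto simp: cdom_def)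
    qed
  qed
qed

end

text \<open>A locale of its own: an instance for the cotangent bundle inside
  \<open>bump_atlas\<close> itself would call for one for the cotangent bundle of that bundle, and
  so on without end.\<close>

locale cotangent = bump_atlas N for N :: "('a, 'e::real_normed_vector) atlas"

sublocale cotangent \<subseteq> T: bump_atlas "cotangent_bundle N"
  by (rule cotangent_bump_atlas)

section \<open>The Liouville and symplectic forms in coordinates\<close>

context cotangent
begin

abbreviation rep :: "'a set \<Rightarrow> ('a \<Rightarrow> 'e) \<Rightarrow> 'a covector vfield \<Rightarrow> 'e \<times> ('e \<Rightarrow>\<^sub>L real) \<Rightarrow> 'e \<times> ('e \<Rightarrow>\<^sub>L real)" where
  "rep U \<phi> \<equiv> T.vf_rep (cdom U, cmap U \<phi>)"

abbreviation "liou \<equiv> liouville N"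
abbreviation "sform \<equiv> liouville_symplectic N"
abbreviation "VT \<equiv> vector_fields (cotangent_bundle N)"
abbreviation "FT \<equiv> smooth_functions (cotangent_bundle N)"

text \<open>These functions detect verticality: a field is vertical exactly when it annihilates all
  pullbacks of smooth functions.\<close>

definition pull :: "('a \<Rightarrow> real) \<Rightarrow> 'a covector \<Rightarrow> real" where
  "pull f q = (if q \<in> points (cotangent_bundle N) then f (fst q) else 0)"

lemma cotangent_chart_mem: "(U, \<phi>) \<in> N \<Longrightarrow> (cdom U, cmap U \<phi>) \<in> cotangent_bundle N"
  by (auto simp: cotangent_bundle_iff)

lemma cdom_points: "(U, \<phi>) \<in> N \<Longrightarrow> q \<in> cdom U \<Longrightarrow> q \<in> points (cotangent_bundle N)"
  using T.chart_points[OF cotangent_chart_mem] .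

lemma cotangent_points_chart:
  assumes "q \<in> points (cotangent_bundle N)"
  obtains U \<phi> where "(U, \<phi>) \<in> N" "q \<in> cdom U"
  using T.points_chart[OF assms] by (auto simp: cotangent_bundle_iff)

lemma cmap_open: "(U, \<phi>) \<in> N \<Longrightarrow> open (cmap U \<phi> ` cdom U)"
  using T.chart_open[OF cotangent_chart_mem] .

lemma cmap_image_fst:
  assumes "(U, \<phi>) \<in> N" "z \<in> cmap U \<phi> ` cdom U"
  shows "fst z \<in> \<phi> ` U"
  using assms by (auto simp: cmap_image)

lemma cmap_inv_cmap: "(U, \<phi>) \<in> N \<Longrightarrow> q \<in> cdom U \<Longrightarrow> inv_into (cdom U) (cmap U \<phi>) (cmap U \<phi> q) = q"
  using T.chart_inv[OF cotangent_chart_mem] .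

lemma cdom_fst: "q \<in> cdom U \<Longrightarrow> fst q \<in> U"
  by (auto simp: cdom_def)

lemma pull_smooth:
  assumes f: "f \<in> smooth_functions N"
  shows "pull f \<in> FT"
proof (rule T.smooth_functionI)
  show "q \<notin> points (cotangent_bundle N) \<Longrightarrow> pull f q = 0" for q by (simp add: pull_def)
  fix UU \<Phi> assume "(UU, \<Phi>) \<in> cotangent_bundle N"
  then obtain U \<phi> where U: "(U, \<phi>) \<in> N" and eq: "UU = cdom U" "\<Phi> = cmap U \<phi>"
    by (auto simp: cotangent_bundle_iff)
  show "smooth_on (\<Phi> ` UU) (pull f \<circ> inv_into UU \<Phi>)"
    unfolding eq
  proof (rule smooth_on_congI[OF cmap_open[OF U] cotangent_function_smooth[OF U smooth_function_local[OF f U]]])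
    fix z assume "z \<in> cmap U \<phi> ` cdom U"
    then have "inv_into (cdom U) (cmap U \<phi>) z \<in> points (cotangent_bundle N)"
      using cdom_points[OF U] by (auto simp: cmap_inv_cmap[OF U])
    then show "(pull f \<circ> inv_into (cdom U) (cmap U \<phi>)) z = ((\<lambda>q. f (fst q)) \<circ> inv_into (cdom U) (cmap U \<phi>)) z"
      by (simp add: pull_def)
  qed
qed

lemma dproj_eq: "dproj N w f = (if f \<in> smooth_functions N then w (pull f) else 0)"
  by (simp add: dproj_def pull_def[abs_def])

text \<open>In a cotangent chart the projection is \<open>fst\<close>, so its differential drops the
  dual component.\<close>

lemma dproj_cv:
  assumes U: "(U, \<phi>) \<in> N" and q: "q \<in> cdom U"
  shows "dproj N (T.cv (cdom U, cmap U \<phi>) q u) = cv (U, \<phi>) (fst q) (fst u)"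
proof
  fix f
  show "dproj N (T.cv (cdom U, cmap U \<phi>) q u) f = cv (U, \<phi>) (fst q) (fst u) f"
  proof (cases "f \<in> smooth_functions N")
    case True
    let ?f = "f \<circ> inv_into U \<phi>" and ?z = "cmap U \<phi> q"
    have z: "?z \<in> cmap U \<phi> ` cdom U" using q by blast
    have d: "(?f has_derivative deriv_at ?f (fst ?z)) (at (fst ?z))"
      unfolding fst_cmap by (rule local_has_derivative[OF True U cdom_fst[OF q]])
    have "deriv_at (pull f \<circ> inv_into (cdom U) (cmap U \<phi>)) ?z = deriv_at (\<lambda>z. ?f (fst z)) ?z"
    proof (rule deriv_at_cong[OF cmap_open[OF U] z])
      fix w assume "w \<in> cmap U \<phi> ` cdom U"
      then obtain r where r: "r \<in> cdom U" "w = cmap U \<phi> r" by blast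
      show "(pull f \<circ> inv_into (cdom U) (cmap U \<phi>)) w = ?f (fst w)"
        using cdom_points[OF U r(1)] chart_inv[OF U cdom_fst[OF r(1)]]
        by (simp add: r(2) cmap_inv_cmap[OF U r(1)] pull_def fst_cmap)
    qed
    also have "\<dots> = (\<lambda>u. deriv_at ?f (fst ?z) (fst u))"
      by (rule deriv_at_eq[OF has_derivative_compose[OF bounded_linear_imp_has_derivative[OF bounded_linear_fst] d]])
    finally show ?thesis
      using True by (simp add: dproj_eq T.cv_apply[OF pull_smooth[OF True]] cv_apply[OF True] fst_cmap)
  qed (simp add: dproj_eq cv_outside)
qed

lemma dproj_rep:
  assumes "Y \<in> VT" "(U, \<phi>) \<in> N" "q \<in> cdom U"
  shows "dproj N (Y q) = cv (U, \<phi>) (fst q) (fst (rep U \<phi> Y (cmap U \<phi> q)))"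
  by (subst T.vf_rep[OF assms(1) cotangent_chart_mem[OF assms(2)] assms(3)]) (rule dproj_cv[OF assms(2,3)])

text \<open>The classical expression p dq: only the base component of the field is seen.\<close>

lemma liouville_rep:
  assumes "Y \<in> VT" "(U, \<phi>) \<in> N" "q \<in> cdom U"
  shows "liou Y q = snd (cmap U \<phi> q) (fst (rep U \<phi> Y (cmap U \<phi> q)))"
  using cdom_points[OF assms(2,3)]
  by (simp add: liouville_def dproj_rep[OF assms] cmap_apply[OF assms(2,3)])

lemma liouville_local:
  assumes "Y \<in> VT" "(U, \<phi>) \<in> N" "z \<in> cmap U \<phi> ` cdom U"
  shows "(liou Y \<circ> inv_into (cdom U) (cmap U \<phi>)) z = blinfun_apply (snd z) (fst (rep U \<phi> Y z))"
  using assms(3) by (auto simp: cmap_inv_cmap[OF assms(2)] liouville_rep[OF assms(1,2)])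

lemma rep_smooth: "Y \<in> VT \<Longrightarrow> (U, \<phi>) \<in> N \<Longrightarrow> smooth_on (cmap U \<phi> ` cdom U) (rep U \<phi> Y)"
  by (rule T.vf_rep_smooth[OF _ cotangent_chart_mem])

lemma rep_has_derivative:
  "Y \<in> VT \<Longrightarrow> (U, \<phi>) \<in> N \<Longrightarrow> z \<in> cmap U \<phi> ` cdom U \<Longrightarrow> (rep U \<phi> Y has_derivative deriv_at (rep U \<phi> Y) z) (at z)"
  by (rule T.vf_rep_has_derivative[OF _ cotangent_chart_mem])

lemma cotangent_smooth_functionI:
  assumes "\<And>q. q \<notin> points (cotangent_bundle N) \<Longrightarrow> f q = 0"
    and "\<And>U \<phi>. (U, \<phi>) \<in> N \<Longrightarrow> smooth_on (cmap U \<phi> ` cdom U) (f \<circ> inv_into (cdom U) (cmap U \<phi>))"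
  shows "f \<in> FT"
  by (rule T.smooth_functionI) (use assms in \<open>auto simp: cotangent_bundle_iff\<close>)

lemma liouville_smooth:
  assumes Y: "Y \<in> VT"
  shows "liou Y \<in> FT"
proof (rule cotangent_smooth_functionI)
  show "q \<notin> points (cotangent_bundle N) \<Longrightarrow> liou Y q = 0" for q by (simp add: liouville_def)
  fix U \<phi> assume U: "(U, \<phi>) \<in> N"
  note S = cmap_open[OF U]
  have "smooth_on (cmap U \<phi> ` cdom U) (\<lambda>z. blinfun_apply (snd z) (fst (rep U \<phi> Y z)))"
    by (rule smooth_on_blinfun_apply[OF S smooth_on_bounded_linear[OF S bounded_linear_snd] smooth_on_fst[OF S rep_smooth[OF Y U]]])
  then show "smooth_on (cmap U \<phi> ` cdom U) (liou Y \<circ> inv_into (cdom U) (cmap U \<phi>))"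
    by (rule smooth_on_congI[OF S _ liouville_local[OF Y U]])
qed

text \<open>Product rule for the pairing of \<open>snd z\<close> with the base component of
  \<open>Y\<close>. The first summand involves no derivative of components; the second cancels
  against the bracket term of the symplectic form.\<close>

lemma apply_liouville:
  assumes X: "X \<in> VT" and Y: "Y \<in> VT" and U: "(U, \<phi>) \<in> N" and q: "q \<in> cdom U"
  defines "z \<equiv> cmap U \<phi> q"
  shows "apply_vf X (liou Y) q = snd (rep U \<phi> X z) (fst (rep U \<phi> Y z)) + snd z (fst (deriv_at (rep U \<phi> Y) z (rep U \<phi> X z)))"
proof -
  have z: "z \<in> cmap U \<phi> ` cdom U" unfolding z_def using q by blast
  have "((\<lambda>w. blinfun_apply (snd w) (fst (rep U \<phi> Y w))) has_derivative
      (\<lambda>u. blinfun_apply (snd z) (fst (deriv_at (rep U \<phi> Y) z u)) + blinfun_apply (snd u) (fst (rep U \<phi> Y z)))) (at z)"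
    by (rule bounded_bilinear.FDERIV[OF bounded_bilinear_blinfun_apply
          bounded_linear_imp_has_derivative[OF bounded_linear_snd]
          bounded_linear.has_derivative[OF bounded_linear_fst rep_has_derivative[OF Y U z]]])
  then have "deriv_at (\<lambda>w. blinfun_apply (snd w) (fst (rep U \<phi> Y w))) z =
      (\<lambda>u. blinfun_apply (snd z) (fst (deriv_at (rep U \<phi> Y) z u)) + blinfun_apply (snd u) (fst (rep U \<phi> Y z)))"
    by (rule deriv_at_eq)
  moreover have "deriv_at (liou Y \<circ> inv_into (cdom U) (cmap U \<phi>)) z = deriv_at (\<lambda>w. blinfun_apply (snd w) (fst (rep U \<phi> Y w))) z"
    by (rule deriv_at_cong[OF cmap_open[OF U] z liouville_local[OF Y U]])
  ultimately show ?thesis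
    using T.vf_apply_rep[OF X cotangent_chart_mem[OF U] q liouville_smooth[OF Y]]
    by (simp add: apply_vf_def z_def)
qed

lemma symplectic_eq: "sform X Y = apply_vf X (liou Y) - apply_vf Y (liou X) - liou (lie_bracket X Y)"
  by (simp add: liouville_symplectic_def exterior_derivative_def)

lemma symplectic_smooth: "X \<in> VT \<Longrightarrow> Y \<in> VT \<Longrightarrow> sform X Y \<in> FT"
  unfolding symplectic_eq
  by (intro T.smooth_function_diff T.apply_vf_smooth liouville_smooth T.lie_bracket_vector_field)

text \<open>The canonical form dp wedge dq in Darboux coordinates. All derivatives of components
  have cancelled, so the value at \<open>q\<close> depends only on the two vectors at
  \<open>q\<close>.\<close>

lemma symplectic_rep:
  assumes X: "X \<in> VT" and Y: "Y \<in> VT" and U: "(U, \<phi>) \<in> N" and q: "q \<in> cdom U"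
  shows "sform X Y q = snd (rep U \<phi> X (cmap U \<phi> q)) (fst (rep U \<phi> Y (cmap U \<phi> q)))
    - snd (rep U \<phi> Y (cmap U \<phi> q)) (fst (rep U \<phi> X (cmap U \<phi> q)))"
proof -
  have z: "cmap U \<phi> q \<in> cmap U \<phi> ` cdom U" using q by blast
  show ?thesis
    by (simp add: symplectic_eq apply_liouville[OF X Y U q] apply_liouville[OF Y X U q]
        liouville_rep[OF T.lie_bracket_vector_field[OF X Y] U q]
        T.vf_rep_lie_bracket[OF X Y cotangent_chart_mem[OF U] z] blinfun.diff_right)
qed

text \<open>Test vectors \<open>(v, 0)\<close> read off the dual component and \<open>(0, c)\<close>
  the base component; each of them is the value at \<open>q\<close> of some global field.\<close>

lemma symplectic_pairing_inj:
  fixes a b :: "'e \<times> ('e \<Rightarrow>\<^sub>L real)"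
  assumes U: "(U, \<phi>) \<in> N" and q: "q \<in> cdom U"
    and eq: "\<And>Z. Z \<in> VT \<Longrightarrow> snd a (fst (rep U \<phi> Z (cmap U \<phi> q))) - snd (rep U \<phi> Z (cmap U \<phi> q)) (fst a)
      = snd b (fst (rep U \<phi> Z (cmap U \<phi> q))) - snd (rep U \<phi> Z (cmap U \<phi> q)) (fst b)"
  shows "a = b"
proof -
  have e: "blinfun_apply (snd a) (fst u) - blinfun_apply (snd u) (fst a) = blinfun_apply (snd b) (fst u) - blinfun_apply (snd u) (fst b)" for u
  proof -
    obtain Z where Z: "Z \<in> VT" "Z q = T.cv (cdom U, cmap U \<phi>) q u"
      using T.vector_field_through[OF cotangent_chart_mem[OF U] q] by blast
    have "rep U \<phi> Z (cmap U \<phi> q) = u" by (rule T.vf_rep_unique[of _ _ q Z, OF cotangent_chart_mem[OF U] q Z(2)])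
    then show ?thesis using eq[OF Z(1)] by simp
  qed
  have "blinfun_apply (snd a) v = blinfun_apply (snd b) v" for v using e[of "(v, 0)"] by simp
  then have s: "snd a = snd b" by (rule blinfun_eqI)
  have "c (fst a - fst b) = 0" for c :: "'e \<Rightarrow>\<^sub>L real" using e[of "(0, c)"] by (simp add: blinfun.diff_right)
  then have "fst a - fst b = 0" by (rule dual_separates[OF fd])
  with s show ?thesis by (simp add: prod_eq_iff)
qed

lemma symplectic_nondegenerate:
  assumes X: "X \<in> VT" and Y: "Y \<in> VT" and eq: "\<And>Z. Z \<in> VT \<Longrightarrow> sform X Z = sform Y Z"
  shows "X = Y"
proof (rule T.vector_field_eqI_rep[OF X Y])
  fix UU \<Phi> q assume "(UU, \<Phi>) \<in> cotangent_bundle N" and q: "q \<in> UU"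
  then obtain U \<phi> where U: "(U, \<phi>) \<in> N" and UU: "UU = cdom U" "\<Phi> = cmap U \<phi>"
    by (auto simp: cotangent_bundle_iff)
  show "T.vf_rep (UU, \<Phi>) X (\<Phi> q) = T.vf_rep (UU, \<Phi>) Y (\<Phi> q)"
    unfolding UU
  proof (rule symplectic_pairing_inj[OF U q[unfolded UU]])
    fix Z assume Z: "Z \<in> VT"
    show "snd (rep U \<phi> X (cmap U \<phi> q)) (fst (rep U \<phi> Z (cmap U \<phi> q))) - snd (rep U \<phi> Z (cmap U \<phi> q)) (fst (rep U \<phi> X (cmap U \<phi> q)))
      = snd (rep U \<phi> Y (cmap U \<phi> q)) (fst (rep U \<phi> Z (cmap U \<phi> q))) - snd (rep U \<phi> Z (cmap U \<phi> q)) (fst (rep U \<phi> Y (cmap U \<phi> q)))"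
      using fun_cong[OF eq[OF Z], of q] by (simp add: symplectic_rep[OF X Z U q[unfolded UU]] symplectic_rep[OF Y Z U q[unfolded UU]])
  qed
qed

text \<open>Both the cotangent lift and the product of vertical fields are obtained by solving
  \<open>i(W)\<omega> = \<alpha>\<close>: the local solutions glue because \<open>\<omega>\<close> is nondegenerate.\<close>

lemma symplectic_sharp:
  fixes t :: "('a, 'e) chart \<Rightarrow> 'e \<times> ('e \<Rightarrow>\<^sub>L real) \<Rightarrow> 'e \<times> ('e \<Rightarrow>\<^sub>L real)"
  assumes smooth: "\<And>U \<phi>. (U, \<phi>) \<in> N \<Longrightarrow> smooth_on (cmap U \<phi> ` cdom U) (t (U, \<phi>))"
    and \<alpha>: "\<And>U \<phi> q Z. (U, \<phi>) \<in> N \<Longrightarrow> q \<in> cdom U \<Longrightarrow> Z \<in> VT \<Longrightarrow>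
      \<alpha> Z q = snd (t (U, \<phi>) (cmap U \<phi> q)) (fst (rep U \<phi> Z (cmap U \<phi> q)))
        - snd (rep U \<phi> Z (cmap U \<phi> q)) (fst (t (U, \<phi>) (cmap U \<phi> q)))"
  obtains W where "W \<in> VT" "\<And>Z q. Z \<in> VT \<Longrightarrow> q \<in> points (cotangent_bundle N) \<Longrightarrow> sform W Z q = \<alpha> Z q"
    "\<And>U \<phi> q. (U, \<phi>) \<in> N \<Longrightarrow> q \<in> cdom U \<Longrightarrow> rep U \<phi> W (cmap U \<phi> q) = t (U, \<phi>) (cmap U \<phi> q)"
proof -
  have sol: "rep U \<phi> Y (cmap U \<phi> q) = t (U, \<phi>) (cmap U \<phi> q)"
    if U: "(U, \<phi>) \<in> N" and q: "q \<in> cdom U" and Y: "Y \<in> VT" "\<And>Z. Z \<in> VT \<Longrightarrow> sform Y Z q = \<alpha> Z q" for U \<phi> q Y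
    by (rule symplectic_pairing_inj[OF U q]) (simp add: Y(2) flip: \<alpha>[OF U q] symplectic_rep[OF Y(1) _ U q])
  \<comment> \<open>The right-hand side \<open>\<alpha> Z q\<close> mentions no chart. A global
    field through the local solution of the first chart therefore solves the equation at
    \<open>q\<close>, and nondegeneracy identifies its components in the second chart.\<close>
  have agree: "T.cv (cdom U, cmap U \<phi>) q (t (U, \<phi>) (cmap U \<phi> q)) = T.cv (cdom V, cmap V \<psi>) q (t (V, \<psi>) (cmap V \<psi> q))"
    if U: "(U, \<phi>) \<in> N" and V: "(V, \<psi>) \<in> N" and q: "q \<in> cdom U" "q \<in> cdom V" for U \<phi> V \<psi> q
  proof -
    obtain Y where Y: "Y \<in> VT" "Y q = T.cv (cdom U, cmap U \<phi>) q (t (U, \<phi>) (cmap U \<phi> q))"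
      using T.vector_field_through[OF cotangent_chart_mem[OF U] q(1)] by blast
    have "rep U \<phi> Y (cmap U \<phi> q) = t (U, \<phi>) (cmap U \<phi> q)"
      by (rule T.vf_rep_unique[of _ _ q Y, OF cotangent_chart_mem[OF U] q(1) Y(2)])
    then have "sform Y Z q = \<alpha> Z q" if "Z \<in> VT" for Z
      by (simp add: symplectic_rep[OF Y(1) that U q(1)] \<alpha>[OF U q(1) that])
    then have "rep V \<psi> Y (cmap V \<psi> q) = t (V, \<psi>) (cmap V \<psi> q)" by (rule sol[OF V q(2) Y(1)])
    then show ?thesis using Y(2) T.vf_rep[OF Y(1) cotangent_chart_mem[OF V] q(2)] by simp
  qed
  \<comment> \<open>\<open>t\<close> is indexed by charts of the base; \<open>c\<close> finds a base
    chart that induces the given cotangent chart.\<close>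
  define c where "c C = (SOME c. c \<in> N \<and> C = (cdom (fst c), cmap (fst c) (snd c)))" for C
  have c: "c C \<in> N \<and> C = (cdom (fst (c C)), cmap (fst (c C)) (snd (c C)))" if "C \<in> cotangent_bundle N" for C
    unfolding c_def by (rule someI_ex) (use that in \<open>force simp: cotangent_bundle_iff\<close>)
  have c': "\<exists>U \<phi>. (U, \<phi>) \<in> N \<and> c (UU, \<Phi>) = (U, \<phi>) \<and> UU = cdom U \<and> \<Phi> = cmap U \<phi>"
    if "(UU, \<Phi>) \<in> cotangent_bundle N" for UU \<Phi>
    using c[OF that] by (cases "c (UU, \<Phi>)") auto
  obtain W where W: "W \<in> VT" "\<And>UU \<Phi> q. (UU, \<Phi>) \<in> cotangent_bundle N \<Longrightarrow> q \<in> UU \<Longrightarrow>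
      T.vf_rep (UU, \<Phi>) W (\<Phi> q) = t (c (UU, \<Phi>)) (\<Phi> q)"
  proof (rule T.vector_field_glue[of "\<lambda>C. t (c C)"])
    show "smooth_on (\<Phi> ` UU) (t (c (UU, \<Phi>)))" if "(UU, \<Phi>) \<in> cotangent_bundle N" for UU \<Phi>
      using c'[OF that] smooth by auto
    show "T.cv (UU, \<Phi>) q (t (c (UU, \<Phi>)) (\<Phi> q)) = T.cv (VV, \<Psi>) q (t (c (VV, \<Psi>)) (\<Psi> q))"
      if UU: "(UU, \<Phi>) \<in> cotangent_bundle N" and VV: "(VV, \<Psi>) \<in> cotangent_bundle N" and q: "q \<in> UU" "q \<in> VV" for UU \<Phi> VV \<Psi> q
    proof -
      obtain U \<phi> where U: "(U, \<phi>) \<in> N" "c (UU, \<Phi>) = (U, \<phi>)" "UU = cdom U" "\<Phi> = cmap U \<phi>" using c'[OF UU] by blast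
      obtain V \<psi> where V: "(V, \<psi>) \<in> N" "c (VV, \<Psi>) = (V, \<psi>)" "VV = cdom V" "\<Psi> = cmap V \<psi>" using c'[OF VV] by blast
      show ?thesis
        using agree[OF U(1) V(1) q[unfolded U(3) V(3)]] U(2) V(2) unfolding U(3,4) V(3,4) by simp
    qed
  qed blast
  have \<omega>: "sform W Z q = \<alpha> Z q" if Z: "Z \<in> VT" and q: "q \<in> points (cotangent_bundle N)" for Z q
  proof -
    obtain UU \<Phi> where UU: "(UU, \<Phi>) \<in> cotangent_bundle N" "q \<in> UU" using T.points_chart[OF q] by blast
    obtain U \<phi> where U: "(U, \<phi>) \<in> N" "c (UU, \<Phi>) = (U, \<phi>)" "UU = cdom U" "\<Phi> = cmap U \<phi>" using c'[OF UU(1)] by blast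
    have "rep U \<phi> W (cmap U \<phi> q) = t (U, \<phi>) (cmap U \<phi> q)" using W(2)[OF UU] U by simp
    moreover have "q \<in> cdom U" using UU U by simp
    ultimately show ?thesis using symplectic_rep[OF W(1) Z U(1)] \<alpha>[OF U(1) _ Z] by simp
  qed
  show ?thesis
  proof (rule that[OF W(1) \<omega>])
    show "rep U \<phi> W (cmap U \<phi> q) = t (U, \<phi>) (cmap U \<phi> q)" if "(U, \<phi>) \<in> N" "q \<in> cdom U" for U \<phi> q
      by (rule sol[OF that W(1) \<omega>]) (use cdom_points[OF that] in auto)
  qed
qed

text \<open>Cartan's formula for the Liouville form, immediate from the invariant definition of the
  exterior derivative.\<close>

lemma liouville_lie_derivative:
  "lie_derivative Y liou Z = sform Y Z + apply_vf Z (liou Y)"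
  by (simp add: lie_derivative_def symplectic_eq)

text \<open>The Liouville form sees only the projection, so a field over \<open>X\<close> satisfies
  \<open>liou Y = H\<close>; by Cartan's formula the equation for \<open>Y\<close> then says
  precisely that the form is preserved. That the solution lies over \<open>X\<close> is read off
  from its components.\<close>

lemma cotangent_lift_exists:
  assumes X: "X \<in> vector_fields N"
  shows "\<exists>Y. is_cotangent_lift N X Y"
proof -
  let ?r = "\<lambda>U \<phi>. vf_rep (U, \<phi>) X"
  \<comment> \<open>Hamilton's equations for \<open>H\<close>: the fibre component is minus the
    transposed derivative of \<open>X\<close>, applied to the covector.\<close>
  define t :: "('a, 'e) chart \<Rightarrow> 'e \<times> ('e \<Rightarrow>\<^sub>L real) \<Rightarrow> 'e \<times> ('e \<Rightarrow>\<^sub>L real)"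
    where "t = (\<lambda>(U, \<phi>) z. (?r U \<phi> (fst z), - Blinfun (\<lambda>v. blinfun_apply (snd z) (deriv_at (?r U \<phi>) (fst z) v))))"
  define H where "H q = (if q \<in> points (cotangent_bundle N) then snd q (X (fst q)) else 0)" for q
  have lin: "bounded_linear (\<lambda>v. blinfun_apply a (deriv_at (?r U \<phi>) y v))"
    if "(U, \<phi>) \<in> N" "y \<in> \<phi> ` U" for U \<phi> y and a :: "'e \<Rightarrow>\<^sub>L real"
    by (rule bounded_linear_compose[OF blinfun.bounded_linear_right
          has_derivative_bounded_linear[OF vf_rep_has_derivative[OF X that]]])
  have base: "smooth_on (cmap U \<phi> ` cdom U) (\<lambda>z. ?r U \<phi> (fst z))" if U: "(U, \<phi>) \<in> N" for U \<phi>
    by (rule smooth_on_compose[OF fd cmap_open[OF U] chart_open[OF U] cmap_image_fst[OF U]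
          smooth_on_bounded_linear[OF cmap_open[OF U] bounded_linear_fst] vf_rep_smooth[OF X U]])
  have t_smooth: "smooth_on (cmap U \<phi> ` cdom U) (t (U, \<phi>))" if U: "(U, \<phi>) \<in> N" for U \<phi>
  proof -
    note S = cmap_open[OF U]
    have "smooth_on (cmap U \<phi> ` cdom U) (\<lambda>z. Blinfun (\<lambda>v. blinfun_apply (snd z) (deriv_at (?r U \<phi>) (fst z) v)))"
    proof (rule smooth_on_blinfun_pointwise[OF fd S])
      fix v
      have "smooth_on (cmap U \<phi> ` cdom U) (\<lambda>z. deriv_at (?r U \<phi>) (fst z) v)"
        by (rule smooth_on_compose[OF fd S chart_open[OF U] cmap_image_fst[OF U]
              smooth_on_bounded_linear[OF S bounded_linear_fst] smooth_on_deriv[OF vf_rep_smooth[OF X U]]])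
      then have sm: "smooth_on (cmap U \<phi> ` cdom U) (\<lambda>z. blinfun_apply (snd z) (deriv_at (?r U \<phi>) (fst z) v))"
        by (rule smooth_on_blinfun_apply[OF S smooth_on_bounded_linear[OF S bounded_linear_snd]])
      show "smooth_on (cmap U \<phi> ` cdom U) (\<lambda>z. blinfun_apply (Blinfun (\<lambda>v. blinfun_apply (snd z) (deriv_at (?r U \<phi>) (fst z) v))) v)"
        by (rule smooth_on_congI[OF S sm]) (simp add: bounded_linear_Blinfun_apply[OF lin[OF U cmap_image_fst[OF U]]])
    qed
    from smooth_on_Pair[OF S base[OF U] smooth_on_uminus[OF S this]] show ?thesis
      by (simp add: t_def)
  qed
  have H_local: "(H \<circ> inv_into (cdom U) (cmap U \<phi>)) z = blinfun_apply (snd z) (?r U \<phi> (fst z))"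
    if U: "(U, \<phi>) \<in> N" and z: "z \<in> cmap U \<phi> ` cdom U" for U \<phi> z
  proof -
    obtain q where q: "q \<in> cdom U" "z = cmap U \<phi> q" using z by blast
    have "(H \<circ> inv_into (cdom U) (cmap U \<phi>)) z = snd q (X (fst q))"
      by (simp add: q(2) cmap_inv_cmap[OF U q(1)] H_def cdom_points[OF U q(1)])
    then show ?thesis
      by (simp add: q(2) cmap_apply[OF U q(1)] fst_cmap flip: vf_rep[OF X U cdom_fst[OF q(1)]])
  qed
  have H: "H \<in> FT"
  proof (rule cotangent_smooth_functionI)
    show "q \<notin> points (cotangent_bundle N) \<Longrightarrow> H q = 0" for q by (simp add: H_def)
    fix U \<phi> assume U: "(U, \<phi>) \<in> N"
    note S = cmap_open[OF U]
    show "smooth_on (cmap U \<phi> ` cdom U) (H \<circ> inv_into (cdom U) (cmap U \<phi>))"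
      by (rule smooth_on_congI[OF S smooth_on_blinfun_apply[OF S smooth_on_bounded_linear[OF S bounded_linear_snd] base[OF U]] H_local[OF U]])
  qed
  have \<alpha>: "- apply_vf Z H q = snd (t (U, \<phi>) (cmap U \<phi> q)) (fst (rep U \<phi> Z (cmap U \<phi> q)))
        - snd (rep U \<phi> Z (cmap U \<phi> q)) (fst (t (U, \<phi>) (cmap U \<phi> q)))"
    if U: "(U, \<phi>) \<in> N" and q: "q \<in> cdom U" and Z: "Z \<in> VT" for U \<phi> q Z
  proof -
    let ?z = "cmap U \<phi> q"
    have z: "?z \<in> cmap U \<phi> ` cdom U" using q by blast
    have "((\<lambda>w. blinfun_apply (snd w) (?r U \<phi> (fst w))) has_derivative
        (\<lambda>u. blinfun_apply (snd ?z) (deriv_at (?r U \<phi>) (fst ?z) (fst u)) + blinfun_apply (snd u) (?r U \<phi> (fst ?z)))) (at ?z)"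
      by (rule bounded_bilinear.FDERIV[OF bounded_bilinear_blinfun_apply
            bounded_linear_imp_has_derivative[OF bounded_linear_snd]
            has_derivative_compose[OF bounded_linear_imp_has_derivative[OF bounded_linear_fst]
              vf_rep_has_derivative[OF X U cmap_image_fst[OF U z]]]])
    then have "deriv_at (\<lambda>w. blinfun_apply (snd w) (?r U \<phi> (fst w))) ?z =
        (\<lambda>u. blinfun_apply (snd ?z) (deriv_at (?r U \<phi>) (fst ?z) (fst u)) + blinfun_apply (snd u) (?r U \<phi> (fst ?z)))"
      by (rule deriv_at_eq)
    moreover have "deriv_at (H \<circ> inv_into (cdom U) (cmap U \<phi>)) ?z = deriv_at (\<lambda>w. blinfun_apply (snd w) (?r U \<phi> (fst w))) ?z"
      by (rule deriv_at_cong[OF cmap_open[OF U] z H_local[OF U]])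
    ultimately show ?thesis
      using T.vf_apply_rep[OF Z cotangent_chart_mem[OF U] q H]
      by (simp add: apply_vf_def t_def blinfun.minus_left bounded_linear_Blinfun_apply[OF lin[OF U cmap_image_fst[OF U z]]])
  qed
  obtain Y where Y: "Y \<in> VT" "\<And>Z q. Z \<in> VT \<Longrightarrow> q \<in> points (cotangent_bundle N) \<Longrightarrow> sform Y Z q = - apply_vf Z H q"
    "\<And>U \<phi> q. (U, \<phi>) \<in> N \<Longrightarrow> q \<in> cdom U \<Longrightarrow> rep U \<phi> Y (cmap U \<phi> q) = t (U, \<phi>) (cmap U \<phi> q)"
    using symplectic_sharp[of t "\<lambda>Z q. - apply_vf Z H q", OF t_smooth \<alpha>] by blast
  have proj: "dproj N (Y q) = X (fst q)" if q: "q \<in> points (cotangent_bundle N)" for q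
  proof -
    obtain U \<phi> where U: "(U, \<phi>) \<in> N" "q \<in> cdom U" using cotangent_points_chart[OF q] .
    show ?thesis
      using dproj_rep[OF Y(1) U] Y(3)[OF U] vf_rep[OF X U(1) cdom_fst[OF U(2)]] by (simp add: t_def fst_cmap)
  qed
  then have liouY: "liou Y = H" by (auto simp: liouville_def H_def)
  have "lie_derivative Y liou Z = 0" if Z: "Z \<in> VT" for Z
  proof
    fix q
    show "lie_derivative Y liou Z q = 0 q"
    proof (cases "q \<in> points (cotangent_bundle N)")
      case True
      then show ?thesis using Y(2)[OF Z True] by (simp add: liouville_lie_derivative liouY)
    next
      case False
      then show ?thesis
        using T.smooth_function_outside[OF symplectic_smooth[OF Y(1) Z]] T.smooth_function_outside[OF T.apply_vf_smooth[OF Z H]]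
        by (simp add: liouville_lie_derivative liouY)
    qed
  qed
  then show ?thesis using Y(1) proj by (auto simp: is_cotangent_lift_def)
qed

section \<open>Vertical fields and existence of their product\<close>

lemma vertical_rep:
  assumes s: "s \<in> vertical_fields N" and U: "(U, \<phi>) \<in> N" and z: "z \<in> cmap U \<phi> ` cdom U"
  shows "fst (rep U \<phi> s z) = 0"
proof -
  obtain q where q: "q \<in> cdom U" "z = cmap U \<phi> q" using z by blast
  have "s \<in> VT" "dproj N (s q) = 0" using s cdom_points[OF U q(1)] by (auto simp: vertical_fields_def)
  then have "cv (U, \<phi>) (fst q) (fst (rep U \<phi> s z)) = cv (U, \<phi>) (fst q) 0"
    using dproj_rep[OF _ U q(1), of s] by (simp add: q(2) cv_zero[OF U cdom_fst[OF q(1)]])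
  then show ?thesis by (rule cv_inj[OF U cdom_fst[OF q(1)]])
qed

lemma vertical_fieldI:
  assumes s: "s \<in> VT" and "\<And>U \<phi> q. (U, \<phi>) \<in> N \<Longrightarrow> q \<in> cdom U \<Longrightarrow> fst (rep U \<phi> s (cmap U \<phi> q)) = 0"
  shows "s \<in> vertical_fields N"
proof -
  have "dproj N (s q) = 0" if q: "q \<in> points (cotangent_bundle N)" for q
  proof -
    obtain U \<phi> where U: "(U, \<phi>) \<in> N" "q \<in> cdom U" using cotangent_points_chart[OF q] .
    show ?thesis using dproj_rep[OF s U] assms(2)[OF U] by (simp add: cv_zero[OF U(1) cdom_fst[OF U(2)]])
  qed
  then show ?thesis using s by (simp add: vertical_fields_def)
qed

text \<open>For \<open>s' = (0, a')\<close> the form \<open>i(s')\<omega>\<close> pairs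
  \<open>a'\<close> with the base component, and \<open>s\<close>, having no base component,
  differentiates only the coefficient \<open>a'\<close>. The product is the derivative of
  \<open>a'\<close> along \<open>s\<close>, that is, the flat connection of the fibres as vector
  spaces.\<close>

lemma vertical_mult_exists:
  assumes s: "s \<in> vertical_fields N" and s': "s' \<in> vertical_fields N"
  shows "\<exists>t. t \<in> vertical_fields N \<and> (\<forall>Z\<in>VT. sform t Z = lie_derivative s (sform s') Z)"
proof -
  have V: "s \<in> VT" "s' \<in> VT" using s s' by (auto simp: vertical_fields_def)
  define t :: "('a, 'e) chart \<Rightarrow> 'e \<times> ('e \<Rightarrow>\<^sub>L real) \<Rightarrow> 'e \<times> ('e \<Rightarrow>\<^sub>L real)"
    where "t = (\<lambda>(U, \<phi>) z. (0, snd (deriv_at (rep U \<phi> s') z (rep U \<phi> s z))))"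
  have t_smooth: "smooth_on (cmap U \<phi> ` cdom U) (t (U, \<phi>))" if U: "(U, \<phi>) \<in> N" for U \<phi>
  proof -
    note S = cmap_open[OF U]
    show ?thesis unfolding t_def prod.case
      by (rule smooth_on_Pair[OF S smooth_on_const smooth_on_snd[OF S smooth_on_deriv_apply[OF T.fd S rep_smooth[OF V(2) U] rep_smooth[OF V(1) U]]]])
  qed
  have \<alpha>: "lie_derivative s (sform s') Z q = snd (t (U, \<phi>) (cmap U \<phi> q)) (fst (rep U \<phi> Z (cmap U \<phi> q)))
        - snd (rep U \<phi> Z (cmap U \<phi> q)) (fst (t (U, \<phi>) (cmap U \<phi> q)))"
    if U: "(U, \<phi>) \<in> N" and q: "q \<in> cdom U" and Z: "Z \<in> VT" for U \<phi> q Z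
  proof -
    let ?z = "cmap U \<phi> q" and ?s = "rep U \<phi> s" and ?s' = "rep U \<phi> s'" and ?Z = "rep U \<phi> Z"
    have z: "?z \<in> cmap U \<phi> ` cdom U" using q by blast
    have "((\<lambda>w. blinfun_apply (snd (?s' w)) (fst (?Z w))) has_derivative
        (\<lambda>u. blinfun_apply (snd (?s' ?z)) (fst (deriv_at ?Z ?z u)) + blinfun_apply (snd (deriv_at ?s' ?z u)) (fst (?Z ?z)))) (at ?z)"
      by (rule bounded_bilinear.FDERIV[OF bounded_bilinear_blinfun_apply
            bounded_linear.has_derivative[OF bounded_linear_snd rep_has_derivative[OF V(2) U z]]
            bounded_linear.has_derivative[OF bounded_linear_fst rep_has_derivative[OF Z U z]]])
    then have d1: "deriv_at (\<lambda>w. blinfun_apply (snd (?s' w)) (fst (?Z w))) ?z =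
        (\<lambda>u. blinfun_apply (snd (?s' ?z)) (fst (deriv_at ?Z ?z u)) + blinfun_apply (snd (deriv_at ?s' ?z u)) (fst (?Z ?z)))"
      by (rule deriv_at_eq)
    have "deriv_at (sform s' Z \<circ> inv_into (cdom U) (cmap U \<phi>)) ?z = deriv_at (\<lambda>w. blinfun_apply (snd (?s' w)) (fst (?Z w))) ?z"
    proof (rule deriv_at_cong[OF cmap_open[OF U] z])
      fix w assume w: "w \<in> cmap U \<phi> ` cdom U"
      then obtain r where r: "r \<in> cdom U" "w = cmap U \<phi> r" by blast
      show "(sform s' Z \<circ> inv_into (cdom U) (cmap U \<phi>)) w = blinfun_apply (snd (?s' w)) (fst (?Z w))"
        using symplectic_rep[OF V(2) Z U r(1)] vertical_rep[OF s' U w] by (simp add: r(2) cmap_inv_cmap[OF U r(1)])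
    qed
    then have 1: "apply_vf s (sform s' Z) q = blinfun_apply (snd (?s' ?z)) (fst (deriv_at ?Z ?z (?s ?z)))
        + blinfun_apply (snd (deriv_at ?s' ?z (?s ?z))) (fst (?Z ?z))"
      using T.vf_apply_rep[OF V(1) cotangent_chart_mem[OF U] q symplectic_smooth[OF V(2) Z]] d1
      by (simp add: apply_vf_def)
    \<comment> \<open>The base component of \<open>s\<close> vanishes on the whole chart, hence so
      does its derivative; this removes one term of the bracket with \<open>Z\<close>.\<close>
    have "deriv_at (\<lambda>w. fst (?s w)) ?z = deriv_at (\<lambda>w. 0) ?z"
      by (rule deriv_at_cong[OF cmap_open[OF U] z vertical_rep[OF s U]])
    then have "fst (deriv_at ?s ?z u) = 0" for u
      using deriv_at_eq[OF bounded_linear.has_derivative[OF bounded_linear_fst rep_has_derivative[OF V(1) U z]]]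
      by (metis frechet_derivative_const)
    then have 2: "sform s' (lie_bracket s Z) q = blinfun_apply (snd (?s' ?z)) (fst (deriv_at ?Z ?z (?s ?z)))"
      using symplectic_rep[OF V(2) T.lie_bracket_vector_field[OF V(1) Z] U q] vertical_rep[OF s' U z]
      by (simp add: T.vf_rep_lie_bracket[OF V(1) Z cotangent_chart_mem[OF U] z] blinfun.diff_right)
    show ?thesis by (simp add: lie_derivative_def 1 2 t_def)
  qed
  obtain W where W: "W \<in> VT" "\<And>Z q. Z \<in> VT \<Longrightarrow> q \<in> points (cotangent_bundle N) \<Longrightarrow> sform W Z q = lie_derivative s (sform s') Z q"
    "\<And>U \<phi> q. (U, \<phi>) \<in> N \<Longrightarrow> q \<in> cdom U \<Longrightarrow> rep U \<phi> W (cmap U \<phi> q) = t (U, \<phi>) (cmap U \<phi> q)"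
    using symplectic_sharp[of t "\<lambda>Z q. lie_derivative s (sform s') Z q", OF t_smooth \<alpha>] by blast
  have "W \<in> vertical_fields N" by (rule vertical_fieldI[OF W(1)]) (simp add: W(3) t_def)
  moreover have "sform W Z = lie_derivative s (sform s') Z" if Z: "Z \<in> VT" for Z
  proof
    fix q
    have "lie_derivative s (sform s') Z \<in> FT"
      unfolding lie_derivative_def
      by (intro T.smooth_function_diff T.apply_vf_smooth symplectic_smooth T.lie_bracket_vector_field V Z)
    then show "sform W Z q = lie_derivative s (sform s') Z q"
      using W(2)[OF Z, of q] symplectic_smooth[OF W(1) Z] T.smooth_function_outside[of "sform W Z" q]
        T.smooth_function_outside[of "lie_derivative s (sform s') Z" q]
      by (cases "q \<in> points (cotangent_bundle N)") simp_all
  qed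
  ultimately show ?thesis by blast
qed

end

section \<open>The first homology of the vertical algebroid\<close>

lemma quotient_class_add:
  fixes B :: "'v::real_vector set"
  assumes B: "subspace B"
  shows "quotient_class B (x + y) = coset_add (quotient_class B x) (quotient_class B y)"
proof
  show "quotient_class B (x + y) \<subseteq> coset_add (quotient_class B x) (quotient_class B y)"
  proof
    fix z assume "z \<in> quotient_class B (x + y)"
    then obtain b where b: "b \<in> B" "z = x + y + b" by (auto simp: quotient_class_def)
    have "x + 0 \<in> quotient_class B x" "y + b \<in> quotient_class B y"
      using b subspace_0[OF B] unfolding quotient_class_def by blast+
    moreover have "z = (x + 0) + (y + b)" using b by (simp add: add.assoc)
    ultimately show "z \<in> coset_add (quotient_class B x) (quotient_class B y)"
      unfolding coset_add_def by blast
  qed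
  show "coset_add (quotient_class B x) (quotient_class B y) \<subseteq> quotient_class B (x + y)"
  proof
    fix z assume "z \<in> coset_add (quotient_class B x) (quotient_class B y)"
    then obtain b b' where b: "b \<in> B" "b' \<in> B" "z = (x + b) + (y + b')"
      by (auto simp: coset_add_def quotient_class_def)
    then have "z = x + y + (b + b')" by (simp add: algebra_simps)
    then show "z \<in> quotient_class B (x + y)"
      using subspace_add[OF B b(1,2)] unfolding quotient_class_def by blast
  qed
qed

text \<open>\<open>coset_scale\<close> adds \<open>B\<close> again after scaling; for
  \<open>c = 0\<close> this returns the zero coset \<open>B\<close>, where bare scaling would give
  {0}.\<close>

lemma quotient_class_scale:
  fixes B :: "'v::real_vector set"
  assumes B: "subspace B"
  shows "quotient_class B (c *\<^sub>R x) = coset_scale B c (quotient_class B x)"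
proof
  show "quotient_class B (c *\<^sub>R x) \<subseteq> coset_scale B c (quotient_class B x)"
  proof
    fix z assume "z \<in> quotient_class B (c *\<^sub>R x)"
    then obtain b where b: "b \<in> B" "z = c *\<^sub>R x + b" by (auto simp: quotient_class_def)
    have "x + 0 \<in> quotient_class B x" using subspace_0[OF B] unfolding quotient_class_def by blast
    then have "x \<in> quotient_class B x" by simp
    then show "z \<in> coset_scale B c (quotient_class B x)" using b unfolding coset_scale_def by blast
  qed
  show "coset_scale B c (quotient_class B x) \<subseteq> quotient_class B (c *\<^sub>R x)"
  proof
    fix z assume "z \<in> coset_scale B c (quotient_class B x)"
    then obtain b b' where b: "b \<in> B" "b' \<in> B" "z = c *\<^sub>R (x + b) + b'"
      by (auto simp: coset_scale_def quotient_class_def)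
    then have "z = c *\<^sub>R x + (c *\<^sub>R b + b')" by (simp add: algebra_simps)
    then show "z \<in> quotient_class B (c *\<^sub>R x)"
      using subspace_add[OF B subspace_scale[OF B b(1)] b(2)] unfolding quotient_class_def by blast
  qed
qed

lemma quotient_class_eqD:
  fixes B :: "'v::real_vector set"
  assumes B: "subspace B" and eq: "quotient_class B x = quotient_class B y"
  shows "x - y \<in> B"
proof -
  have "x + 0 \<in> quotient_class B x" using subspace_0[OF B] unfolding quotient_class_def by blast
  then have "x \<in> quotient_class B y" using eq by simp
  then show ?thesis by (auto simp: quotient_class_def)
qed

section \<open>The Koszul-Vinberg algebra, its chains and boundaries\<close>

context cotangent
begin

abbreviation "VF \<equiv> vertical_fields N"
abbreviation vmult (infixl "\<star>" 70) where "s \<star> s' \<equiv> vertical_mult N s s'"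

lemma vertical_VT: "s \<in> VF \<Longrightarrow> s \<in> VT"
  by (simp add: vertical_fields_def)

text \<open>The local solution and nondegeneracy settle the definite description; from here on the
  product is used through its pairing with the symplectic form.\<close>

lemma vertical_mult_correct:
  assumes "s \<in> VF" "s' \<in> VF"
  shows vertical_mult_vertical: "s \<star> s' \<in> VF"
    and vertical_mult_sform: "Z \<in> VT \<Longrightarrow> sform (s \<star> s') Z = apply_vf s (sform s' Z) - sform s' (lie_bracket s Z)"
proof -
  have "\<exists>!t. t \<in> VF \<and> (\<forall>Y\<in>VT. inner_product t sform Y = lie_derivative s (inner_product s' sform) Y)"
  proof (rule ex_ex1I)
    have "inner_product s' sform = sform s'" by (simp add: inner_product_def)
    then show "\<exists>t. t \<in> VF \<and> (\<forall>Y\<in>VT. inner_product t sform Y = lie_derivative s (inner_product s' sform) Y)"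
      using vertical_mult_exists[OF assms] by (simp add: inner_product_def)
    show "t = u" if "t \<in> VF \<and> (\<forall>Y\<in>VT. inner_product t sform Y = lie_derivative s (inner_product s' sform) Y)"
      "u \<in> VF \<and> (\<forall>Y\<in>VT. inner_product u sform Y = lie_derivative s (inner_product s' sform) Y)" for t u
      using that by (intro symplectic_nondegenerate) (auto simp: vertical_VT inner_product_def)
  qed
  from theI'[OF this]
  have *: "s \<star> s' \<in> VF \<and> (\<forall>Y\<in>VT. inner_product (s \<star> s') sform Y = lie_derivative s (inner_product s' sform) Y)"
    unfolding vertical_mult_def .
  show "s \<star> s' \<in> VF" using * by blast
  show "sform (s \<star> s') Z = apply_vf s (sform s' Z) - sform s' (lie_bracket s Z)" if "Z \<in> VT"
    using * that by (simp add: inner_product_def lie_derivative_def)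
qed

lemma liouville_add:
  assumes "X \<in> VT" "Y \<in> VT"
  shows "liou (X + Y) = liou X + liou Y"
proof
  fix q
  show "liou (X + Y) q = (liou X + liou Y) q"
  proof (cases "q \<in> points (cotangent_bundle N)")
    case True
    then obtain U \<phi> where U: "(U, \<phi>) \<in> N" "q \<in> cdom U" using cotangent_points_chart by blast
    show ?thesis
      using T.vf_rep_add[OF assms cotangent_chart_mem[OF U(1)] U(2)]
      by (simp add: liouville_rep[OF assms(1) U] liouville_rep[OF assms(2) U]
          liouville_rep[OF T.vector_field_add[OF assms] U] blinfun.add_right)
  qed (simp add: liouville_def)
qed

lemma liouville_scale:
  assumes "X \<in> VT"
  shows "liou (r *\<^sub>R X) = r *\<^sub>R liou X"
proof
  fix q
  show "liou (r *\<^sub>R X) q = (r *\<^sub>R liou X) q"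
  proof (cases "q \<in> points (cotangent_bundle N)")
    case True
    then obtain U \<phi> where U: "(U, \<phi>) \<in> N" "q \<in> cdom U" using cotangent_points_chart by blast
    show ?thesis
      using T.vf_rep_scale[OF assms cotangent_chart_mem[OF U(1)] U(2)]
      by (simp add: liouville_rep[OF assms U] scaleR_fun_apply
          liouville_rep[OF T.vector_field_scale[OF assms] U] blinfun.scaleR_right)
  qed (simp add: liouville_def scaleR_fun_def)
qed

lemma symplectic_anti: "X \<in> VT \<Longrightarrow> Y \<in> VT \<Longrightarrow> sform X Y = - sform Y X"
proof -
  assume XY: "X \<in> VT" "Y \<in> VT"
  have "lie_bracket X Y = (-1) *\<^sub>R lie_bracket Y X" by (simp add: T.lie_bracket_anti[OF XY])
  then have "liou (lie_bracket X Y) = - liou (lie_bracket Y X)"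
    using liouville_scale[OF T.lie_bracket_vector_field[OF XY(2,1)], of "-1"] by simp
  then show ?thesis by (simp add: symplectic_eq)
qed

lemma symplectic_add_right:
  "X \<in> VT \<Longrightarrow> Y \<in> VT \<Longrightarrow> Z \<in> VT \<Longrightarrow> sform X (Y + Z) = sform X Y + sform X Z"
  by (simp add: symplectic_eq liouville_add T.lie_bracket_add_right T.lie_bracket_vector_field
      apply_vf_add_left T.apply_vf_add_right liouville_smooth)

lemma symplectic_scale_right:
  "X \<in> VT \<Longrightarrow> Y \<in> VT \<Longrightarrow> sform X (r *\<^sub>R Y) = r *\<^sub>R sform X Y"
  by (simp add: symplectic_eq liouville_scale T.lie_bracket_scale_right T.lie_bracket_vector_field
      apply_vf_scale_left T.apply_vf_scale_right liouville_smooth scaleR_diff_right)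

lemma symplectic_add_left:
  "X \<in> VT \<Longrightarrow> Y \<in> VT \<Longrightarrow> Z \<in> VT \<Longrightarrow> sform (X + Y) Z = sform X Z + sform Y Z"
  by (simp add: symplectic_anti[of _ Z] symplectic_add_right T.vector_field_add)

lemma symplectic_scale_left:
  "X \<in> VT \<Longrightarrow> Z \<in> VT \<Longrightarrow> sform (r *\<^sub>R X) Z = r *\<^sub>R sform X Z"
  by (simp add: symplectic_anti[of _ Z] symplectic_scale_right T.vector_field_scale)

text \<open>Replaces the pointwise condition on \<open>dproj\<close> by annihilation of pullbacks,
  which is visibly stable under sums, multiples and brackets with a lift.\<close>

lemma vertical_apply_pull: "s \<in> VT \<Longrightarrow> s \<in> VF \<longleftrightarrow> (\<forall>f\<in>smooth_functions N. apply_vf s (pull f) = 0)"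
proof -
  assume s: "s \<in> VT"
  have "dproj N (s q) = 0 \<longleftrightarrow> (\<forall>f\<in>smooth_functions N. s q (pull f) = 0)" for q
    by (auto simp: fun_eq_iff dproj_eq)
  moreover have "s q f = 0" if "q \<notin> points (cotangent_bundle N)" for q f
    by (simp add: T.vector_field_outside[OF s that])
  ultimately show ?thesis using s by (auto simp: vertical_fields_def apply_vf_def fun_eq_iff)
qed

lemma vertical_zero: "0 \<in> VF"
  using T.vector_field_zero by (simp add: vertical_apply_pull apply_vf_zero_left)

lemma vertical_add: "s \<in> VF \<Longrightarrow> s' \<in> VF \<Longrightarrow> s + s' \<in> VF"
  using vertical_apply_pull[of s] vertical_apply_pull[of s'] vertical_apply_pull[of "s + s'"]
  by (simp add: vertical_VT T.vector_field_add apply_vf_add_left)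

lemma vertical_scale: "s \<in> VF \<Longrightarrow> r *\<^sub>R s \<in> VF"
  using vertical_apply_pull[of s] vertical_apply_pull[of "r *\<^sub>R s"]
  by (simp add: vertical_VT T.vector_field_scale apply_vf_scale_left)

text \<open>Turns identities between products of vertical fields into computations with functions,
  by pairing both sides with an arbitrary \<open>Z\<close>.\<close>

lemma vertical_eqI:
  "t \<in> VF \<Longrightarrow> u \<in> VF \<Longrightarrow> (\<And>Z. Z \<in> VT \<Longrightarrow> sform t Z = sform u Z) \<Longrightarrow> t = u"
  by (intro symplectic_nondegenerate vertical_VT)

lemmas vertical_closed = vertical_VT vertical_add vertical_scale vertical_mult_vertical
  T.lie_bracket_vector_field T.vector_field_add T.vector_field_scale T.apply_vf_smooth symplectic_smooth

lemma vertical_mult_add_right: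
  assumes "s \<in> VF" "t \<in> VF" "u \<in> VF"
  shows "s \<star> (t + u) = s \<star> t + s \<star> u"
  by (rule vertical_eqI) (simp_all add: assms vertical_closed vertical_mult_sform symplectic_add_left T.apply_vf_add_right)

lemma vertical_mult_scale_right:
  assumes "s \<in> VF" "t \<in> VF"
  shows "s \<star> (r *\<^sub>R t) = r *\<^sub>R (s \<star> t)"
  by (rule vertical_eqI) (simp_all add: assms vertical_closed vertical_mult_sform symplectic_scale_left T.apply_vf_scale_right scaleR_diff_right)

lemma vertical_mult_add_left:
  assumes "s \<in> VF" "t \<in> VF" "u \<in> VF"
  shows "(s + t) \<star> u = s \<star> u + t \<star> u"
  by (rule vertical_eqI) (simp_all add: assms vertical_closed vertical_mult_sform symplectic_add_left
      symplectic_add_right apply_vf_add_left T.lie_bracket_add_left)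

lemma vertical_mult_scale_left:
  assumes "s \<in> VF" "u \<in> VF"
  shows "(r *\<^sub>R s) \<star> u = r *\<^sub>R (s \<star> u)"
  by (rule vertical_eqI) (simp_all add: assms vertical_closed vertical_mult_sform symplectic_scale_left
      symplectic_scale_right apply_vf_scale_left T.lie_bracket_scale_left scaleR_diff_right)

abbreviation "G \<equiv> kv_algebra N"
abbreviation kvm (infixl "\<odot>" 70) where "a \<odot> b \<equiv> kv_mult N a b"

lemma kv_algebra_iff: "a \<in> G \<longleftrightarrow> fst a \<in> VF \<and> snd a \<in> FT"
  by (simp add: kv_algebra_def mem_Times_iff)

lemma kv_algebra_subspace: "subspace G"
  by (rule subspaceI)
    (auto simp: kv_algebra_iff vertical_zero vertical_add vertical_scale T.smooth_function_zero
      T.smooth_function_add T.smooth_function_scale)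

lemma kv_mult_closed: "a \<in> G \<Longrightarrow> b \<in> G \<Longrightarrow> a \<odot> b \<in> G"
  by (simp add: kv_algebra_iff kv_mult_def vertical_closed T.smooth_function_mult T.smooth_function_add)

lemma kv_mult_add_right: "a \<in> G \<Longrightarrow> b \<in> G \<Longrightarrow> c \<in> G \<Longrightarrow> a \<odot> (b + c) = a \<odot> b + a \<odot> c"
  by (simp add: kv_algebra_iff kv_mult_def prod_eq_iff vertical_closed vertical_mult_add_right
      T.apply_vf_add_right ring_distribs)

lemma fun_mult_scale: "f * (r *\<^sub>R g) = r *\<^sub>R (f * g :: 'b \<Rightarrow> real)" "(r *\<^sub>R f) * g = r *\<^sub>R (f * g :: 'b \<Rightarrow> real)"
  by (auto simp: scaleR_fun_def fun_eq_iff)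

lemma kv_mult_scale_right: "a \<in> G \<Longrightarrow> b \<in> G \<Longrightarrow> a \<odot> (r *\<^sub>R b) = r *\<^sub>R (a \<odot> b)"
  by (simp add: kv_algebra_iff kv_mult_def prod_eq_iff vertical_closed vertical_mult_scale_right
      T.apply_vf_scale_right fun_mult_scale scaleR_add_right)

lemma kv_mult_add_left: "a \<in> G \<Longrightarrow> b \<in> G \<Longrightarrow> c \<in> G \<Longrightarrow> (a + b) \<odot> c = a \<odot> c + b \<odot> c"
  by (simp add: kv_algebra_iff kv_mult_def prod_eq_iff vertical_closed vertical_mult_add_left
      apply_vf_add_left ring_distribs)

lemma kv_mult_scale_left: "a \<in> G \<Longrightarrow> c \<in> G \<Longrightarrow> (r *\<^sub>R a) \<odot> c = r *\<^sub>R (a \<odot> c)"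
  by (simp add: kv_algebra_iff kv_mult_def prod_eq_iff vertical_closed vertical_mult_scale_left
      apply_vf_scale_left fun_mult_scale scaleR_add_right)

lemma kv_mult_zero_right: "a \<in> G \<Longrightarrow> a \<odot> 0 = 0"
  using kv_mult_scale_right[of a 0 0] subspace_0[OF kv_algebra_subspace] by simp

lemma chains0_subspace: "subspace (chains0 N)"
proof (rule subspaceI)
  show "0 \<in> chains0 N"
    by (simp add: chains0_def subspace_0[OF kv_algebra_subspace] kv_mult_zero_right kv_mult_closed)
  show "c + d \<in> chains0 N" if "c \<in> chains0 N" "d \<in> chains0 N" for c d
    using that by (simp add: chains0_def subspace_add[OF kv_algebra_subspace] kv_mult_add_right kv_mult_closed)
  show "r *\<^sub>R c \<in> chains0 N" if "c \<in> chains0 N" for r c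
    using that by (simp add: chains0_def subspace_scale[OF kv_algebra_subspace] kv_mult_scale_right kv_mult_closed)
qed

text \<open>Makes the operations on cosets those of a quotient vector space. The boundary operator
  is linear because the product is bilinear.\<close>

lemma boundaries1_subspace: "subspace (boundaries1 N)"
proof (rule subspaceI)
  have G: "c \<in> G" if "c \<in> chains0 N" for c using that by (simp add: chains0_def)
  have add: "delta0 N (c + d) = delta0 N c + delta0 N d" if "c \<in> chains0 N" "d \<in> chains0 N" for c d
    using G[OF that(1)] G[OF that(2)]
    by (auto simp: delta0_def fun_eq_iff kv_mult_add_right kv_mult_add_left)
  have scale: "delta0 N (r *\<^sub>R c) = r *\<^sub>R delta0 N c" if "c \<in> chains0 N" for r c
    using G[OF that]
    by (auto simp: delta0_def scaleR_fun_apply scaleR_diff_right fun_eq_iff kv_mult_scale_right kv_mult_scale_left scaleR_add_right)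
  show "\<theta> + \<eta> \<in> boundaries1 N" if "\<theta> \<in> boundaries1 N" "\<eta> \<in> boundaries1 N" for \<theta> \<eta>
    using that subspace_add[OF chains0_subspace] by (auto simp: boundaries1_def simp flip: add)
  show sc: "r *\<^sub>R \<theta> \<in> boundaries1 N" if "\<theta> \<in> boundaries1 N" for r \<theta>
    using that subspace_scale[OF chains0_subspace] by (auto simp: boundaries1_def simp flip: scale)
  have "delta0 N 0 \<in> boundaries1 N" using subspace_0[OF chains0_subspace] by (simp add: boundaries1_def)
  from sc[OF this, of 0] show "0 \<in> boundaries1 N" by simp
qed

section \<open>Cotangent lifts act by derivations\<close>

lemma lift_VT: "is_cotangent_lift N X Y \<Longrightarrow> Y \<in> VT"
  by (simp add: is_cotangent_lift_def)

lemma lift_liouville: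
  assumes "is_cotangent_lift N X Y" "Z \<in> VT"
  shows "apply_vf Y (liou Z) = liou (lie_bracket Y Z)"
  using assms by (simp add: is_cotangent_lift_def lie_derivative_def)

text \<open>Preservation of the Liouville form passes to its differential: in the invariant formula,
  \<open>Y\<close> is commuted past \<open>A\<close> and \<open>B\<close> and the bracket term is
  settled by the Jacobi identity.\<close>

lemma lift_symplectic:
  assumes Y: "is_cotangent_lift N X Y" and A: "A \<in> VT" and B: "B \<in> VT"
  shows "apply_vf Y (sform A B) = sform (lie_bracket Y A) B + sform A (lie_bracket Y B)"
proof -
  note V = lift_VT[OF Y]
  have *: "apply_vf Y (apply_vf A f) = apply_vf (lie_bracket Y A) f + apply_vf A (apply_vf Y f)"
    if "A \<in> VT" "f \<in> FT" for A f using T.apply_lie_bracket[OF V that] by simp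
  show ?thesis
    using V A B
    by (simp add: symplectic_eq T.apply_vf_diff_right vertical_closed liouville_smooth T.smooth_function_diff
        * lift_liouville[OF Y] T.lie_bracket_jacobi[OF V A B] liouville_add)
qed

lemma lift_apply_pull:
  assumes Y: "is_cotangent_lift N X Y" and f: "f \<in> smooth_functions N"
  shows "apply_vf Y (pull f) = pull (apply_vf X f)"
proof
  fix q
  show "apply_vf Y (pull f) q = pull (apply_vf X f) q"
  proof (cases "q \<in> points (cotangent_bundle N)")
    case True
    then have "dproj N (Y q) f = X (fst q) f" using Y by (simp add: is_cotangent_lift_def)
    then show ?thesis using f True by (simp add: dproj_eq apply_vf_def pull_def)
  next
    case False
    then show ?thesis using T.vector_field_outside[OF lift_VT[OF Y]] by (simp add: apply_vf_def pull_def)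
  qed
qed

text \<open>\<open>Y\<close> maps pullbacks to pullbacks and \<open>s\<close> annihilates them, so
  both terms of the commutator vanish on pullbacks.\<close>

lemma lift_bracket_vertical:
  assumes X: "X \<in> vector_fields N" and Y: "is_cotangent_lift N X Y" and s: "s \<in> VF"
  shows "lie_bracket Y s \<in> VF"
proof -
  note V = lift_VT[OF Y] vertical_VT[OF s]
  have "apply_vf s (pull f) = 0" if "f \<in> smooth_functions N" for f
    using s vertical_apply_pull[OF V(2)] that by blast
  then have "apply_vf (lie_bracket Y s) (pull f) = 0" if f: "f \<in> smooth_functions N" for f
    using T.apply_vf_diff_right[OF V(1) T.smooth_function_zero T.smooth_function_zero]
    by (simp add: T.apply_lie_bracket[OF V pull_smooth[OF f]] lift_apply_pull[OF Y f] f apply_vf_smooth[OF X f])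
  then show ?thesis using vertical_apply_pull[OF T.lie_bracket_vector_field[OF V]] by blast
qed

text \<open>Every ingredient of the equation defining the product is natural: \<open>Y\<close>
  preserves the symplectic form, and commuting it past \<open>s\<close> produces brackets that the
  Jacobi identity collects.\<close>

lemma lift_vertical_mult:
  assumes X: "X \<in> vector_fields N" and Y: "is_cotangent_lift N X Y" and s: "s \<in> VF" and t: "t \<in> VF"
  shows "lie_bracket Y (s \<star> t) = lie_bracket Y s \<star> t + s \<star> lie_bracket Y t"
proof (rule vertical_eqI)
  note V = lift_VT[OF Y] vertical_VT[OF s] vertical_VT[OF t]
  note b = lift_bracket_vertical[OF X Y]
  show "lie_bracket Y (s \<star> t) \<in> VF" "lie_bracket Y s \<star> t + s \<star> lie_bracket Y t \<in> VF"
    using s t b by (simp_all add: vertical_closed)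
  fix Z assume Z: "Z \<in> VT"
  \<comment> \<open>Oriented so that brackets with \<open>Y\<close> leave the first slot of the
    form; both sides then reduce to expressions in \<open>sform t\<close>.\<close>
  have bracket: "sform (lie_bracket Y A) B = apply_vf Y (sform A B) - sform A (lie_bracket Y B)"
    if "A \<in> VT" "B \<in> VT" for A B using lift_symplectic[OF Y that] by simp
  have "sform (lie_bracket Y (s \<star> t)) Z
      = apply_vf Y (apply_vf s (sform t Z)) - apply_vf Y (sform t (lie_bracket s Z))
        - apply_vf s (sform t (lie_bracket Y Z)) + sform t (lie_bracket s (lie_bracket Y Z))"
    using s t V Z by (simp add: bracket vertical_closed vertical_mult_sform T.apply_vf_diff_right T.smooth_function_diff)
  also have "\<dots> = sform (lie_bracket Y s \<star> t + s \<star> lie_bracket Y t) Z"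
    using s t V Z b
    by (simp add: bracket vertical_closed vertical_mult_sform symplectic_add_left T.apply_vf_diff_right T.smooth_function_diff
        T.apply_lie_bracket T.lie_bracket_jacobi[OF V(1,2) Z] symplectic_add_right)
  finally show "sform (lie_bracket Y (s \<star> t)) Z = sform (lie_bracket Y s \<star> t + s \<star> lie_bracket Y t) Z" .
qed

text \<open>The cycle condition is the Leibniz rule for the product. On functions it combines the
  ordinary product rule with the commutator formula for the bracket of \<open>Y\<close> with
  \<open>fst a\<close>.\<close>

lemma lie_action_cycle:
  assumes X: "X \<in> vector_fields N" and Y: "is_cotangent_lift N X Y"
  shows "lie_action N Y \<in> cycles1 N"
proof -
  note V = lift_VT[OF Y]
  have G: "lie_action N Y a \<in> G" if "a \<in> G" for a
    using that lift_bracket_vertical[OF X Y] V by (simp add: lie_action_def kv_algebra_iff T.apply_vf_smooth)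
  have "linear_map_on G (lie_action N Y)"
    unfolding linear_map_on_def
  proof (intro conjI ballI allI)
    show "lie_action N Y (a + b) = lie_action N Y a + lie_action N Y b" if "a \<in> G" "b \<in> G" for a b
      using that V subspace_add[OF kv_algebra_subspace that]
      by (simp add: lie_action_def kv_algebra_iff prod_eq_iff T.lie_bracket_add_right vertical_VT T.apply_vf_add_right)
    show "lie_action N Y (r *\<^sub>R a) = r *\<^sub>R lie_action N Y a" if "a \<in> G" for r a
      using that V subspace_scale[OF kv_algebra_subspace that]
      by (simp add: lie_action_def kv_algebra_iff prod_eq_iff T.lie_bracket_scale_right vertical_VT T.apply_vf_scale_right)
  qed
  then have "lie_action N Y \<in> chains1 N" using G by (simp add: chains1_def lie_action_def)
  moreover have "lie_action N Y (a \<odot> b) = a \<odot> lie_action N Y b + lie_action N Y a \<odot> b" if a: "a \<in> G" and b: "b \<in> G" for a b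
  proof -
    have v: "fst a \<in> VF" "snd a \<in> FT" "fst b \<in> VF" "snd b \<in> FT" using a b by (simp_all add: kv_algebra_iff)
    have "apply_vf Y (apply_vf (fst a) (snd b)) = apply_vf (lie_bracket Y (fst a)) (snd b) + apply_vf (fst a) (apply_vf Y (snd b))"
      using T.apply_lie_bracket[OF V vertical_VT[OF v(1)] v(4)] by simp
    then show ?thesis
      using a b v kv_mult_closed[OF a b] V
      by (simp add: lie_action_def kv_mult_def prod_eq_iff lift_vertical_mult[OF X Y] T.apply_vf_add_right
          T.apply_vf_mult_right T.smooth_function_mult T.apply_vf_smooth vertical_VT)
  qed
  then have "delta1 N (lie_action N Y) = 0" by (auto simp: delta1_def fun_eq_iff)
  ultimately show ?thesis by (simp add: cycles1_def)
qed

text \<open>The projection determines \<open>liou Y\<close>, and Cartan's formula then determines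
  \<open>i(Y)\<omega>\<close>.\<close>

lemma lift_unique:
  assumes Y: "is_cotangent_lift N X Y" and Y': "is_cotangent_lift N X Y'"
  shows "Y = Y'"
proof (rule symplectic_nondegenerate[OF lift_VT[OF Y] lift_VT[OF Y']])
  fix Z assume Z: "Z \<in> VT"
  have "liou Y = liou Y'" using Y Y' by (auto simp: is_cotangent_lift_def liouville_def)
  moreover have "sform Y Z = - apply_vf Z (liou Y)" "sform Y' Z = - apply_vf Z (liou Y')"
    using Y Y' Z by (simp_all add: is_cotangent_lift_def liouville_lie_derivative eq_neg_iff_add_eq_0)
  ultimately show "sform Y Z = sform Y' Z" by simp
qed

section \<open>Linearity of the lift and the kernel of the map to homology\<close>

lemma dproj_add: "dproj N (v + w) = dproj N v + dproj N w"
  by (auto simp: dproj_eq fun_eq_iff)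

lemma dproj_scale: "dproj N (r *\<^sub>R v) = r *\<^sub>R dproj N v"
  by (auto simp: dproj_eq fun_eq_iff scaleR_fun_def)

lemma lift_add:
  assumes A: "is_cotangent_lift N X A" and B: "is_cotangent_lift N Y B"
  shows "is_cotangent_lift N (X + Y) (A + B)"
  using A B unfolding is_cotangent_lift_def
  by (simp add: dproj_add T.vector_field_add lie_derivative_def apply_vf_add_left T.lie_bracket_add_left
      liouville_add T.lie_bracket_vector_field)

lemma lift_scale:
  assumes A: "is_cotangent_lift N X A"
  shows "is_cotangent_lift N (r *\<^sub>R X) (r *\<^sub>R A)"
  using A unfolding is_cotangent_lift_def
  by (simp add: dproj_scale scaleR_fun_apply T.vector_field_scale lie_derivative_def
      apply_vf_scale_left T.lie_bracket_scale_left liouville_scale T.lie_bracket_vector_field)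

lemma lie_action_add:
  "A \<in> VT \<Longrightarrow> B \<in> VT \<Longrightarrow> lie_action N (A + B) = lie_action N A + lie_action N B"
  by (auto simp: lie_action_def fun_eq_iff kv_algebra_iff vertical_VT T.lie_bracket_add_left apply_vf_add_left)

lemma lie_action_scale:
  "A \<in> VT \<Longrightarrow> lie_action N (r *\<^sub>R A) = r *\<^sub>R lie_action N A"
  by (rule ext) (simp add: lie_action_def kv_algebra_iff vertical_VT T.lie_bracket_scale_left
      apply_vf_scale_left scaleR_fun_apply)

lemma lift_boundary_zero:
  assumes X: "X \<in> vector_fields N" and Y: "is_cotangent_lift N X Y" and bd: "lie_action N Y \<in> boundaries1 N"
  shows "X = 0"
proof -
  obtain c where c: "c \<in> G" "lie_action N Y = delta0 N c" using bd by (auto simp: boundaries1_def chains0_def)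
  have "apply_vf Y f = apply_vf (fst c) f" if f: "f \<in> FT" for f
  proof -
    \<comment> \<open>In the boundary at this element the two products of \<open>f\<close> with
      \<open>snd c\<close> cancel because functions commute, and the derivative along 0 vanishes;
      only \<open>fst c\<close> applied to \<open>f\<close> remains.\<close>
    have a: "(0, f) \<in> G" using f vertical_zero by (simp add: kv_algebra_iff)
    have "snd (lie_action N Y (0, f)) = snd (delta0 N c (0, f))" using c(2) by simp
    then show ?thesis using a by (simp add: lie_action_def delta0_def kv_mult_def apply_vf_zero_left mult.commute)
  qed
  moreover have "fst c \<in> VT" using c(1) by (simp add: kv_algebra_iff vertical_VT)
  ultimately have "Y = fst c" by (intro T.vector_field_eqI[OF lift_VT[OF Y]])
  then have "Y \<in> VF" using c(1) by (simp add: kv_algebra_iff)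
  then have z: "pull (apply_vf X f) = 0" if "f \<in> smooth_functions N" for f
    using vertical_apply_pull[OF lift_VT[OF Y]] lift_apply_pull[OF Y that] that by simp
  show "X = 0"
  proof (rule vector_field_eqI[OF X vector_field_zero])
    fix f assume f: "f \<in> smooth_functions N"
    have "apply_vf X f x = 0" for x
    proof (cases "x \<in> points N")
      case True
      \<comment> \<open>The zero section reaches every point of the base, so vanishing of the
        pullback gives vanishing on \<open>M\<close>.\<close>
      have "(x, 0) \<in> points (cotangent_bundle N)"
        using True by (simp add: points_cotangent cotangent_space_def linear_map_on_def)
      then show ?thesis using fun_cong[OF z[OF f], of "(x, 0)"] by (simp add: pull_def)
    next
      case False
      then show ?thesis by (simp add: apply_vf_def vector_field_outside[OF X])
    qed
    then show "apply_vf X f = apply_vf 0 f" by (simp add: apply_vf_zero_left fun_eq_iff)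
  qed
qed

end

theorem mainTheorem8:
  fixes M :: "('a, 'e::real_normed_vector) atlas"
  assumes "smooth_manifold M"
  shows "\<exists>\<Phi> :: 'a vfield \<Rightarrow> ('a kv \<Rightarrow> 'a kv) set.
    \<Phi> \<in> vector_fields M \<rightarrow> homology1 M \<and>
    (\<forall>X\<in>vector_fields M. \<forall>Y\<in>vector_fields M. \<Phi> (X + Y) = coset_add (\<Phi> X) (\<Phi> Y)) \<and>
    (\<forall>c. \<forall>X\<in>vector_fields M. \<Phi> (c *\<^sub>R X) = coset_scale (boundaries1 M) c (\<Phi> X)) \<and>
    inj_on \<Phi> (vector_fields M) \<and>
    (\<forall>X\<in>vector_fields M.
       (\<exists>Y. is_cotangent_lift M X Y) \<and>
       (\<forall>Y. is_cotangent_lift M X Y \<longrightarrow> \<Phi> X = quotient_class (boundaries1 M) (lie_action M Y)))"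
proof -
  interpret cotangent M
    by (rule cotangent.intro[OF smooth_manifold_bump_atlas[OF assms]])
  let ?B = "boundaries1 M" and ?V = "vector_fields M"
  note B = boundaries1_subspace
  \<comment> \<open>The choice is immaterial because lifts are unique. This is the sense in which
    the map is canonical, and it lets sums and multiples of chosen lifts compute the values on sums
    and multiples.\<close>
  define lift where "lift X = (SOME Y. is_cotangent_lift M X Y)" for X
  have lift: "is_cotangent_lift M X (lift X)" if "X \<in> ?V" for X
    unfolding lift_def by (rule someI_ex[OF cotangent_lift_exists[OF that]])
  define \<Phi> where "\<Phi> X = quotient_class ?B (lie_action M (lift X))" for X
  have \<Phi>: "\<Phi> X = quotient_class ?B (lie_action M Y)" if "X \<in> ?V" "is_cotangent_lift M X Y" for X Y
    using lift_unique[OF lift[OF that(1)] that(2)] by (simp add: \<Phi>_def)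
  have add: "\<Phi> (X + Y) = coset_add (\<Phi> X) (\<Phi> Y)" if "X \<in> ?V" "Y \<in> ?V" for X Y
    using \<Phi>[OF vector_field_add[OF that] lift_add[OF lift[OF that(1)] lift[OF that(2)]]]
    by (simp add: \<Phi>_def quotient_class_add[OF B, symmetric] lie_action_add lift_VT[OF lift[OF that(1)]] lift_VT[OF lift[OF that(2)]])
  have scale: "\<Phi> (c *\<^sub>R X) = coset_scale ?B c (\<Phi> X)" if "X \<in> ?V" for c X
    using \<Phi>[OF vector_field_scale[OF that] lift_scale[OF lift[OF that]]]
    by (simp add: \<Phi>_def quotient_class_scale[OF B, symmetric] lie_action_scale lift_VT[OF lift[OF that]])
  have "inj_on \<Phi> ?V"
  proof (rule inj_onI)
    fix X Y assume X: "X \<in> ?V" and Y: "Y \<in> ?V" and eq: "\<Phi> X = \<Phi> Y"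
    have V: "lift X \<in> VT" "lift Y \<in> VT" using lift_VT[OF lift[OF X]] lift_VT[OF lift[OF Y]] .
    \<comment> \<open>Injectivity is reduced to the kernel: the difference of the lifts is a lift of
      the difference, written with the scalar -1 to fit the closure lemmas.\<close>
    have "is_cotangent_lift M (X + (-1) *\<^sub>R Y) (lift X + (-1) *\<^sub>R lift Y)"
      by (rule lift_add[OF lift[OF X] lift_scale[OF lift[OF Y]]])
    moreover have "lie_action M (lift X + (-1) *\<^sub>R lift Y) = lie_action M (lift X) - lie_action M (lift Y)"
      using lie_action_add[OF V(1) T.vector_field_scale[OF V(2), of "-1"]] lie_action_scale[OF V(2), of "-1"] by simp
    moreover have "lie_action M (lift X) - lie_action M (lift Y) \<in> ?B"
      using quotient_class_eqD[OF B] eq by (simp add: \<Phi>_def)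
    ultimately have "X + (-1) *\<^sub>R Y = 0"
      using lift_boundary_zero[OF vector_field_add[OF X vector_field_scale[OF Y, of "-1"]]] by simp
    then show "X = Y" by simp
  qed
  moreover have "\<Phi> \<in> ?V \<rightarrow> homology1 M"
    using lie_action_cycle[OF _ lift] by (auto simp: \<Phi>_def homology1_def)
  ultimately show ?thesis
    using add scale \<Phi> cotangent_lift_exists by (intro exI[of _ \<Phi>]) blast
qed

end
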